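(* Let $n$ be an integer with $n = 7$, $n=10$, or $n \ge 12$, and $n \neq 14$. Then $\tilde H_{\nu_n}(M_n)$ is a nontrivial elementary $3$-group.
   Context: For a positive integer $n$, $[n]=\{1,\dots,n\}$. The matching complex $M_n$ is the abstract simplicial complex whose vertices are the edges of the complete graph on vertex set $[n]$ (i.e. the $2$-element subsets of $[n]$) and whose faces are the sets of pairwise disjoint edges (matchings). $\nu_n = \lfloor \frac{n+1}{3}\rfloor - 1$. $\tilde H_*$ denotes reduced simplicial homology with integer coefficients. An elementary $3$-group is an abelian group in which every element $x$ satisfies $3x=0$. *)

theory Defs
  imports Complex_Main "HOL-Algebra.Free_Abelian_Groups" "HOL-Library.Disjoint_Sets"
begin

section \<open>Reduced simplicial homology with integer coefficients\<close>

text \<open>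
  A simplicial complex is given by its set \<open>K\<close> of faces, a downward closed family of finite
  vertex sets that contains the empty face.  Simplices are oriented by a linear order \<open>r\<close> on
  the vertices: a face \<open>{v\<^sub>0 < \<dots> < v\<^sub>p}\<close> stands for the oriented simplex
  \<open>[v\<^sub>0, \<dots>, v\<^sub>p]\<close>.  Degrees are integers; the empty face spans degree \<open>-1\<close>,
  which makes the chain complex the augmented one and its homology reduced.
\<close>

definition abstract_simplicial_complex :: "'v set set \<Rightarrow> bool" where
  "abstract_simplicial_complex K \<longleftrightarrow>
     {} \<in> K \<and> (\<forall>\<sigma>\<in>K. finite \<sigma>) \<and> (\<forall>\<sigma>\<in>K. \<forall>\<tau>. \<tau> \<subseteq> \<sigma> \<longrightarrow> \<tau> \<in> K)"

definition faces :: "'v set set \<Rightarrow> int \<Rightarrow> 'v set set" where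
  "faces K p = {\<sigma> \<in> K. int (card \<sigma>) = p + 1}"

definition simplicial_chain_group :: "'v set set \<Rightarrow> int \<Rightarrow> ('v set \<Rightarrow>\<^sub>0 int) monoid" where
  "simplicial_chain_group K p = free_Abelian_group (faces K p)"

text \<open>
  The linear extension of
  \<open>[v\<^sub>0, \<dots>, v\<^sub>p] \<mapsto> \<Sum>\<^sub>i (-1)\<^sup>i [v\<^sub>0, \<dots>, v\<^sub>i\<^sub>-\<^sub>1, v\<^sub>i\<^sub>+\<^sub>1, \<dots>, v\<^sub>p]\<close>;
  the position \<open>i\<close> of a vertex \<open>v\<close> in \<open>\<sigma>\<close> is the number of vertices
  of \<open>\<sigma>\<close> strictly below \<open>v\<close>.
\<close>

definition simplicial_boundary ::
    "('v \<times> 'v) set \<Rightarrow> ('v set \<Rightarrow>\<^sub>0 int) \<Rightarrow> ('v set \<Rightarrow>\<^sub>0 int)" where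
  "simplicial_boundary r =
     frag_extend (\<lambda>\<sigma>. \<Sum>v\<in>\<sigma>.
       frag_cmul ((-1) ^ card {w \<in> \<sigma>. (w, v) \<in> r \<and> w \<noteq> v}) (frag_of (\<sigma> - {v})))"

definition simplicial_cycles ::
    "('v \<times> 'v) set \<Rightarrow> 'v set set \<Rightarrow> int \<Rightarrow> ('v set \<Rightarrow>\<^sub>0 int) set" where
  "simplicial_cycles r K p =
     kernel (simplicial_chain_group K p) (simplicial_chain_group K (p - 1)) (simplicial_boundary r)"

definition simplicial_boundaries ::
    "('v \<times> 'v) set \<Rightarrow> 'v set set \<Rightarrow> int \<Rightarrow> ('v set \<Rightarrow>\<^sub>0 int) set" where
  "simplicial_boundaries r K p =
     simplicial_boundary r ` carrier (simplicial_chain_group K (p + 1))"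

definition reduced_simplicial_homology_group ::
    "('v \<times> 'v) set \<Rightarrow> 'v set set \<Rightarrow> int \<Rightarrow> ('v set \<Rightarrow>\<^sub>0 int) set monoid" where
  "reduced_simplicial_homology_group r K p =
     subgroup_generated (simplicial_chain_group K p) (simplicial_cycles r K p)
       Mod simplicial_boundaries r K p"


section \<open>Matching complexes\<close>

definition complete_graph_edges :: "nat \<Rightarrow> nat set set" where
  "complete_graph_edges n = {e. e \<subseteq> {1..n} \<and> card e = 2}"

definition matching_complex :: "nat \<Rightarrow> nat set set set" where
  "matching_complex n = {M. M \<subseteq> complete_graph_edges n \<and> disjoint M}"

definition nu :: "nat \<Rightarrow> int" where
  "nu n = \<lfloor>(real n + 1) / 3\<rfloor> - 1"


section \<open>Elementary 3-groups\<close>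

definition elementary_3_group :: "('a, 'b) monoid_scheme \<Rightarrow> bool" where
  "elementary_3_group G \<longleftrightarrow> comm_group G \<and> (\<forall>x\<in>carrier G. x [^]\<^bsub>G\<^esub> (3::nat) = \<one>\<^bsub>G\<^esub>)"


section \<open>Well-definedness\<close>

lemma abstract_simplicial_complex_matching_complex:
  "abstract_simplicial_complex (matching_complex n)"
proof -
  have "complete_graph_edges n \<subseteq> Pow {1..n}"
    by (auto simp: complete_graph_edges_def)
  then have "finite (complete_graph_edges n)"
    using finite_subset by blast
  then show ?thesis
    unfolding abstract_simplicial_complex_def matching_complex_def
    by (auto intro: finite_subset pairwise_subset)
qed

lemma vertices_matching_complex: "\<Union> (matching_complex n) = complete_graph_edges n"
proof -
  have "{e} \<in> matching_complex n" if "e \<in> complete_graph_edges n" for e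
    using that by (simp add: matching_complex_def)
  then show ?thesis
    unfolding matching_complex_def by blast
qed

lemma simplicial_boundary_of:
  "simplicial_boundary r (frag_of \<sigma>) =
     (\<Sum>v\<in>\<sigma>. frag_cmul ((-1) ^ card {w \<in> \<sigma>. (w, v) \<in> r \<and> w \<noteq> v}) (frag_of (\<sigma> - {v})))"
  by (simp add: simplicial_boundary_def)

lemma simplicial_boundary_add:
  "simplicial_boundary r (a + b) = simplicial_boundary r a + simplicial_boundary r b"
  by (simp add: simplicial_boundary_def frag_extend_add)

lemma carrier_simplicial_chain_group:
  "carrier (simplicial_chain_group K p) = {c. Poly_Mapping.keys c \<subseteq> faces K p}"
  by (simp add: simplicial_chain_group_def free_Abelian_group_def)

lemma simplicial_boundary_in_chain_group:
  assumes "abstract_simplicial_complex K" "c \<in> carrier (simplicial_chain_group K p)"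
  shows "simplicial_boundary r c \<in> carrier (simplicial_chain_group K (p - 1))"
proof -
  have "Poly_Mapping.keys (frag_cmul a (frag_of (\<sigma> - {v}))) \<subseteq> faces K (p - 1)"
    if "\<sigma> \<in> faces K p" "v \<in> \<sigma>" for \<sigma> v a
  proof -
    have "\<sigma> - {v} \<in> faces K (p - 1)"
      using that assms(1) card.remove[of \<sigma> v]
      by (auto simp: faces_def abstract_simplicial_complex_def)
    then show ?thesis
      using keys_cmul[of a "frag_of (\<sigma> - {v})"] by auto
  qed
  then have "Poly_Mapping.keys (\<Sum>v\<in>\<sigma>. frag_cmul (a v) (frag_of (\<sigma> - {v}))) \<subseteq> faces K (p - 1)"
    if "\<sigma> \<in> faces K p" for \<sigma> and a :: "'a \<Rightarrow> int"
    using that keys_sum[of "\<lambda>v. frag_cmul (a v) (frag_of (\<sigma> - {v}))" \<sigma>] by blast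
  then show ?thesis
    using assms(2) keys_frag_extend[of _ c]
    unfolding carrier_simplicial_chain_group simplicial_boundary_def by fastforce
qed

lemma simplicial_boundary_boundary:
  assumes K: "abstract_simplicial_complex K" and r: "linear_order_on (\<Union>K) r"
    and c: "c \<in> carrier (simplicial_chain_group K p)"
  shows "simplicial_boundary r (simplicial_boundary r c) = 0"
proof -
  have face: "simplicial_boundary r (simplicial_boundary r (frag_of \<sigma>)) = 0"
    if \<sigma>: "\<sigma> \<in> K" for \<sigma>
  proof -
    have fin: "finite \<sigma>" and sub: "\<sigma> \<subseteq> \<Union>K"
      using K \<sigma> by (auto simp: abstract_simplicial_complex_def)
    define pos where "pos \<tau> v = card {w \<in> \<tau>. (w, v) \<in> r \<and> w \<noteq> v}" for \<tau> v
    define t where "t u v = frag_cmul ((-1) ^ pos \<sigma> u * (-1) ^ pos (\<sigma> - {u}) v)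
      (frag_of (\<sigma> - {u} - {v}))" for u v
    have anti: "t u v = - t v u"
      if "u \<in> \<sigma>" "v \<in> \<sigma>" "(u, v) \<in> r" "u \<noteq> v" for u v
    proof -
      have vu: "(v, u) \<notin> r"
        using r that by (auto simp: order_on_defs antisym_def)
      have "{w \<in> \<sigma>. (w, v) \<in> r \<and> w \<noteq> v} = insert u {w \<in> \<sigma> - {u}. (w, v) \<in> r \<and> w \<noteq> v}"
        using that by auto
      then have "pos \<sigma> v = Suc (pos (\<sigma> - {u}) v)"
        unfolding pos_def using fin by simp
      moreover have "{w \<in> \<sigma> - {v}. (w, u) \<in> r \<and> w \<noteq> u} = {w \<in> \<sigma>. (w, u) \<in> r \<and> w \<noteq> u}"
        using vu by auto
      then have "pos (\<sigma> - {v}) u = pos \<sigma> u"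
        unfolding pos_def by simp
      moreover have "\<sigma> - {u} - {v} = \<sigma> - {v} - {u}" by auto
      ultimately show ?thesis
        by (simp add: t_def mult.commute)
    qed
    have lin: "frag_extend f (sum g A) = (\<Sum>i\<in>A. frag_extend f (g i))" if "finite A"
      for f :: "'a set \<Rightarrow> ('a set \<Rightarrow>\<^sub>0 int)" and g :: "'a \<Rightarrow> _" and A
      using that by (induction A rule: finite_induct) (auto simp: frag_extend_add)
    have "simplicial_boundary r (simplicial_boundary r (frag_of \<sigma>)) =
        (\<Sum>u\<in>\<sigma>. \<Sum>v\<in>\<sigma> - {u}. t u v)"
      unfolding simplicial_boundary_def using fin
      by (simp add: lin frag_extend_cmul frag_cmul_sum t_def pos_def)
    also have "\<dots> = (\<Sum>(u,v)\<in>(SIGMA u:\<sigma>. \<sigma> - {u}). t u v)"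
      using fin by (simp add: sum.Sigma)
    also have "(SIGMA u:\<sigma>. \<sigma> - {u}) = {(u,v). u \<in> \<sigma> \<and> v \<in> \<sigma> \<and> u \<noteq> v \<and> (u,v) \<in> r}
        \<union> {(u,v). u \<in> \<sigma> \<and> v \<in> \<sigma> \<and> u \<noteq> v \<and> (v,u) \<in> r}" (is "_ = ?A \<union> ?B")
    proof -
      have "(u,v) \<in> r \<or> (v,u) \<in> r" if "u \<in> \<sigma>" "v \<in> \<sigma>" "u \<noteq> v" for u v
        using r sub that unfolding linear_order_on_def total_on_def by blast
      then show ?thesis by auto
    qed
    also have "(\<Sum>(u,v)\<in>?A \<union> ?B. t u v) = (\<Sum>(u,v)\<in>?A. t u v) + (\<Sum>(u,v)\<in>?B. t u v)"
    proof (rule sum.union_disjoint)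
      show "finite ?A" "finite ?B"
        by (rule finite_subset[of _ "\<sigma> \<times> \<sigma>"]; use fin in auto)+
      show "?A \<inter> ?B = {}"
        using r by (auto simp: order_on_defs antisym_def)
    qed
    also have "(\<Sum>(u,v)\<in>?B. t u v) = (\<Sum>(u,v)\<in>?A. t v u)"
      by (rule sum.reindex_bij_witness[of _ prod.swap prod.swap]) auto
    also have "(\<Sum>(u,v)\<in>?A. t u v) = (\<Sum>(u,v)\<in>?A. - t v u)"
      by (rule sum.cong) (auto intro: anti)
    also have "\<dots> + (\<Sum>(u,v)\<in>?A. t v u) = 0"
      by (simp add: sum.distrib[symmetric] case_prod_unfold)
    finally show ?thesis .
  qed
  have "Poly_Mapping.keys c \<subseteq> K"
    using c by (auto simp: carrier_simplicial_chain_group faces_def)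
  then show ?thesis
  proof (induction c rule: frag_induction)
    case zero
    then show ?case by (simp add: simplicial_boundary_def)
  next
    case (one x)
    then show ?case by (rule face)
  next
    case (diff a b)
    then show ?case by (simp add: simplicial_boundary_def frag_extend_diff)
  qed
qed

lemma comm_group_reduced_simplicial_homology_group:
  assumes K: "abstract_simplicial_complex K" and r: "linear_order_on (\<Union>K) r"
  shows "comm_group (reduced_simplicial_homology_group r K p)"
proof -
  let ?C = "simplicial_chain_group K"
  have grp: "group (?C q)" "comm_group (?C q)" for q
    by (simp_all add: simplicial_chain_group_def abelian_free_Abelian_group)
  have hom: "group_hom (?C q) (?C (q - 1)) (simplicial_boundary r)" for q
    using grp(1) simplicial_boundary_in_chain_group[OF K, of _ q r]
    by (auto simp: group_hom_def group_hom_axioms_def hom_def simplicial_boundary_add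
        simplicial_chain_group_def)
  let ?Z = "subgroup_generated (?C p) (simplicial_cycles r K p)"
  have Z: "subgroup (simplicial_cycles r K p) (?C p)"
    unfolding simplicial_cycles_def by (rule group_hom.subgroup_kernel[OF hom])
  have B: "subgroup (simplicial_boundaries r K p) (?C p)"
    using group_hom.img_is_subgroup[OF hom[of "p + 1"]] by (simp add: simplicial_boundaries_def)
  have carZ: "carrier ?Z = simplicial_cycles r K p"
    by (rule subgroup.carrier_subgroup_generated_subgroup[OF Z])
  have "one (?C q) = 0" for q
    by (simp add: simplicial_chain_group_def)
  then have "simplicial_boundaries r K p \<subseteq> simplicial_cycles r K p"
    using B simplicial_boundary_boundary[OF K r, of _ "p + 1"]
    by (auto simp: simplicial_cycles_def simplicial_boundaries_def kernel_def
        dest: subgroup.mem_carrier)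
  then have "subgroup (simplicial_boundaries r K p) ?Z"
    using B carZ by (simp add: group.subgroup_of_subgroup_generated grp(1))
  moreover have "comm_group ?Z"
    using grp by (simp add: group.abelian_subgroup_generated)
  ultimately show ?thesis
    unfolding reduced_simplicial_homology_group_def
    by (rule comm_group.abelian_FactGroup[rotated])
qed

end

theory Submission
  imports Defs
begin

text \<open>
  Matchings on a set of \<open>n\<close> vertices are counted by their number of edges; the degree of the
  theorem belongs to \<open>k = (n + 1) div 3\<close> edges. A product of chains on disjoint vertex sets is
  written by juxtaposition.

  Splitting. Fix two vertices \<open>p\<close> and \<open>q\<close>. A cycle without edges at \<open>p\<close> or \<open>q\<close> other than \<open>pq\<close> lies
  in a cone, so a cycle \<open>c\<close> is governed by its coefficients of the edges \<open>px\<close> and \<open>qy\<close> and of the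
  pairs \<open>px qy\<close>. The latter are cycles on \<open>n - 4\<close> vertices with two edges less. When they bound,
  \<open>c\<close> is homologous to a sum of terms \<open>(px - pq) a\<close> and \<open>(qx - pq) b\<close> with cycles \<open>a, b\<close> on
  \<open>n - 3\<close> vertices (\<open>blk_decomposition\<close>). Induction shows that cycles with fewer than \<open>k\<close> edges
  bound (\<open>cycles_below_bound\<close>), and that for \<open>n = 3m\<close> and \<open>n = 3m + 1\<close> the homology is generated by
  products of \<open>m\<close> blocks \<open>ab - ac\<close> on disjoint triples (\<open>cycles_generated\<close>). For \<open>n = 3m + 2\<close> the
  coefficients of \<open>px qy\<close> are such products on \<open>3 (m - 1) + 1\<close> vertices; with the help of their spare
  vertex \<open>px qy\<close> can be completed to a pentagon, and the homology is generated by products of one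
  pentagon and \<open>m - 1\<close> blocks (\<open>cycles_pent_generated\<close>).

  Torsion. Two blocks and a spare vertex occupy seven vertices. In the presence of the spare vertex,
  every transposition of the seven acts by \<open>-1\<close>, so the three rotations of a block are homologous;
  as they add up to zero, the product is annihilated by 3 (\<open>three_blk2_bounds\<close>). This settles
  \<open>n = 3m + 1\<close>. In the other cases there is no spare vertex, and the claim is that the product of
  four blocks on twelve vertices is annihilated by 3 (\<open>three_blk4_bounds\<close>); together with a pentagon
  this takes 17 vertices. Three times the product of two blocks is homologous to a combination of
  hexagons, each of which omits one of the six vertices (\<open>three_blk2_hexa\<close>). Multiplied by the two
  remaining blocks, a hexagon therefore has a spare vertex, so these products are annihilated by 3
  and alternate in the seven vertices outside of the hexagon. Modulo 3 a hexagon with sides \<open>u, v\<close>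
  and \<open>x, y, t\<close> behaves like \<open>(u - v) \<and> (x + y + t)\<close>, and the combination in question like
  \<open>U \<and> T + T \<and> U = 0\<close>, where \<open>U\<close> and \<open>T\<close> are the sums of two complementary triples. The vanishing
  follows from two relations between hexagons, \<open>hexa_star\<close> and \<open>hexa_triangle\<close>.

  Nontriviality. Give a product of blocks \<open>ab - ac\<close> with spare vertex \<open>w\<close> the volume form
  \<open>\<dots> \<and> a \<and> b \<and> c \<and> \<dots> \<and> w\<close>. If a combination of such products bounds, then its volume is
  divisible by 3 (\<open>bounding_combination_threefold\<close>), whereas a single product has volume \<open>\<plusminus>1\<close>. So a
  product of blocks does not bound on \<open>3m + 1\<close> vertices, nor, a fortiori, on the \<open>3m\<close> vertices that
  it uses. On \<open>3m + 5\<close> vertices, the coefficient of two adjacent edges of a pentagon recovers a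
  product of blocks on \<open>3m + 1\<close> vertices.
\<close>

section \<open>Exterior calculus on simplicial chains\<close>

text \<open>
  Chains on finite subsets of a linearly ordered set form an exterior algebra: \<open>E e\<close> multiplies by
  the generator \<open>e\<close> from the left, and \<open>D e\<close> is the contraction with \<open>e\<close>. All signs are absorbed
  into the relations between these operators, so that no permutation has to be counted later. The same
  calculus serves twice, with edges as generators for chains of matchings, and with vertices as
  generators for volume forms. The order is total on the whole type, which frees all relations from
  side conditions on the generators.
\<close>

locale exterior =
  fixes r :: "('e \<times> 'e) set"
  assumes linear_order: "linear_order_on UNIV r"
begin

definition pos :: "'e \<Rightarrow> 'e set \<Rightarrow> nat" where
  "pos e \<sigma> = card {w \<in> \<sigma>. (w, e) \<in> r \<and> w \<noteq> e}"

definition E :: "'e \<Rightarrow> ('e set \<Rightarrow>\<^sub>0 int) \<Rightarrow> ('e set \<Rightarrow>\<^sub>0 int)" where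
  "E e = frag_extend (\<lambda>\<sigma>. if finite \<sigma> \<and> e \<notin> \<sigma>
     then frag_cmul ((-1) ^ pos e \<sigma>) (frag_of (insert e \<sigma>)) else 0)"

definition D :: "'e \<Rightarrow> ('e set \<Rightarrow>\<^sub>0 int) \<Rightarrow> ('e set \<Rightarrow>\<^sub>0 int)" where
  "D e = frag_extend (\<lambda>\<sigma>. if finite \<sigma> \<and> e \<in> \<sigma>
     then frag_cmul ((-1) ^ pos e \<sigma>) (frag_of (\<sigma> - {e})) else 0)"

abbreviation bd :: "('e set \<Rightarrow>\<^sub>0 int) \<Rightarrow> ('e set \<Rightarrow>\<^sub>0 int)" where
  "bd \<equiv> simplicial_boundary r"

text \<open>Infinite sets have cardinality 0 and would spoil the signs; the relations that involve \<open>D\<close> or the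
  boundary hold on chains supported on finite sets. On infinite sets \<open>E\<close> and \<open>D\<close> are 0.\<close>

definition finitary :: "('e set \<Rightarrow>\<^sub>0 int) \<Rightarrow> bool" where
  "finitary c \<longleftrightarrow> (\<forall>\<sigma>\<in>Poly_Mapping.keys c. finite \<sigma>)"

lemma E_linear [simp]:
  "E e 0 = 0" "E e (a + b) = E e a + E e b" "E e (a - b) = E e a - E e b" "E e (- a) = - E e a"
  by (simp_all add: E_def frag_extend_add frag_extend_diff frag_extend_minus)

lemma D_linear [simp]:
  "D e 0 = 0" "D e (a + b) = D e a + D e b" "D e (a - b) = D e a - D e b" "D e (- a) = - D e a"
  by (simp_all add: D_def frag_extend_add frag_extend_diff frag_extend_minus)

lemma bd_linear [simp]:
  "bd 0 = 0" "bd (a + b) = bd a + bd b" "bd (a - b) = bd a - bd b" "bd (- a) = - bd a"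
  by (simp_all add: simplicial_boundary_def frag_extend_add frag_extend_diff frag_extend_minus)

lemma E_cmul: "E e (frag_cmul n a) = frag_cmul n (E e a)"
  by (simp add: E_def frag_extend_cmul)

lemma D_cmul: "D e (frag_cmul n a) = frag_cmul n (D e a)"
  by (simp add: D_def frag_extend_cmul)

lemma bd_cmul: "bd (frag_cmul n a) = frag_cmul n (bd a)"
  by (simp add: simplicial_boundary_def frag_extend_cmul)

lemma E_sum: "E e (sum f I) = (\<Sum>i\<in>I. E e (f i))"
  by (induction I rule: infinite_finite_induct) auto

lemma D_sum: "D e (sum f I) = (\<Sum>i\<in>I. D e (f i))"
  by (induction I rule: infinite_finite_induct) auto

lemma bd_sum: "bd (sum f I) = (\<Sum>i\<in>I. bd (f i))"
  by (induction I rule: infinite_finite_induct) auto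

lemma finitary_induct [consumes 1, case_names basis diff]:
  assumes "finitary c" and "\<And>\<sigma>. finite \<sigma> \<Longrightarrow> P (frag_of \<sigma>)"
    and "\<And>a b. P a \<Longrightarrow> P b \<Longrightarrow> P (a - b)"
  shows "P c"
proof -
  have "Poly_Mapping.keys c \<subseteq> {\<sigma>. finite \<sigma>}"
    using assms(1) by (auto simp: finitary_def)
  then show ?thesis
  proof (induction c rule: frag_induction)
    case zero
    show ?case using assms(3)[OF assms(2)[of "{}"] assms(2)[of "{}"]] by simp
  qed (use assms in auto)
qed

lemma finitary_closed [simp]:
  "finitary 0" "finitary (frag_of \<sigma>) \<longleftrightarrow> finite \<sigma>" "finitary a \<Longrightarrow> finitary (- a)"
  "finitary a \<Longrightarrow> finitary b \<Longrightarrow> finitary (a + b)"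
  "finitary a \<Longrightarrow> finitary b \<Longrightarrow> finitary (a - b)"
  "finitary a \<Longrightarrow> finitary (frag_cmul n a)"
  using keys_diff[of a b] Poly_Mapping.keys_add[of a b] by (auto simp: finitary_def keys_frag_of)

lemma E_basis: "finite \<sigma> \<Longrightarrow> e \<notin> \<sigma> \<Longrightarrow>
    E e (frag_of \<sigma>) = frag_cmul ((-1) ^ pos e \<sigma>) (frag_of (insert e \<sigma>))"
  and E_basis_mem: "e \<in> \<sigma> \<Longrightarrow> E e (frag_of \<sigma>) = 0"
  by (simp_all add: E_def)

lemma D_basis: "finite \<sigma> \<Longrightarrow> e \<in> \<sigma> \<Longrightarrow>
    D e (frag_of \<sigma>) = frag_cmul ((-1) ^ pos e \<sigma>) (frag_of (\<sigma> - {e}))"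
  and D_basis_nonmem: "e \<notin> \<sigma> \<Longrightarrow> D e (frag_of \<sigma>) = 0"
  by (simp_all add: D_def)

lemma finitary_E [simp]: "finitary c \<Longrightarrow> finitary (E e c)"
proof (induction c rule: finitary_induct)
  case (basis \<sigma>)
  then show ?case by (simp add: E_def)
qed auto

lemma finitary_D [simp]: "finitary c \<Longrightarrow> finitary (D e c)"
proof (induction c rule: finitary_induct)
  case (basis \<sigma>)
  then show ?case by (simp add: D_def)
qed auto

lemma order_total: "e \<noteq> f \<Longrightarrow> ((e, f) \<in> r) \<longleftrightarrow> (f, e) \<notin> r"
  using linear_order
  by (auto simp: linear_order_on_def total_on_def partial_order_on_def antisym_def)

lemma pos_insert:
  assumes "finite \<sigma>" "f \<notin> \<sigma>" "e \<noteq> f"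
  shows "pos e (insert f \<sigma>) = (if (f, e) \<in> r then Suc (pos e \<sigma>) else pos e \<sigma>)"
proof -
  have "{w \<in> insert f \<sigma>. (w, e) \<in> r \<and> w \<noteq> e} =
      (if (f, e) \<in> r then insert f {w \<in> \<sigma>. (w, e) \<in> r \<and> w \<noteq> e} else {w \<in> \<sigma>. (w, e) \<in> r \<and> w \<noteq> e})"
    using assms by auto
  then show ?thesis using assms by (simp add: pos_def)
qed

lemma pos_insert_self: "pos e (insert e \<sigma>) = pos e \<sigma>"
  unfolding pos_def by (rule arg_cong[where f = card]) auto

lemma pos_diff:
  assumes "finite \<sigma>" "f \<in> \<sigma>" "e \<noteq> f"
  shows "pos e \<sigma> = (if (f, e) \<in> r then Suc (pos e (\<sigma> - {f})) else pos e (\<sigma> - {f}))"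
  using pos_insert[of "\<sigma> - {f}" f e] assms by (simp add: insert_absorb)

lemma pos_diff_self: "pos e (\<sigma> - {e}) = pos e \<sigma>"
  unfolding pos_def by (rule arg_cong[where f = card]) auto

lemma E_E_same [simp]: "E e (E e c) = 0"
proof -
  have "E e (E e (frag_of \<sigma>)) = 0" for \<sigma>
    by (cases "finite \<sigma> \<and> e \<notin> \<sigma>") (auto simp: E_def frag_extend_cmul)
  then show ?thesis
    by (intro frag_induction[of c UNIV "\<lambda>c. E e (E e c) = 0"]) auto
qed

lemma E_anticommute: "E e (E f c) = - E f (E e c)"
proof (cases "e = f")
  case False
  have "E e (E f (frag_of \<sigma>)) = - E f (E e (frag_of \<sigma>))" for \<sigma>
  proof (cases "finite \<sigma> \<and> e \<notin> \<sigma> \<and> f \<notin> \<sigma>")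
    case True
    with False order_total[OF False] show ?thesis
      by (auto simp: E_basis E_cmul pos_insert insert_commute mult.commute)
  next
    case False
    then show ?thesis
      by (cases "finite \<sigma>"; cases "e \<in> \<sigma>"; cases "f \<in> \<sigma>")
         (simp_all add: E_def frag_extend_cmul)
  qed
  then show ?thesis
    by (intro frag_induction[of c UNIV "\<lambda>c. E e (E f c) = - E f (E e c)"]) auto
qed simp

lemma D_E_same: "finitary c \<Longrightarrow> D e (E e c) + E e (D e c) = c"
proof (induction c rule: finitary_induct)
  case (basis \<sigma>)
  then show ?case
    by (cases "e \<in> \<sigma>")
       (simp_all add: E_basis D_basis E_basis_mem D_basis_nonmem E_cmul D_cmul pos_insert_self
          pos_diff_self insert_absorb flip: power_add mult_2)
next
  case (diff a b)
  have "D e (E e (a - b)) + E e (D e (a - b)) =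
      (D e (E e a) + E e (D e a)) - (D e (E e b) + E e (D e b))"
    by (simp add: algebra_simps)
  then show ?case using diff by simp
qed

lemma D_E:
  assumes "e \<noteq> f"
  shows "finitary c \<Longrightarrow> D e (E f c) = - E f (D e c)"
proof (induction c rule: finitary_induct)
  case (basis \<sigma>)
  show ?case
  proof (cases "e \<in> \<sigma> \<and> f \<notin> \<sigma>")
    case True
    have ins: "insert f \<sigma> - {e} = insert f (\<sigma> - {e})"
      using assms by auto
    have pos_f: "pos f \<sigma> = (if (e, f) \<in> r then Suc (pos f (\<sigma> - {e})) else pos f (\<sigma> - {e}))"
      using basis True assms by (intro pos_diff) auto
    have pos_e: "pos e (insert f \<sigma>) = (if (f, e) \<in> r then Suc (pos e \<sigma>) else pos e \<sigma>)"
      using basis True assms by (intro pos_insert) auto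
    have "D e (E f (frag_of \<sigma>)) =
        frag_cmul ((-1) ^ pos f \<sigma> * (-1) ^ pos e (insert f \<sigma>)) (frag_of (insert f (\<sigma> - {e})))"
      using basis True by (simp add: E_basis D_basis D_cmul ins)
    moreover have "E f (D e (frag_of \<sigma>)) =
        frag_cmul ((-1) ^ pos e \<sigma> * (-1) ^ pos f (\<sigma> - {e})) (frag_of (insert f (\<sigma> - {e})))"
      using basis True by (simp add: E_basis D_basis E_cmul)
    ultimately show ?thesis
      using order_total[OF assms] by (cases "(e, f) \<in> r") (simp_all add: pos_e pos_f mult.commute)
  next
    case False
    then show ?thesis using basis assms
      by (cases "e \<in> \<sigma>"; cases "f \<in> \<sigma>")
         (simp_all add: E_basis D_basis E_basis_mem D_basis_nonmem E_cmul D_cmul)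
  qed
qed auto

lemma D_D_anticommute: "finitary c \<Longrightarrow> D e (D f c) = - D f (D e c)"
proof (induction c rule: finitary_induct)
  case (basis \<sigma>)
  show ?case
  proof (cases "e = f")
    case True
    then show ?thesis using basis
      by (cases "e \<in> \<sigma>") (simp_all add: D_basis D_basis_nonmem D_cmul)
  next
    case ef: False
    show ?thesis
    proof (cases "e \<in> \<sigma> \<and> f \<in> \<sigma>")
      case True
      have pos_f: "pos f \<sigma> = (if (e, f) \<in> r then Suc (pos f (\<sigma> - {e})) else pos f (\<sigma> - {e}))"
        using basis True ef by (intro pos_diff) auto
      have pos_e: "pos e \<sigma> = (if (f, e) \<in> r then Suc (pos e (\<sigma> - {f})) else pos e (\<sigma> - {f}))"
        using basis True ef by (intro pos_diff) auto
      have comm: "\<sigma> - {f} - {e} = \<sigma> - {e} - {f}" by auto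
      have "D e (D f (frag_of \<sigma>)) =
          frag_cmul ((-1) ^ pos f \<sigma> * (-1) ^ pos e (\<sigma> - {f})) (frag_of (\<sigma> - {e} - {f}))"
        using basis True ef by (simp add: D_basis D_cmul comm)
      moreover have "D f (D e (frag_of \<sigma>)) =
          frag_cmul ((-1) ^ pos e \<sigma> * (-1) ^ pos f (\<sigma> - {e})) (frag_of (\<sigma> - {e} - {f}))"
        using basis True ef by (simp add: D_basis D_cmul)
      ultimately show ?thesis
        using order_total[OF ef] by (cases "(e, f) \<in> r") (simp_all add: pos_e pos_f mult.commute)
    next
      case False
      then show ?thesis using basis ef
        by (cases "e \<in> \<sigma>"; cases "f \<in> \<sigma>") (simp_all add: D_basis D_basis_nonmem D_cmul)
    qed
  qed
qed auto

lemma D_eq_0: "(\<And>\<sigma>. \<sigma> \<in> Poly_Mapping.keys c \<Longrightarrow> e \<notin> \<sigma>) \<Longrightarrow> D e c = 0"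
  unfolding D_def by (intro frag_extend_eq_0) auto

lemma bd_basis: "finite \<sigma> \<Longrightarrow> bd (frag_of \<sigma>) = (\<Sum>v\<in>\<sigma>. D v (frag_of \<sigma>))"
  by (auto simp: simplicial_boundary_of D_basis pos_def intro!: sum.cong)

lemma finitary_bd [simp]: "finitary c \<Longrightarrow> finitary (bd c)"
proof (induction c rule: finitary_induct)
  case (basis \<sigma>)
  have "finitary (sum f A)" if "\<And>v. finitary (f v)" for f :: "'e \<Rightarrow> _" and A
    using that by (induction A rule: infinite_finite_induct) auto
  then show ?case using basis by (simp add: bd_basis)
qed auto

text \<open>Multiplication by \<open>e\<close> is a contracting homotopy of the full simplex. The boundary is the sum of all
  contractions, and \<open>E e\<close> anticommutes with all of them except \<open>D e\<close>.\<close>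

lemma bd_E: "finitary c \<Longrightarrow> bd (E e c) = c - E e (bd c)"
proof (induction c rule: finitary_induct)
  case (basis \<sigma>)
  have DE: "D v (E e (frag_of \<sigma>)) = - E e (D v (frag_of \<sigma>))" if "v \<noteq> e" for v
    using that basis by (intro D_E) auto
  show ?case
  proof (cases "e \<in> \<sigma>")
    case True
    have "E e (D v (frag_of \<sigma>)) = 0" if "v \<noteq> e" for v
      using DE[OF that] True by (simp add: E_basis_mem)
    then have "E e (bd (frag_of \<sigma>)) = E e (D e (frag_of \<sigma>))"
      using True basis by (simp add: bd_basis E_sum sum.remove[of \<sigma> e])
    also have "\<dots> = frag_of \<sigma>"
      using D_E_same[of "frag_of \<sigma>" e] True basis by (simp add: E_basis_mem)
    finally show ?thesis using True by (simp add: E_basis_mem)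
  next
    case False
    have "bd (E e (frag_of \<sigma>)) = (\<Sum>v\<in>insert e \<sigma>. D v (E e (frag_of \<sigma>)))"
      using False basis by (simp add: E_basis bd_cmul bd_basis D_cmul frag_cmul_sum del: sum.insert)
    also have "\<dots> = D e (E e (frag_of \<sigma>)) + (\<Sum>v\<in>\<sigma>. D v (E e (frag_of \<sigma>)))"
      using False basis by simp
    also have "(\<Sum>v\<in>\<sigma>. D v (E e (frag_of \<sigma>))) = (\<Sum>v\<in>\<sigma>. - E e (D v (frag_of \<sigma>)))"
      using False by (intro sum.cong refl DE) auto
    also have "D e (E e (frag_of \<sigma>)) = frag_of \<sigma>"
      using D_E_same[of "frag_of \<sigma>" e] False basis by (simp add: D_basis_nonmem)
    finally show ?thesis using basis by (simp add: bd_basis E_sum sum_negf)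
  qed
qed simp

lemma D_bd: "finitary c \<Longrightarrow> D e (bd c) = - bd (D e c)"
proof (induction c rule: finitary_induct)
  case (basis \<sigma>)
  have "D e (bd (frag_of \<sigma>)) = (\<Sum>v\<in>\<sigma>. D e (D v (frag_of \<sigma>)))"
    using basis by (simp add: bd_basis D_sum)
  also have "\<dots> = - (\<Sum>v\<in>\<sigma>. D v (D e (frag_of \<sigma>)))"
    unfolding sum_negf[symmetric] using basis
    by (intro sum.cong refl D_D_anticommute) simp
  also have "(\<Sum>v\<in>\<sigma>. D v (D e (frag_of \<sigma>))) = bd (D e (frag_of \<sigma>))"
  proof (cases "e \<in> \<sigma>")
    case True
    have "D e (D e (frag_of \<sigma>)) = 0"
      using True basis by (simp add: D_basis D_cmul D_basis_nonmem)
    then have "(\<Sum>v\<in>\<sigma>. D v (D e (frag_of \<sigma>))) = (\<Sum>v\<in>\<sigma> - {e}. D v (D e (frag_of \<sigma>)))"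
      using sum.remove[OF basis True, of "\<lambda>v. D v (D e (frag_of \<sigma>))"] by simp
    also have "\<dots> = bd (D e (frag_of \<sigma>))"
      using True basis by (simp add: D_basis[OF basis True] bd_cmul bd_basis D_cmul frag_cmul_sum)
    finally show ?thesis .
  qed (simp add: D_basis_nonmem)
  finally show ?case .
qed simp

text \<open>By \<open>bd_E\<close>, the square of the boundary commutes with every \<open>E e\<close>, and
  every basis element is a product of generators.\<close>

lemma bd_bd: "finitary c \<Longrightarrow> bd (bd c) = 0"
proof (induction c rule: finitary_induct)
  case (basis \<sigma>)
  then show ?case
  proof (induction \<sigma> rule: finite_induct)
    case empty
    show ?case by (simp add: simplicial_boundary_of)
  next
    case (insert e \<sigma>)
    have "bd (bd (E e (frag_of \<sigma>))) = 0"
      using insert by (simp add: bd_E)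
    then show ?case using insert by (simp add: E_basis bd_cmul)
  qed
qed auto

end

section \<open>Chains of matchings\<close>

definition matchings :: "'v set \<Rightarrow> 'v set set set" where
  "matchings V = {M. finite M \<and> disjoint M \<and> (\<forall>e\<in>M. e \<subseteq> V \<and> card e = 2)}"

lemma matchings_mono: "V \<subseteq> V' \<Longrightarrow> matchings V \<subseteq> matchings V'"
  by (auto simp: matchings_def)

lemma matchings_insert:
  assumes "M \<in> matchings (V - {a, b})" "a \<in> V" "b \<in> V" "a \<noteq> b"
  shows "insert {a, b} M \<in> matchings V"
proof -
  have "finite M" "disjoint M" and M: "\<And>e. e \<in> M \<Longrightarrow> e \<subseteq> V - {a, b} \<and> card e = 2"
    using assms(1) by (auto simp: matchings_def)
  moreover have "{a, b} \<inter> e = {}" if "e \<in> M" for e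
    using M[OF that] by blast
  then have "disjoint (insert {a, b} M)"
    using \<open>disjoint M\<close> unfolding disjoint_def by blast
  moreover have "e \<subseteq> V \<and> card e = 2" if "e \<in> insert {a, b} M" for e
    using M[of e] that assms(2-) by (cases "e = {a, b}") auto
  ultimately show ?thesis
    unfolding matchings_def by blast
qed

lemma matchings_remove:
  assumes "M \<in> matchings V" "e \<in> M"
  shows "M - {e} \<in> matchings (V - e)"
proof -
  have "finite M" "disjoint M" and M: "\<And>f. f \<in> M \<Longrightarrow> f \<subseteq> V \<and> card f = 2"
    using assms(1) by (auto simp: matchings_def)
  moreover have "f \<inter> e = {}" if "f \<in> M" "f \<noteq> e" for f
    using \<open>disjoint M\<close> that assms(2) unfolding disjoint_def by blast
  moreover have "disjoint (M - {e})"
    using \<open>disjoint M\<close> unfolding disjoint_def by blast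
  ultimately show ?thesis
    unfolding matchings_def by blast
qed

locale matching_chains = exterior r for r :: "('v set \<times> 'v set) set"
begin

text \<open>Multiplication by the edge \<open>ab\<close>, and the coefficient of \<open>ab\<close>, which is supported on the link of that
  vertex of the matching complex.\<close>

abbreviation ed :: "'v \<Rightarrow> 'v \<Rightarrow> ('v set set \<Rightarrow>\<^sub>0 int) \<Rightarrow> ('v set set \<Rightarrow>\<^sub>0 int)" where
  "ed a b \<equiv> E {a, b}"

abbreviation lk :: "'v \<Rightarrow> 'v \<Rightarrow> ('v set set \<Rightarrow>\<^sub>0 int) \<Rightarrow> ('v set set \<Rightarrow>\<^sub>0 int)" where
  "lk a b \<equiv> D {a, b}"

definition mchains :: "'v set \<Rightarrow> nat \<Rightarrow> ('v set set \<Rightarrow>\<^sub>0 int) set" where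
  "mchains V k = {c. \<forall>M\<in>Poly_Mapping.keys c. M \<in> matchings V \<and> card M = k}"

definition mcycles :: "'v set \<Rightarrow> nat \<Rightarrow> ('v set set \<Rightarrow>\<^sub>0 int) set" where
  "mcycles V k = {c \<in> mchains V k. bd c = 0}"

definition mbounds :: "'v set \<Rightarrow> nat \<Rightarrow> ('v set set \<Rightarrow>\<^sub>0 int) set" where
  "mbounds V k = bd ` mchains V (Suc k)"

lemma mchains_frag_of [simp]: "frag_of M \<in> mchains V k \<longleftrightarrow> M \<in> matchings V \<and> card M = k"
  by (simp add: mchains_def keys_frag_of)

lemma mchains_0 [simp]: "0 \<in> mchains V k"
  by (simp add: mchains_def)

lemma mchains_minus [simp]: "a \<in> mchains V k \<Longrightarrow> - a \<in> mchains V k"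
  by (simp add: mchains_def)

lemma mchains_add [simp]: "a \<in> mchains V k \<Longrightarrow> b \<in> mchains V k \<Longrightarrow> a + b \<in> mchains V k"
  using Poly_Mapping.keys_add[of a b] by (auto simp: mchains_def)

lemma mchains_diff [simp]: "a \<in> mchains V k \<Longrightarrow> b \<in> mchains V k \<Longrightarrow> a - b \<in> mchains V k"
  using keys_diff[of a b] by (auto simp: mchains_def)

lemma mchains_cmul [simp]: "a \<in> mchains V k \<Longrightarrow> frag_cmul n a \<in> mchains V k"
  by (auto simp: mchains_def)

lemma mchains_sum: "(\<And>i. i \<in> I \<Longrightarrow> f i \<in> mchains V k) \<Longrightarrow> sum f I \<in> mchains V k"
  by (induction I rule: infinite_finite_induct) auto

lemma mchains_mono: "c \<in> mchains V k \<Longrightarrow> V \<subseteq> V' \<Longrightarrow> c \<in> mchains V' k"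
  using matchings_mono[of V V'] by (auto simp: mchains_def)

lemma mchains_finitary [simp]: "c \<in> mchains V k \<Longrightarrow> finitary c"
  by (auto simp: mchains_def finitary_def matchings_def)

text \<open>A property that is closed under differences only has to be checked on single matchings.\<close>

lemma mchains_induct [consumes 1, case_names zero basis diff]:
  assumes "c \<in> mchains V k" "P 0" "\<And>M. M \<in> matchings V \<Longrightarrow> card M = k \<Longrightarrow> P (frag_of M)"
    and "\<And>a b. P a \<Longrightarrow> P b \<Longrightarrow> P (a - b)"
  shows "P c"
  by (rule frag_induction[of c "{M \<in> matchings V. card M = k}"]) (use assms in \<open>auto simp: mchains_def\<close>)

lemma ed_in_mchains:
  assumes "c \<in> mchains (V - {a, b}) k" "a \<in> V" "b \<in> V" "a \<noteq> b"
  shows "ed a b c \<in> mchains V (Suc k)"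
  using assms(1)
proof (induction c rule: mchains_induct)
  case (basis M)
  have new: "{a, b} \<notin> M" and fin: "finite M"
    using basis(1) by (auto simp: matchings_def)
  have "insert {a, b} M \<in> matchings V"
    using basis(1) assms(2-) by (intro matchings_insert)
  then show ?case
    using basis(2) new fin by (simp add: E_basis)
qed simp_all

lemma lk_in_mchains:
  assumes "c \<in> mchains V (Suc k)"
  shows "lk a b c \<in> mchains (V - {a, b}) k"
  using assms
proof (induction c rule: mchains_induct)
  case (basis M)
  show ?case
  proof (cases "{a, b} \<in> M")
    case True
    moreover have "finite M" using basis(1) by (simp add: matchings_def)
    ultimately show ?thesis
      using basis(2) matchings_remove[OF basis(1) True] by (simp add: D_basis)
  qed (simp add: D_basis_nonmem)
qed simp_all

lemma mchains_0_subset: "c \<in> mchains V 0 \<Longrightarrow> \<exists>n. c = frag_cmul n (frag_of {})"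
proof (induction c rule: mchains_induct)
  case zero
  show ?case by (rule exI[of _ 0]) simp
next
  case (basis M)
  then have "M = {}" by (auto simp: matchings_def)
  then show ?case by (intro exI[of _ 1]) simp
next
  case (diff a b)
  then show ?case by (metis frag_cmul_diff_distrib)
qed

lemma lk_mchains_0: "c \<in> mchains V 0 \<Longrightarrow> lk a b c = 0"
  by (drule mchains_0_subset) (auto simp: D_cmul D_basis_nonmem)

lemma bd_in_mchains: "c \<in> mchains V (Suc k) \<Longrightarrow> bd c \<in> mchains V k"
proof (induction c rule: mchains_induct)
  case (basis M)
  have "D e (frag_of M) \<in> mchains V k" if "e \<in> M" for e
    using that basis
    by (auto simp: D_basis matchings_def disjoint_def card_Diff_singleton)
  moreover have "finite M" using basis by (simp add: matchings_def)
  ultimately show ?case by (auto simp: bd_basis intro!: mchains_sum)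
qed auto

lemma lk_eq_0: "c \<in> mchains V k \<Longrightarrow> a \<notin> V \<or> b \<notin> V \<Longrightarrow> lk a b c = 0"
  by (intro D_eq_0) (fastforce simp: mchains_def matchings_def)

lemma lk_ed_same: "c \<in> mchains V k \<Longrightarrow> a \<notin> V \<or> b \<notin> V \<Longrightarrow> lk a b (ed a b c) = c"
  using D_E_same[of c "{a, b}"] lk_eq_0[of c V k a b] by simp

lemma mcyclesI: "c \<in> mchains V k \<Longrightarrow> bd c = 0 \<Longrightarrow> c \<in> mcycles V k"
  and mcycles_mchains [simp]: "c \<in> mcycles V k \<Longrightarrow> c \<in> mchains V k"
  and mcycles_bd [simp]: "c \<in> mcycles V k \<Longrightarrow> bd c = 0"
  by (simp_all add: mcycles_def)

lemma mcycles_finitary [simp]: "c \<in> mcycles V k \<Longrightarrow> finitary c"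
  using mchains_finitary mcycles_mchains by blast

lemma mcycles_closed [simp]:
  "0 \<in> mcycles V k" "a \<in> mcycles V k \<Longrightarrow> - a \<in> mcycles V k"
  "a \<in> mcycles V k \<Longrightarrow> b \<in> mcycles V k \<Longrightarrow> a + b \<in> mcycles V k"
  "a \<in> mcycles V k \<Longrightarrow> b \<in> mcycles V k \<Longrightarrow> a - b \<in> mcycles V k"
  by (auto intro!: mcyclesI)

lemma mcycles_sum: "(\<And>i. i \<in> I \<Longrightarrow> f i \<in> mcycles V k) \<Longrightarrow> sum f I \<in> mcycles V k"
  by (induction I rule: infinite_finite_induct) auto

lemma mcycles_mono: "c \<in> mcycles V k \<Longrightarrow> V \<subseteq> V' \<Longrightarrow> c \<in> mcycles V' k"
  using mchains_mono[of c V k V'] by (simp add: mcycles_def del: mcycles_mchains mcycles_bd)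

lemma mboundsI: "u \<in> mchains V (Suc k) \<Longrightarrow> bd u = c \<Longrightarrow> c \<in> mbounds V k"
  by (auto simp: mbounds_def)

lemma mbounds_closed [simp]:
  "0 \<in> mbounds V k" "a \<in> mbounds V k \<Longrightarrow> - a \<in> mbounds V k"
  "a \<in> mbounds V k \<Longrightarrow> b \<in> mbounds V k \<Longrightarrow> a + b \<in> mbounds V k"
  "a \<in> mbounds V k \<Longrightarrow> b \<in> mbounds V k \<Longrightarrow> a - b \<in> mbounds V k"
proof -
  show "0 \<in> mbounds V k"
    by (rule mboundsI[of 0]) simp_all
  show "- a \<in> mbounds V k" if "a \<in> mbounds V k"
    using that by (auto simp: mbounds_def intro!: image_eqI[where x = "- u" for u])
  show "a + b \<in> mbounds V k" if "a \<in> mbounds V k" "b \<in> mbounds V k"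
    using that by (auto simp: mbounds_def intro!: image_eqI[where x = "u + v" for u v])
  show "a - b \<in> mbounds V k" if "a \<in> mbounds V k" "b \<in> mbounds V k"
    using that by (auto simp: mbounds_def intro!: image_eqI[where x = "u - v" for u v])
qed

lemma mbounds_sum: "(\<And>i. i \<in> I \<Longrightarrow> f i \<in> mbounds V k) \<Longrightarrow> sum f I \<in> mbounds V k"
  by (induction I rule: infinite_finite_induct) auto

lemma mbounds_mono: "c \<in> mbounds V k \<Longrightarrow> V \<subseteq> V' \<Longrightarrow> c \<in> mbounds V' k"
  using mchains_mono[of _ V "Suc k" V'] by (auto simp: mbounds_def)

text \<open>A matching has at most one edge at \<open>p\<close>; removing the part with an edge at \<open>p\<close> leaves a chain that
  avoids \<open>p\<close>.\<close>

lemma ed_mchains_decomposition: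
  assumes "finite V" "p \<in> V" "c \<in> mchains V k"
  shows "c - (\<Sum>x\<in>V - {p}. ed p x (lk p x c)) \<in> mchains (V - {p}) k"
  using assms(3)
proof (induction c rule: mchains_induct)
  case (basis M)
  have fin: "finite M" and sub: "\<And>e. e \<in> M \<Longrightarrow> e \<subseteq> V \<and> card e = 2" and dis: "disjoint M"
    using basis(1) by (auto simp: matchings_def)
  show ?case
  proof (cases "\<exists>e\<in>M. p \<in> e")
    case True
    then obtain e where e: "e \<in> M" "p \<in> e" by blast
    then have "e \<subseteq> V" "card e = 2" using sub by auto
    then obtain y where y: "e = {p, y}" "y \<noteq> p" "y \<in> V"
      using e(2) by (auto simp: card_2_iff)
    have other: "lk p x (frag_of M) = 0" if "x \<noteq> y" for x
    proof -
      have "{p, x} \<noteq> {p, y}" using that by (auto simp: doubleton_eq_iff)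
      then have "{p, x} \<notin> M"
        using dis e(1) unfolding y(1) by (metis disjoint_def disjoint_iff insertI1)
      then show ?thesis by (simp add: D_basis_nonmem)
    qed
    have "(\<Sum>x\<in>V - {p}. ed p x (lk p x (frag_of M))) = ed p y (lk p y (frag_of M))"
      using assms(1) y other by (subst sum.remove[of _ y]) (auto intro!: sum.neutral)
    also have "\<dots> = frag_of M"
      using D_E_same[of "frag_of M" e] e y fin by (simp add: E_basis_mem)
    finally show ?thesis by simp
  next
    case False
    then have "lk p x (frag_of M) = 0" for x
      by (auto intro!: D_basis_nonmem)
    moreover have "M \<in> matchings (V - {p})"
      using False basis(1) by (auto simp: matchings_def)
    ultimately show ?thesis using basis(2) by simp
  qed
next
  case (diff a b)
  have "a - b - (\<Sum>x\<in>V - {p}. ed p x (lk p x (a - b))) =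
     (a - (\<Sum>x\<in>V - {p}. ed p x (lk p x a))) - (b - (\<Sum>x\<in>V - {p}. ed p x (lk p x b)))"
    by (simp add: sum_subtractf algebra_simps)
  then show ?case using mchains_diff[OF diff] by (simp only:)
qed auto

text \<open>Two disjoint edges multiply to a chain whose boundary is their difference.\<close>

lemma ed_homologous:
  assumes "z \<in> mcycles (V - {a, b, c, d}) k" "distinct [a, b, c, d]" "{a, b, c, d} \<subseteq> V"
  shows "ed a b z - ed c d z \<in> mbounds V (Suc k)"
proof (rule mboundsI[of "ed c d (ed a b z)"])
  have "V - {c, d} - {a, b} = V - {a, b, c, d}" by auto
  then show "ed c d (ed a b z) \<in> mchains V (Suc (Suc k))"
    using assms by (intro ed_in_mchains) auto
qed (use assms in \<open>auto simp: bd_E\<close>)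

end

section \<open>Splitting off three vertices\<close>

context matching_chains
begin

text \<open>A block: the path with the edges \<open>ab\<close> and \<open>ac\<close>, as a reduced 0-cycle, times \<open>z\<close>.\<close>

definition blk :: "'v \<Rightarrow> 'v \<Rightarrow> 'v \<Rightarrow> ('v set set \<Rightarrow>\<^sub>0 int) \<Rightarrow> ('v set set \<Rightarrow>\<^sub>0 int)" where
  "blk a b c z = ed a b z - ed a c z"

lemma blk_linear [simp]:
  "blk a b c 0 = 0" "blk a b c (y + z) = blk a b c y + blk a b c z"
  "blk a b c (y - z) = blk a b c y - blk a b c z" "blk a b c (- z) = - blk a b c z"
  by (simp_all add: blk_def algebra_simps)

lemma finitary_blk [simp]: "finitary z \<Longrightarrow> finitary (blk a b c z)"
  by (simp add: blk_def)

lemma blk_commute: "blk a b c z = - blk a c b z"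
  by (simp add: blk_def)

lemma blk_E_commute: "E e (blk a b c z) = - blk a b c (E e z)"
  by (simp add: blk_def E_anticommute[of e])

lemma blk_blk_commute: "blk a b c (blk d e f z) = - blk d e f (blk a b c z)"
  by (simp add: blk_def[of d] blk_E_commute)

lemma bd_blk: "finitary z \<Longrightarrow> bd (blk a b c z) = - blk a b c (bd z)"
  by (simp add: blk_def bd_E)

lemma blk_in_mchains:
  assumes "z \<in> mchains (V - {a, b, c}) k" "distinct [a, b, c]" "{a, b, c} \<subseteq> V"
  shows "blk a b c z \<in> mchains V (Suc k)"
proof -
  have "z \<in> mchains (V - {a, b}) k" "z \<in> mchains (V - {a, c}) k"
    by (rule mchains_mono[OF assms(1)]; blast)+
  then show ?thesis
    unfolding blk_def using assms(2-) by (intro mchains_diff ed_in_mchains) auto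
qed

lemma blk_in_mcycles:
  assumes "z \<in> mcycles (V - {a, b, c}) k" "distinct [a, b, c]" "{a, b, c} \<subseteq> V"
  shows "blk a b c z \<in> mcycles V (Suc k)"
  using assms blk_in_mchains[of z V a b c k] by (intro mcyclesI) (simp_all add: bd_blk)

lemma blk_in_mbounds:
  assumes "z \<in> mbounds (V - {a, b, c}) k" "distinct [a, b, c]" "{a, b, c} \<subseteq> V"
  shows "blk a b c z \<in> mbounds V (Suc k)"
proof -
  obtain u where u: "u \<in> mchains (V - {a, b, c}) (Suc k)" "z = bd u"
    using assms(1) by (auto simp: mbounds_def)
  then have "blk a b c z = bd (- blk a b c u)"
    using mchains_finitary[OF u(1)] by (simp add: bd_blk)
  moreover have "- blk a b c u \<in> mchains V (Suc (Suc k))"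
    using blk_in_mchains[OF u(1) assms(2,3)] by simp
  ultimately show ?thesis unfolding mbounds_def by (rule image_eqI)
qed

lemma lk_ed_other:
  assumes "z \<in> mchains W k" "{a, b} \<noteq> {c, d}" "a \<notin> W \<or> b \<notin> W"
  shows "lk a b (ed c d z) = 0"
  using assms D_E[of "{a, b}" "{c, d}" z] lk_eq_0[OF assms(1), of a b] mchains_finitary[OF assms(1)] by simp

lemma lk_in_mcycles: "c \<in> mcycles V (Suc k) \<Longrightarrow> lk a b c \<in> mcycles (V - {a, b}) k"
  by (intro mcyclesI lk_in_mchains) (simp_all add: D_bd[symmetric] flip: neg_equal_0_iff_equal)

text \<open>All matchings that occur in \<open>c\<close> either contain \<open>pq\<close> or can be extended by it, so \<open>c\<close> lies in the
  cone with apex \<open>pq\<close>.\<close>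

lemma cone_cycle_bounds:
  assumes "finite V" "p \<in> V" "q \<in> V" "p \<noteq> q" "c \<in> mcycles V k"
    and "\<And>x. x \<in> V - {p, q} \<Longrightarrow> lk p x c = 0" "\<And>x. x \<in> V - {p, q} \<Longrightarrow> lk q x c = 0"
  shows "c \<in> mbounds V k"
proof -
  define s where "s = c - ed p q (lk p q c)"
  have fin: "finitary c" and c: "c \<in> mchains V k" using assms(5) by auto
  have lk_no: "lk q x (lk p q c) = 0" for x
  proof (cases k)
    case 0
    then show ?thesis using c lk_mchains_0 by simp
  next
    case (Suc j)
    then have "lk p q c \<in> mchains (V - {p, q}) j"
      using c lk_in_mchains by simp
    then show ?thesis by (rule lk_eq_0) simp
  qed
  have "(\<Sum>x\<in>V - {p}. ed p x (lk p x c)) = ed p q (lk p q c)"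
    using assms by (subst sum.remove[of _ q]) (auto intro!: sum.neutral)
  then have s: "s \<in> mchains (V - {p}) k"
    using ed_mchains_decomposition[OF assms(1,2) c] by (simp add: s_def)
  have "lk q x s = 0" if "x \<in> V - {p} - {q}" for x
    using that assms(4,7) fin lk_no[of x] by (simp add: s_def D_E doubleton_eq_iff)
  then have "(\<Sum>x\<in>V - {p} - {q}. ed q x (lk q x s)) = 0"
    by (intro sum.neutral) simp
  then have "s \<in> mchains (V - {p} - {q}) k"
    using ed_mchains_decomposition[OF _ _ s, of q] assms by simp
  then have "ed p q s \<in> mchains V (Suc k)"
    using assms by (intro ed_in_mchains) (simp_all add: Diff_insert2[symmetric] insert_commute)
  moreover have "bd (ed p q s) = c"
    using fin assms(5) by (simp add: s_def bd_E)
  ultimately show ?thesis by (rule mboundsI)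
qed

text \<open>The coefficients \<open>a\<close> and \<open>b\<close> of a sum of blocks can be read off as links.\<close>

lemma lk_blk_sum:
  assumes V: "finite V" and pq: "p \<in> V" "q \<in> V" "p \<noteq> q"
    and a: "\<And>x. x \<in> V - {p, q} \<Longrightarrow> a x \<in> mchains (V - {p, q, x}) k"
    and b: "\<And>x. x \<in> V - {p, q} \<Longrightarrow> b x \<in> mchains (V - {p, q, x}) k"
    and x: "x \<in> V - {p, q}"
  shows "lk p x (\<Sum>y\<in>V - {p, q}. blk p y q (a y) + blk q y p (b y)) = a x"
    and "lk q x (\<Sum>y\<in>V - {p, q}. blk p y q (a y) + blk q y p (b y)) = b x"
proof -
  have lk_blk: "lk p x (blk p y q (a y) + blk q y p (b y)) = (if y = x then a x else 0)"
      "lk q x (blk p y q (a y) + blk q y p (b y)) = (if y = x then b x else 0)"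
    if y: "y \<in> V - {p, q}" for y
  proof -
    note A = a[OF y] and B = b[OF y]
    show "lk p x (blk p y q (a y) + blk q y p (b y)) = (if y = x then a x else 0)"
      using x y pq lk_ed_same[OF A, of p y] lk_ed_other[OF A, of p x p y] lk_ed_other[OF A, of p x p q]
        lk_ed_other[OF B, of p x q y] lk_ed_other[OF B, of p x q p]
      by (auto simp: blk_def doubleton_eq_iff)
    show "lk q x (blk p y q (a y) + blk q y p (b y)) = (if y = x then b x else 0)"
      using x y pq lk_ed_same[OF B, of q y] lk_ed_other[OF B, of q x q y] lk_ed_other[OF B, of q x q p]
        lk_ed_other[OF A, of q x p y] lk_ed_other[OF A, of q x p q]
      by (auto simp: blk_def doubleton_eq_iff)
  qed
  have "lk p x (\<Sum>y\<in>V - {p, q}. blk p y q (a y) + blk q y p (b y)) =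
      (\<Sum>y\<in>V - {p, q}. if y = x then a x else 0)"
    unfolding D_sum by (intro sum.cong refl lk_blk)
  then show "lk p x (\<Sum>y\<in>V - {p, q}. blk p y q (a y) + blk q y p (b y)) = a x"
    using x V by simp
  have "lk q x (\<Sum>y\<in>V - {p, q}. blk p y q (a y) + blk q y p (b y)) =
      (\<Sum>y\<in>V - {p, q}. if y = x then b x else 0)"
    unfolding D_sum by (intro sum.cong refl lk_blk)
  then show "lk q x (\<Sum>y\<in>V - {p, q}. blk p y q (a y) + blk q y p (b y)) = b x"
    using x V by simp
qed

text \<open>The coefficient of the pair \<open>px qy\<close> in \<open>c\<close> is \<open>lk q y (lk p x c)\<close>. If it is the boundary of \<open>h\<close>,
  then subtracting the boundary of \<open>px qy h\<close> removes the pair from \<open>c\<close>. Once no pairs are left, the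
  coefficients of \<open>px\<close> and of \<open>qx\<close> are cycles that avoid both \<open>p\<close> and \<open>q\<close>; the blocks built from
  them have the same links as \<open>c\<close>, and the difference is a cycle in a cone.\<close>

lemma blk_decomposition:
  assumes V: "finite V" and pq: "p \<in> V" "q \<in> V" "p \<noteq> q" and c: "c \<in> mcycles V (Suc k)"
    and filled: "\<And>x y. x \<in> V - {p, q} \<Longrightarrow> y \<in> V - {p, q, x} \<Longrightarrow>
      \<exists>h \<in> mchains (V - {p, q, x, y}) k. bd h = lk q y (lk p x c)"
  obtains a b where "\<And>x. x \<in> V - {p, q} \<Longrightarrow> a x \<in> mcycles (V - {p, q, x}) k"
    "\<And>x. x \<in> V - {p, q} \<Longrightarrow> b x \<in> mcycles (V - {p, q, x}) k"
    "c - (\<Sum>x\<in>V - {p, q}. blk p x q (a x) + blk q x p (b x)) \<in> mbounds V (Suc k)"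
proof -
  let ?V = "V - {p, q}"
  define h where "h x y = (SOME h. h \<in> mchains (V - {p, q, x, y}) k \<and> bd h = lk q y (lk p x c))" for x y
  have h: "h x y \<in> mchains (V - {p, q, x, y}) k" "bd (h x y) = lk q y (lk p x c)"
    if x: "x \<in> ?V" and y: "y \<in> ?V - {x}" for x y
  proof -
    have "\<exists>h. h \<in> mchains (V - {p, q, x, y}) k \<and> bd h = lk q y (lk p x c)"
      using filled[OF x, of y] y by auto
    from someI_ex[OF this] show "h x y \<in> mchains (V - {p, q, x, y}) k" "bd (h x y) = lk q y (lk p x c)"
      unfolding h_def by blast+
  qed
  have fV: "finite ?V" using V by simp
  \<comment> \<open>The sum of all \<open>px qy h\<close>, grouped by \<open>x\<close>.\<close>
  define w where "w x = (\<Sum>y\<in>?V - {x}. ed q y (h x y))" for x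
  define u where "u = (\<Sum>x\<in>?V. ed p x (w x))"
  have w: "w x \<in> mchains (V - {p, x}) (Suc k)" if x: "x \<in> ?V" for x
    unfolding w_def
  proof (intro mchains_sum ed_in_mchains)
    fix y assume y: "y \<in> ?V - {x}"
    have "V - {p, x} - {q, y} = V - {p, q, x, y}" by auto
    then show "h x y \<in> mchains (V - {p, x} - {q, y}) k" using h(1)[OF x y] by simp
  qed (use x pq in auto)
  have u: "u \<in> mchains V (Suc (Suc k))"
    unfolding u_def using pq w by (intro mchains_sum ed_in_mchains) auto
  have lk_u: "lk p x u = w x" if x: "x \<in> ?V" for x
  proof -
    have "lk p x (ed p y (w y)) = (if y = x then w x else 0)" if "y \<in> ?V" for y
      using that w[OF that] lk_ed_same[OF w[OF that], of p y]
        lk_ed_other[OF w[OF that], of p x p y] by (auto simp: doubleton_eq_iff)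
    then have "lk p x u = (\<Sum>y\<in>?V. if y = x then w x else 0)"
      unfolding u_def D_sum by (intro sum.cong) auto
    then show ?thesis using x fV by simp
  qed
  have lk_w: "lk q y (w x) = h x y" if x: "x \<in> ?V" and y: "y \<in> ?V - {x}" for x y
  proof -
    have "lk q y (ed q v (h x v)) = (if v = y then h x y else 0)" if "v \<in> ?V - {x}" for v
      using that h(1)[OF x that] lk_ed_same[OF h(1)[OF x that], of q v]
        lk_ed_other[OF h(1)[OF x that], of q y q v] by (auto simp: doubleton_eq_iff)
    then have "lk q y (w x) = (\<Sum>v\<in>?V - {x}. if v = y then h x y else 0)"
      unfolding w_def D_sum by (intro sum.cong) auto
    then show ?thesis using y fV by simp
  qed
  define c' where "c' = c - bd u"
  have fin_c': "finitary c'" and fin_u: "finitary u"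
    using c u by (auto simp: c'_def)
  have c': "c' \<in> mcycles V (Suc k)"
    using c u by (auto simp: c'_def bd_bd bd_in_mchains intro!: mcyclesI)
  have lk_lk: "lk q y (lk p x c') = 0" if x: "x \<in> ?V" and y: "y \<in> ?V - {x}" for x y
    using fin_u mchains_finitary[OF w[OF x]] h(2)[OF x y]
    by (simp add: c'_def D_bd lk_u[OF x] lk_w[OF x y])
  have a: "lk p x c' \<in> mcycles (V - {p, q, x}) k" if x: "x \<in> ?V" for x
  proof -
    have 1: "lk p x c' \<in> mcycles (V - {p, x}) k"
      using c' by (rule lk_in_mcycles)
    have "(\<Sum>y\<in>V - {p, x} - {q}. ed q y (lk q y (lk p x c'))) = 0"
      using lk_lk[OF x] by (intro sum.neutral) auto
    then have "lk p x c' \<in> mchains (V - {p, x} - {q}) k"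
      using ed_mchains_decomposition[of "V - {p, x}" q "lk p x c'" k] 1 V pq x by auto
    moreover have "V - {p, x} - {q} = V - {p, q, x}" by auto
    ultimately show ?thesis using 1 by (intro mcyclesI) auto
  qed
  have b: "lk q x c' \<in> mcycles (V - {p, q, x}) k" if x: "x \<in> ?V" for x
  proof -
    have 1: "lk q x c' \<in> mcycles (V - {q, x}) k"
      using c' by (rule lk_in_mcycles)
    have "lk p y (lk q x c') = 0" if "y \<in> ?V - {x}" for y
      using lk_lk[of y x] that x D_D_anticommute[OF fin_c', of "{p, y}" "{q, x}"] by auto
    then have "(\<Sum>y\<in>V - {q, x} - {p}. ed p y (lk p y (lk q x c'))) = 0"
      by (intro sum.neutral) auto
    then have "lk q x c' \<in> mchains (V - {q, x} - {p}) k"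
      using ed_mchains_decomposition[of "V - {q, x}" p "lk q x c'" k] 1 V pq x by auto
    moreover have "V - {q, x} - {p} = V - {p, q, x}" by auto
    ultimately show ?thesis using 1 by (intro mcyclesI) auto
  qed
  define s where "s = (\<Sum>x\<in>?V. blk p x q (lk p x c') + blk q x p (lk q x c'))"
  have lk_s: "lk p x s = lk p x c'" "lk q x s = lk q x c'" if x: "x \<in> ?V" for x
    unfolding s_def using lk_blk_sum[OF V pq, of "\<lambda>x. lk p x c'" k "\<lambda>x. lk q x c'" x] a b x by auto
  have s: "s \<in> mcycles V (Suc k)"
  proof -
    have "blk p x q (lk p x c') \<in> mcycles V (Suc k)" "blk q x p (lk q x c') \<in> mcycles V (Suc k)"
      if x: "x \<in> ?V" for x
    proof -
      have "V - {p, x, q} = V - {p, q, x}" "V - {q, x, p} = V - {p, q, x}" by auto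
      then show "blk p x q (lk p x c') \<in> mcycles V (Suc k)" "blk q x p (lk q x c') \<in> mcycles V (Suc k)"
        using a[OF x] b[OF x] x pq by (intro blk_in_mcycles; force)+
    qed
    then show ?thesis
      unfolding s_def by (intro mcycles_sum mcycles_closed(3)) auto
  qed
  have "c' - s \<in> mbounds V (Suc k)"
    using V pq s c' lk_s by (intro cone_cycle_bounds) (auto intro!: mcyclesI)
  moreover have "bd u \<in> mbounds V (Suc k)" using u by (auto intro: mboundsI)
  ultimately have "c' - s + bd u \<in> mbounds V (Suc k)" by (rule mbounds_closed)
  then have "c - s \<in> mbounds V (Suc k)"
    by (simp add: c'_def algebra_simps)
  with a b show ?thesis
    unfolding s_def by (rule that)
qed

text \<open>Splitting off \<open>p\<close> and \<open>q\<close> leads from \<open>n\<close> vertices and \<open>k\<close> edges to \<open>n - 4\<close> vertices and \<open>k - 2\<close>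
  edges, and to \<open>n - 3\<close> vertices and \<open>k - 1\<close> edges; both remain below the bound.\<close>

theorem cycles_below_bound:
  assumes "finite V" "k < (card V + 1) div 3" "c \<in> mcycles V k"
  shows "c \<in> mbounds V k"
  using assms
proof (induction "card V" arbitrary: V k c rule: less_induct)
  case less
  have "1 < card V" using less.prems(2) by linarith
  then obtain p q where pq: "p \<in> V" "q \<in> V" "p \<noteq> q"
    by (metis card_le_Suc0_iff_eq less.prems(1) not_less One_nat_def)
  show ?case
  proof (cases k)
    case 0
    obtain n where n: "c = frag_cmul n (frag_of {})"
      using mchains_0_subset[of c V] less.prems(3) 0 by auto
    have "ed p q c \<in> mchains V (Suc 0)"
      using pq by (intro ed_in_mchains) (auto simp: n matchings_def)
    moreover have "bd (ed p q c) = c"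
      using less.prems(3) by (simp add: bd_E)
    ultimately show ?thesis using 0 by (auto intro: mboundsI)
  next
    case (Suc j)
    have card: "card (V - X) = card V - card X" if "X \<subseteq> V" for X
      using that less.prems(1) by (simp add: card_Diff_subset finite_subset)
    have filled: "\<exists>h \<in> mchains (V - {p, q, x, y}) j. bd h = lk q y (lk p x c)"
      if x: "x \<in> V - {p, q}" and y: "y \<in> V - {p, q, x}" for x y
    proof (cases j)
      case 0
      then have "lk q y (lk p x c) = 0"
        using lk_in_mchains[of c V 0 p x] less.prems(3) Suc lk_mchains_0 by auto
      then show ?thesis by (intro bexI[of _ 0]) auto
    next
      case (Suc i)
      have "lk q y (lk p x c) \<in> mcycles (V - {p, x} - {q, y}) i"
        using less.prems(3) \<open>k = Suc j\<close> Suc by (intro lk_in_mcycles) simp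
      moreover have "V - {p, x} - {q, y} = V - {p, q, x, y}" by auto
      moreover have "card {p, q, x, y} = 4" using x y pq by auto
      then have "card (V - {p, q, x, y}) = card V - 4" using x y pq card by auto
      ultimately have "lk q y (lk p x c) \<in> mbounds (V - {p, q, x, y}) i"
        using less.prems \<open>k = Suc j\<close> Suc \<open>1 < card V\<close> by (intro less.hyps) auto
      then show ?thesis using Suc by (auto simp: mbounds_def)
    qed
    have "c \<in> mcycles V (Suc j)" using less.prems(3) Suc by simp
    from blk_decomposition[OF less.prems(1) pq this filled]
    obtain a b where ab: "\<And>x. x \<in> V - {p, q} \<Longrightarrow> a x \<in> mcycles (V - {p, q, x}) j"
      "\<And>x. x \<in> V - {p, q} \<Longrightarrow> b x \<in> mcycles (V - {p, q, x}) j"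
      "c - (\<Sum>x\<in>V - {p, q}. blk p x q (a x) + blk q x p (b x)) \<in> mbounds V (Suc j)"
      by blast
    have "blk p x q (a x) + blk q x p (b x) \<in> mbounds V (Suc j)" if x: "x \<in> V - {p, q}" for x
    proof -
      have "card {p, q, x} = 3" using x pq by auto
      then have "card (V - {p, q, x}) = card V - 3" using x pq card by auto
      then have "a x \<in> mbounds (V - {p, q, x}) j" "b x \<in> mbounds (V - {p, q, x}) j"
        using ab(1,2)[OF x] less.prems Suc \<open>1 < card V\<close> by (auto intro!: less.hyps)
      moreover have "V - {p, x, q} = V - {p, q, x}" "V - {q, x, p} = V - {p, q, x}" by auto
      ultimately show ?thesis
        using x pq by (intro mbounds_closed(3) blk_in_mbounds) auto
    qed
    then have "(\<Sum>x\<in>V - {p, q}. blk p x q (a x) + blk q x p (b x)) \<in> mbounds V (Suc j)"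
      by (rule mbounds_sum)
    from mbounds_closed(3)[OF ab(3) this] show ?thesis using Suc by simp
  qed
qed

end

section \<open>Three-torsion from two blocks and a spare vertex\<close>

context matching_chains
begin

text \<open>The moves below are chained as calculations.\<close>

definition homologous :: "'v set \<Rightarrow> nat \<Rightarrow> ('v set set \<Rightarrow>\<^sub>0 int) \<Rightarrow> ('v set set \<Rightarrow>\<^sub>0 int) \<Rightarrow> bool" where
  "homologous V k x y \<longleftrightarrow> x - y \<in> mbounds V k"

lemma homologous_trans [trans]:
  "homologous V k x y \<Longrightarrow> homologous V k y z \<Longrightarrow> homologous V k x z"
  unfolding homologous_def using mbounds_closed(3)[of "x - y" V k "y - z"] by simp

lemma homologous_minus: "homologous V k x y \<Longrightarrow> homologous V k (- x) (- y)"
  unfolding homologous_def using mbounds_closed(2)[of "x - y" V k] by simp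

lemma homologous_blk:
  assumes "homologous (V - {a, b, c}) k x y" "distinct [a, b, c]" "{a, b, c} \<subseteq> V"
  shows "homologous V (Suc k) (blk a b c x) (blk a b c y)"
  using assms blk_in_mbounds[of "x - y" V a b c k] by (simp add: homologous_def)

lemma blk_in_mcycles':
  assumes "z \<in> mcycles Z k" "distinct [a, b, c]" "insert a (insert b (insert c Z)) \<subseteq> V" "Z \<inter> {a, b, c} = {}"
  shows "blk a b c z \<in> mcycles V (Suc k)"
  using assms by (intro blk_in_mcycles mcycles_mono[OF assms(1)]) auto

text \<open>With a fourth vertex \<open>w\<close> at hand, the opposite edges of the tetrahedron \<open>abcw\<close> are homologous, so
  a block only depends on the two perfect matchings of the tetrahedron that contain its edges.
  Here \<open>ab\<close> is replaced by \<open>wc\<close>, and \<open>ac\<close> by \<open>wb\<close>.\<close>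

lemma blk_exchange:
  assumes "z \<in> mcycles Z k" "distinct [a, b, c, w]" "{a, b, c, w} \<subseteq> V" "Z \<subseteq> V - {a, b, c, w}"
  shows "homologous V (Suc k) (blk a b c z) (- blk w b c z)"
proof -
  have 1: "z \<in> mcycles (V - {a, b, w, c}) k" "z \<in> mcycles (V - {a, c, w, b}) k"
    using assms(4) by (auto intro!: mcycles_mono[OF assms(1)])
  have "(ed a b z - ed w c z) - (ed a c z - ed w b z) \<in> mbounds V (Suc k)"
    using assms(2,3) by (intro mbounds_closed(4) ed_homologous 1) auto
  then show ?thesis by (simp add: homologous_def blk_def algebra_simps)
qed

lemma blk_rotate:
  assumes "z \<in> mcycles Z k" "distinct [a, b, c, w]" "{a, b, c, w} \<subseteq> V" "Z \<subseteq> V - {a, b, c, w}"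
  shows "homologous V (Suc k) (blk a b c z) (blk b a w z)"
proof -
  have 1: "z \<in> mcycles (V - {b, w, a, c}) k"
    using assms(4) by (auto intro!: mcycles_mono[OF assms(1)])
  have "ed b w z - ed a c z \<in> mbounds V (Suc k)"
    using assms(2,3) by (intro ed_homologous 1) auto
  then show ?thesis by (simp add: homologous_def blk_def algebra_simps insert_commute)
qed

context
  fixes V Z :: "'v set" and z :: "'v set set \<Rightarrow>\<^sub>0 int" and k :: nat
  assumes z: "z \<in> mcycles Z k" and Z: "Z \<subseteq> V"
begin

lemma blk2_exchange:
  assumes "distinct [a, b, c, d, e, f, w]" "{a, b, c, d, e, f, w} \<subseteq> V - Z"
  shows "homologous V (Suc (Suc k)) (blk a b c (blk d e f z)) (- blk w b c (blk d e f z))"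
proof (rule blk_exchange)
  show "blk d e f z \<in> mcycles (insert d (insert e (insert f Z))) (Suc k)"
    using assms by (intro blk_in_mcycles'[OF z]) auto
qed (use assms Z in auto)

lemma blk2_exchange':
  assumes "distinct [a, b, c, d, e, f, w]" "{a, b, c, d, e, f, w} \<subseteq> V - Z"
  shows "homologous V (Suc (Suc k)) (blk a b c (blk d e f z)) (- blk a b c (blk w e f z))"
proof -
  have "homologous (V - {a, b, c}) (Suc k) (blk d e f z) (- blk w e f z)"
    using assms Z by (intro blk_exchange[OF z]) auto
  from homologous_blk[OF this] show ?thesis using assms by simp
qed

lemma blk2_rotate:
  assumes "distinct [a, b, c, d, e, f, w]" "{a, b, c, d, e, f, w} \<subseteq> V - Z"
  shows "homologous V (Suc (Suc k)) (blk a b c (blk d e f z)) (blk b a w (blk d e f z))"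
proof (rule blk_rotate)
  show "blk d e f z \<in> mcycles (insert d (insert e (insert f Z))) (Suc k)"
    using assms by (intro blk_in_mcycles'[OF z]) auto
qed (use assms Z in auto)

text \<open>Three exchanges with the spare vertex, which is again \<open>w\<close> at the end; in between it is
  \<open>a\<close> and then \<open>d\<close>. Each exchange contributes a sign.\<close>

lemma blk2_swap_centres:
  assumes "distinct [a, b, c, d, e, f, w]" "{a, b, c, d, e, f, w} \<subseteq> V - Z"
  shows "homologous V (Suc (Suc k)) (blk a b c (blk d e f z)) (- blk d b c (blk a e f z))"
proof -
  have "homologous V (Suc (Suc k)) (blk a b c (blk d e f z)) (- blk w b c (blk d e f z))"
    using assms by (intro blk2_exchange) auto
  also have "homologous V (Suc (Suc k)) (- blk w b c (blk d e f z)) (- (- blk w b c (blk a e f z)))"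
    using assms by (intro homologous_minus blk2_exchange') auto
  also have "homologous V (Suc (Suc k)) (- (- blk w b c (blk a e f z))) (- (- (- blk d b c (blk a e f z))))"
    using assms by (intro homologous_minus blk2_exchange) auto
  finally show ?thesis by simp
qed

text \<open>After the move \<open>blk2_rotate\<close>, which makes \<open>b\<close> a centre, the transposition of \<open>b\<close> and \<open>d\<close> swaps two
  centres.\<close>

lemma blk2_swap_mixed:
  assumes "distinct [a, b, c, d, e, f, w]" "{a, b, c, d, e, f, w} \<subseteq> V - Z"
  shows "homologous V (Suc (Suc k)) (blk a b c (blk d e f z)) (- blk a d c (blk b e f z))"
proof -
  have "homologous V (Suc (Suc k)) (blk a b c (blk d e f z)) (blk b a w (blk d e f z))"
    using assms by (intro blk2_rotate) auto
  also have "homologous V (Suc (Suc k)) (blk b a w (blk d e f z)) (- blk d a w (blk b e f z))"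
    using assms by (intro blk2_swap_centres[where w = c]) auto
  also have "homologous V (Suc (Suc k)) (- blk d a w (blk b e f z)) (- blk a d c (blk b e f z))"
    using assms by (intro homologous_minus blk2_rotate) auto
  finally show ?thesis .
qed

text \<open>The transposition of \<open>a\<close> and \<open>b\<close> is that of \<open>b\<close> and \<open>d\<close>, conjugated by that of \<open>a\<close> and \<open>d\<close>.\<close>

lemma blk2_swap:
  assumes "distinct [a, b, c, d, e, f, w]" "{a, b, c, d, e, f, w} \<subseteq> V - Z"
  shows "homologous V (Suc (Suc k)) (blk a b c (blk d e f z)) (- blk b a c (blk d e f z))"
proof -
  have "homologous V (Suc (Suc k)) (blk a b c (blk d e f z)) (- blk d b c (blk a e f z))"
    using assms by (rule blk2_swap_centres)
  also have "homologous V (Suc (Suc k)) (- blk d b c (blk a e f z)) (- (- blk d a c (blk b e f z)))"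
    using assms by (intro homologous_minus blk2_swap_mixed[where w = w]) auto
  also have "homologous V (Suc (Suc k)) (- (- blk d a c (blk b e f z))) (- (- (- blk b a c (blk d e f z))))"
    using assms by (intro homologous_minus blk2_swap_centres[where w = w]) auto
  finally show ?thesis by simp
qed

text \<open>The three rotations of the first block add up to zero. Each of them arises from the block by two
  transpositions, one inside the block that is a sign by definition and one by \<open>blk2_swap\<close>, so all
  three are homologous.\<close>

lemma three_blk2_bounds:
  assumes "distinct [a, b, c, d, e, f, w]" "{a, b, c, d, e, f, w} \<subseteq> V - Z"
  defines "y \<equiv> blk d e f z"
  shows "blk a b c y + blk a b c y + blk a b c y \<in> mbounds V (Suc (Suc k))"
proof -
  have 1: "blk a b c y + blk b a c y \<in> mbounds V (Suc (Suc k))"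
    using blk2_swap[OF assms(1,2)] by (simp add: y_def homologous_def)
  have "homologous V (Suc (Suc k)) (blk c a b y) (- blk a c b y)"
    unfolding y_def using assms(1,2) by (intro blk2_swap[where w = w]) auto
  then have 2: "blk c a b y - blk a b c y \<in> mbounds V (Suc (Suc k))"
    by (simp add: homologous_def blk_commute[of a c b])
  have "blk a b c y + blk a b c y + blk a b c y =
      (blk a b c y + blk b a c y) - (blk c a b y - blk a b c y)"
    by (simp add: blk_def insert_commute)
  then show ?thesis by (simp only: mbounds_closed(4)[OF 1 2])
qed

end

section \<open>Hexagons\<close>

text \<open>The six pairs \<open>us, vs'\<close> with distinct \<open>s, s'\<close> in \<open>{x, y, t}\<close> form a hexagon in the matching
  complex of five vertices. It is symmetric in \<open>u, v\<close> and alternates in \<open>x, y, t\<close>.\<close>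

definition hexa :: "'v \<Rightarrow> 'v \<Rightarrow> 'v \<Rightarrow> 'v \<Rightarrow> 'v \<Rightarrow> ('v set set \<Rightarrow>\<^sub>0 int) \<Rightarrow> ('v set set \<Rightarrow>\<^sub>0 int)" where
  "hexa u v x y t c =
     ed u x (ed v y c) - ed u y (ed v x c) + ed u y (ed v t c) - ed u t (ed v y c)
     + ed u t (ed v x c) - ed u x (ed v t c)"

lemma hexa_linear [simp]:
  "hexa u v x y t (a + b) = hexa u v x y t a + hexa u v x y t b"
  "hexa u v x y t (a - b) = hexa u v x y t a - hexa u v x y t b"
  "hexa u v x y t (- a) = - hexa u v x y t a"
  by (simp_all add: hexa_def algebra_simps)

lemma hexa_commute: "hexa u v x y t c = hexa v u x y t c"
  by (simp add: hexa_def E_anticommute[of "{u, _}" "{v, _}"] algebra_simps)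

lemma hexa_swap1: "hexa u v y x t c = - hexa u v x y t c"
  and hexa_swap2: "hexa u v x t y c = - hexa u v x y t c"
  by (simp_all add: hexa_def algebra_simps)

lemma bd_hexa: "finitary c \<Longrightarrow> bd (hexa u v x y t c) = hexa u v x y t (bd c)"
  by (simp add: hexa_def bd_E algebra_simps)

lemma ed_ed_in_mchains:
  assumes "c \<in> mchains (V - X) k" "{a, b, p, q} \<subseteq> X" "distinct [a, b, p, q]" "X \<subseteq> V"
  shows "ed a b (ed p q c) \<in> mchains V (Suc (Suc k))"
  using assms by (intro ed_in_mchains mchains_mono[OF assms(1)]) auto

lemma hexa_in_mchains:
  assumes "c \<in> mchains (V - {u, v, x, y, t}) k" "distinct [u, v, x, y, t]" "{u, v, x, y, t} \<subseteq> V"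
  shows "hexa u v x y t c \<in> mchains V (Suc (Suc k))"
  unfolding hexa_def using assms
  by (intro mchains_add mchains_diff ed_ed_in_mchains[OF assms(1)]) auto

lemma hexa_in_mbounds:
  assumes "c \<in> mbounds W k" "distinct [u, v, x, y, t]" "{u, v, x, y, t} \<subseteq> V" "W \<subseteq> V - {u, v, x, y, t}"
  shows "hexa u v x y t c \<in> mbounds V (Suc (Suc k))"
proof -
  obtain h where h: "h \<in> mchains W (Suc k)" "c = bd h"
    using assms(1) by (auto simp: mbounds_def)
  have "hexa u v x y t h \<in> mchains V (Suc (Suc (Suc k)))"
    using assms by (intro hexa_in_mchains mchains_mono[OF h(1)]) auto
  moreover have "bd (hexa u v x y t h) = hexa u v x y t c"
    using mchains_finitary[OF h(1)] h(2) by (simp add: bd_hexa)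
  ultimately show ?thesis by (rule mboundsI)
qed

text \<open>On the five vertices \<open>e, a, b, c, d\<close>, the four hexagons that have \<open>e\<close> on their short side.
  Each pair of an edge at \<open>e\<close> and an edge disjoint from it lies on two of them, with opposite signs.\<close>

lemma hexa_star:
  "hexa e a b c d z - hexa e b a c d z + hexa e c a b d z - hexa e d a b c z = 0"
  by (simp add: hexa_def insert_commute algebra_simps)

text \<open>The six triangles that match \<open>u, v, w\<close> with \<open>x, y, t\<close> form a chain whose boundary consists of the three
  hexagons.\<close>

lemma hexa_triangle:
  assumes "c \<in> mcycles W k" "distinct [u, v, w, x, y, t]" "{u, v, w, x, y, t} \<subseteq> V"
    "W \<subseteq> V - {u, v, w, x, y, t}"
  shows "hexa u v x y t c + hexa v w x y t c + hexa u w x y t c \<in> mbounds V (Suc (Suc k))"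
proof (rule mboundsI)
  let ?tri = "\<lambda>x y t. ed u x (ed v y (ed w t c))"
  show "?tri x y t + ?tri y t x + ?tri t x y - ?tri y x t - ?tri x t y - ?tri t y x \<in> mchains V (Suc (Suc (Suc k)))"
    using assms by (intro mchains_add mchains_diff ed_in_mchains mchains_mono[OF mcycles_mchains[OF assms(1)]]) auto
  show "bd (?tri x y t + ?tri y t x + ?tri t x y - ?tri y x t - ?tri x t y - ?tri t y x)
      = hexa u v x y t c + hexa v w x y t c + hexa u w x y t c"
    using assms(1) by (simp add: bd_E hexa_def algebra_simps)
qed

text \<open>Only five triangles are needed to push three times a product of two blocks onto hexagons. Every
  hexagon on the right omits one of the six vertices. Modulo 3, the hexagons on \<open>f, a, b\<close> with their
  coefficients 1 and 2 amount to a cyclic sum over \<open>e, c, d\<close>, and those on \<open>e, c, d\<close> to a cyclic sum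
  over \<open>f, a, b\<close>; this is used in \<open>three_blk4_bounds\<close>.\<close>

lemma three_blk2_hexa:
  assumes z: "z \<in> mcycles W k" and dist: "distinct [e, a, b, f, c, d]" and V: "{e, a, b, f, c, d} \<subseteq> V"
    "W \<subseteq> V - {e, a, b, f, c, d}"
  defines "F \<equiv> blk e a b (blk f c d z)"
  shows "F + F + F - (hexa c d f a b z - hexa a b e c d z - hexa f b e c d z - hexa f b e c d z
    + hexa e d f a b z + hexa e d f a b z) \<in> mbounds V (Suc (Suc k))"
proof (rule mboundsI)
  define t1 where "t1 = ed e a (ed b c (ed f d z))"
  define t2 where "t2 = ed e a (ed b d (ed f c z))"
  define t3 where "t3 = ed e b (ed a c (ed f d z))"
  define t4 where "t4 = ed e b (ed a d (ed f c z))"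
  define t5 where "t5 = ed e f (ed a d (ed b c z))"
  show "t1 - t2 - t2 - t2 + t3 + t4 - t5 - t5 \<in> mchains V (Suc (Suc (Suc k)))"
    unfolding t1_def t2_def t3_def t4_def t5_def using dist V
    by (intro mchains_add mchains_diff ed_in_mchains mchains_mono[OF mcycles_mchains[OF z]]) auto
  have bd3: "bd (ed p q (ed p' q' (ed p'' q'' z))) =
      ed p' q' (ed p'' q'' z) - ed p q (ed p'' q'' z) + ed p q (ed p' q' z)" for p q p' q' p'' q''
    using z by (simp add: bd_E)
  have sets: "{a, e} = {e, a}" "{b, e} = {e, b}" "{c, a} = {a, c}" "{c, b} = {b, c}" "{c, f} = {f, c}"
      "{d, a} = {a, d}" "{d, b} = {b, d}" "{d, f} = {f, d}" "{f, e} = {e, f}"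
    by auto
  \<comment> \<open>The products of edges that occur in both orders, oriented as rewrite rules.\<close>
  note order = E_anticommute[of "{f, c}" "{a, d}"] E_anticommute[of "{b, c}" "{a, d}"]
    E_anticommute[of "{a, d}" "{e, b}"] E_anticommute[of "{f, c}" "{e, b}"] E_anticommute[of "{f, d}" "{b, c}"]
    E_anticommute[of "{f, d}" "{e, b}"] E_anticommute[of "{b, d}" "{f, c}"] E_anticommute[of "{e, b}" "{a, c}"]
  show "bd (t1 - t2 - t2 - t2 + t3 + t4 - t5 - t5) =
    F + F + F - (hexa c d f a b z - hexa a b e c d z - hexa f b e c d z - hexa f b e c d z
    + hexa e d f a b z + hexa e d f a b z)"
    unfolding t1_def t2_def t3_def t4_def t5_def F_def
    by (simp add: bd3 blk_def hexa_def sets order algebra_simps)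
qed

section \<open>Three-torsion from four blocks\<close>

context
  fixes V Z :: "'v set" and z :: "'v set set \<Rightarrow>\<^sub>0 int" and j :: nat and e a b f c d g k l m n o' :: 'v
  assumes z: "z \<in> mcycles Z j" and Z: "Z \<subseteq> V"
    and dist: "distinct [e, a, b, f, c, d, g, k, l, m, n, o']"
    and sub: "{e, a, b, f, c, d, g, k, l, m, n, o'} \<subseteq> V - Z"
begin

text \<open>The blocks on \<open>e, a, b\<close> and \<open>f, c, d\<close> are to be turned into hexagons. Of the other six vertices, the
  five \<open>k, l, m, n, o'\<close> keep their place in the last two blocks, while the centre \<open>g\<close> of the third
  block is traded for one of the six letters.\<close>

definition tail :: "'v \<Rightarrow> ('v set set \<Rightarrow>\<^sub>0 int)" where
  "tail p = blk p k l (blk m n o' z)"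

text \<open>The hexagon with sides \<open>u, g\<close> and \<open>x, y, t\<close>. It leaves out the letters \<open>v\<close> and \<open>w\<close>, one of which is
  the centre of the third block and the other one the spare vertex. As \<open>tail v\<close> and \<open>tail w\<close> are
  homologous up to sign, taking their difference doubles the class modulo boundaries, but makes it
  exactly alternating in \<open>v, w\<close>. Modulo 3 it
  behaves like a multiple of \<open>(u - g) \<and> (x + y + t)\<close>.\<close>

definition psi :: "'v \<Rightarrow> 'v \<Rightarrow> 'v \<Rightarrow> 'v \<Rightarrow> 'v \<Rightarrow> 'v \<Rightarrow> ('v set set \<Rightarrow>\<^sub>0 int)" where
  "psi u v w x y t = hexa u g x y t (tail v - tail w)"

definition letters :: "'v set" where
  "letters = {e, a, b, f, c, d}"

text \<open>The definition of \<open>letters\<close> is kept folded, so that the many distinctness conditions below are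
  decided from membership alone.\<close>

abbreviation six :: "'v \<Rightarrow> 'v \<Rightarrow> 'v \<Rightarrow> 'v \<Rightarrow> 'v \<Rightarrow> 'v \<Rightarrow> bool" where
  "six u v w x y t \<equiv> distinct [u, v, w, x, y, t] \<and> {u, v, w, x, y, t} \<subseteq> letters"

abbreviation null :: "('v set set \<Rightarrow>\<^sub>0 int) \<Rightarrow> bool" where
  "null y \<equiv> y \<in> mbounds V (Suc (Suc (Suc (Suc j))))"

lemma letters_away:
  assumes "p \<in> letters"
  shows "p \<in> V" "p \<notin> Z" "p \<noteq> g" "p \<noteq> k" "p \<noteq> l" "p \<noteq> m" "p \<noteq> n" "p \<noteq> o'"
  using assms dist sub by (auto simp: letters_def)

lemma spare_away: "{g, k, l, m, n, o'} \<subseteq> V" "{g, k, l, m, n, o'} \<inter> Z = {}" "distinct [g, k, l, m, n, o']"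
  using dist sub by auto

lemma tail_cycle:
  assumes "p \<in> insert g letters"
  shows "tail p \<in> mcycles ({p, k, l, m, n, o'} \<union> Z) (Suc (Suc j))"
proof -
  have inner: "blk m n o' z \<in> mcycles ({m, n, o'} \<union> Z) (Suc j)"
    using spare_away by (intro blk_in_mcycles'[OF z]) auto
  show ?thesis
    unfolding tail_def using spare_away letters_away[of p] assms
    by (intro blk_in_mcycles'[OF inner]) auto
qed

lemma tail_flip:
  assumes "p \<in> insert g letters" "q \<in> insert g letters" "p \<noteq> q"
  shows "tail p + tail q \<in> mbounds ({p, q, k, l, m, n, o'} \<union> Z) (Suc (Suc j))"
proof -
  have "homologous ({p, q, k, l, m, n, o'} \<union> Z) (Suc (Suc j)) (tail p) (- tail q)"
    unfolding tail_def using spare_away letters_away[of p] letters_away[of q] assms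
    by (intro blk2_exchange[OF z]) auto
  then show ?thesis by (simp add: homologous_def)
qed

lemma three_tail:
  assumes "p \<in> insert g letters" "q \<in> insert g letters" "p \<noteq> q"
  shows "tail p + tail p + tail p \<in> mbounds ({p, q, k, l, m, n, o'} \<union> Z) (Suc (Suc j))"
  unfolding tail_def using spare_away letters_away[of p] letters_away[of q] assms
  by (intro three_blk2_bounds[OF z, where w = q]) auto

lemma hexa_null:
  assumes "distinct [u, v, p, q, x, y, t]" "{u, v, p, q, x, y, t} \<subseteq> insert g letters"
    and "h \<in> mbounds ({p, q, k, l, m, n, o'} \<union> Z) (Suc (Suc j))"
  shows "null (hexa u v x y t h)"
proof (rule hexa_in_mbounds[OF assms(3)])
  have away: "s \<in> V \<and> s \<notin> {k, l, m, n, o'} \<union> Z" if "s \<in> insert g letters" for s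
    using that spare_away letters_away[of s] by auto
  have "u \<in> insert g letters" "v \<in> insert g letters" "p \<in> insert g letters" "q \<in> insert g letters"
    "x \<in> insert g letters" "y \<in> insert g letters" "t \<in> insert g letters"
    using assms(2) by auto
  note this[THEN away]
  then show "{p, q, k, l, m, n, o'} \<union> Z \<subseteq> V - {u, v, x, y, t}" "{u, v, x, y, t} \<subseteq> V"
    using assms(1) spare_away Z by auto
qed (use assms(1) in auto)

lemma hexa_flip:
  assumes "six u v w x y t"
  shows "null (hexa u g x y t (tail v + tail w))"
proof (rule hexa_null)
  show "tail v + tail w \<in> mbounds ({v, w, k, l, m, n, o'} \<union> Z) (Suc (Suc j))"
    by (rule tail_flip) (use assms letters_away(3) in auto)
qed (use assms letters_away(3) in auto)

lemma hexa_flip_spare: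
  assumes "six u v w x y t"
  shows "null (hexa u v x y t (tail g + tail w))"
proof (rule hexa_null)
  show "tail g + tail w \<in> mbounds ({g, w, k, l, m, n, o'} \<union> Z) (Suc (Suc j))"
    by (rule tail_flip) (use assms letters_away(3) in auto)
qed (use assms letters_away(3) in auto)

lemma three_hexa:
  assumes "six u v w x y t"
  shows "null (hexa u g x y t (tail v + tail v + tail v))"
proof (rule hexa_null)
  show "tail v + tail v + tail v \<in> mbounds ({v, w, k, l, m, n, o'} \<union> Z) (Suc (Suc j))"
    by (rule three_tail) (use assms letters_away(3) in auto)
qed (use assms letters_away(3) in auto)

lemma psi_alternating:
  "psi u w v x y t = - psi u v w x y t" "psi u v w y x t = - psi u v w x y t"
  "psi u v w x t y = - psi u v w x y t"
proof -
  have "tail w - tail v = - (tail v - tail w)" by simp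
  then show "psi u w v x y t = - psi u v w x y t"
    unfolding psi_def by (simp only: hexa_linear)
  show "psi u v w y x t = - psi u v w x y t"
    unfolding psi_def by (rule hexa_swap1)
  show "psi u v w x t y = - psi u v w x y t"
    unfolding psi_def by (rule hexa_swap2)
qed

lemma three_psi:
  assumes "six u v w x y t"
  shows "null (psi u v w x y t + psi u v w x y t + psi u v w x y t)"
proof -
  have "null (hexa u g x y t (tail v + tail v + tail v))"
    using assms by (rule three_hexa)
  moreover have "null (hexa u g x y t (tail w + tail w + tail w))"
    using assms by (intro three_hexa[of u w v]) auto
  ultimately have "null (hexa u g x y t (tail v + tail v + tail v) - hexa u g x y t (tail w + tail w + tail w))"
    by (rule mbounds_closed(4))
  then show ?thesis
    unfolding psi_def by (simp add: algebra_simps)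
qed

lemma psi_star:
  "psi p v w q s t - psi q v w p s t + psi s v w p q t - psi t v w p q s = 0"
  unfolding psi_def using hexa_star[of g p q s t "tail v - tail w"]
  by (simp only: hexa_commute[of g])

lemma hexa_triangle_tail:
  assumes "six u v w x y t"
  shows "null (hexa u v x y t (tail w) + hexa v g x y t (tail w) + hexa u g x y t (tail w))"
proof (rule hexa_triangle[OF tail_cycle])
  have "u \<in> letters" "v \<in> letters" "w \<in> letters" "x \<in> letters" "y \<in> letters" "t \<in> letters"
    using assms by auto
  note this[THEN letters_away(1)] this[THEN letters_away(2)] this[THEN letters_away(3)] this[THEN letters_away(4)]
    this[THEN letters_away(5)] this[THEN letters_away(6)] this[THEN letters_away(7)] this[THEN letters_away(8)]
  then show "w \<in> insert g letters" "distinct [u, v, g, x, y, t]" "{u, v, g, x, y, t} \<subseteq> V"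
      "{w, k, l, m, n, o'} \<union> Z \<subseteq> V - {u, v, g, x, y, t}"
    using assms spare_away Z by auto
qed

text \<open>By \<open>hexa_triangle\<close> the hexagon with sides \<open>u, p\<close> is minus the sum of those with sides \<open>p, g\<close> and
  \<open>u, g\<close>. Taking the alternating sum over the four letters opposite to \<open>u\<close>, the first two families
  cancel by \<open>hexa_star\<close>, applied at \<open>u\<close> and at \<open>g\<close>. What remains is the third, in which \<open>tail_flip\<close>
  turns twice \<open>tail w\<close> into the difference of tails that occurs in \<open>psi\<close>.\<close>

lemma psi_pair_star:
  assumes "six u w p q s t"
  shows "null (psi u w p q s t - psi u w q p s t + psi u w s p q t - psi u w t p q s)"
proof -
  define T where "T p q s t = hexa u p q s t (tail w) + hexa p g q s t (tail w) + hexa u g q s t (tail w)"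
    for p q s t
  define R where "R p q s t = hexa u g q s t (tail w + tail p)" for p q s t
  have T: "null (T p q s t)" "null (T q p s t)" "null (T s p q t)" "null (T t p q s)"
    unfolding T_def by (rule hexa_triangle_tail; use assms in auto)+
  have R: "null (R p q s t)" "null (R q p s t)" "null (R s p q t)" "null (R t p q s)"
    unfolding R_def by (rule hexa_flip; use assms in auto)+
  have star: "hexa u p q s t (tail w) - hexa u q p s t (tail w) + hexa u s p q t (tail w) - hexa u t p q s (tail w) = 0"
    "hexa p g q s t (tail w) - hexa q g p s t (tail w) + hexa s g p q t (tail w) - hexa t g p q s (tail w) = 0"
    using hexa_star[of u p q s t "tail w"] hexa_star[of g p q s t "tail w"]
    by (simp_all only: hexa_commute[of g])
  define A where "A = T p q s t - T q p s t + T s p q t - T t p q s"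
  have eq: "A = hexa u g q s t (tail w) - hexa u g p s t (tail w) + hexa u g p q t (tail w) - hexa u g p q s (tail w)"
  proof -
    have "A = (hexa u p q s t (tail w) - hexa u q p s t (tail w) + hexa u s p q t (tail w) - hexa u t p q s (tail w))
        + (hexa p g q s t (tail w) - hexa q g p s t (tail w) + hexa s g p q t (tail w) - hexa t g p q s (tail w))
        + (hexa u g q s t (tail w) - hexa u g p s t (tail w) + hexa u g p q t (tail w) - hexa u g p q s (tail w))"
      by (simp add: A_def T_def algebra_simps)
    then show ?thesis unfolding star by simp
  qed
  have "psi u w p q s t - psi u w q p s t + psi u w s p q t - psi u w t p q s
      = A + A - (R p q s t - R q p s t + R s p q t - R t p q s)"
    unfolding eq psi_def R_def by (simp add: algebra_simps)
  moreover have "null (A + A - (R p q s t - R q p s t + R s p q t - R t p q s))"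
    unfolding A_def using T R by (intro mbounds_closed(3,4))
  ultimately show ?thesis by (simp only:)
qed

text \<open>All classes in this section are annihilated by 3, so factors 2 may be cancelled.\<close>

lemma halve:
  assumes "null (y + y)" "null (y + y + y)"
  shows "null y"
  using mbounds_closed(4)[OF assms(2,1)] by simp

text \<open>For fixed \<open>u\<close>, \<open>psi_pair_star\<close> gives one relation for each of the other five letters: up to sign,
  the four classes whose omitted pair contains that letter add up to zero. The relations for
  \<open>x, y, t\<close> minus those for \<open>v, w\<close> leave twice the class that omits \<open>v, w\<close> against twice those that
  omit two of \<open>x, y, t\<close>.\<close>

lemma psi_dual:
  assumes "six u v w x y t"
  shows "null (psi u v w x y t - psi u x y t v w - psi u t x y v w - psi u y t x v w)"
proof (rule halve)
  let ?y = "psi u v w x y t - psi u x y t v w - psi u t x y v w - psi u y t x v w"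
  have "null (psi u x y t v w - psi u x t y v w + psi u x v y t w - psi u x w y t v)"
    "null (psi u y x t v w - psi u y t x v w + psi u y v x t w - psi u y w x t v)"
    "null (psi u t x y v w - psi u t y x v w + psi u t v x y w - psi u t w x y v)"
    "null (psi u v x y t w - psi u v y x t w + psi u v t x y w - psi u v w x y t)"
    "null (psi u w x y t v - psi u w y x t v + psi u w t x y v - psi u w v x y t)"
    by (rule psi_pair_star; use assms in auto)+
  note N = this
  have alt: "psi u y x t v w = - psi u x y t v w" "psi u x t y v w = - psi u t x y v w"
     "psi u t y x v w = - psi u y t x v w" "psi u v x y t w = - psi u x v y t w"
     "psi u v y x t w = - psi u y v x t w" "psi u v t x y w = - psi u t v x y w"
     "psi u w x y t v = - psi u x w y t v" "psi u w y x t v = - psi u y w x t v"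
     "psi u w t x y v = - psi u t w x y v" "psi u w v x y t = - psi u v w x y t"
    by (rule psi_alternating)+
  have "?y + ?y = (psi u y x t v w - psi u y t x v w + psi u y v x t w - psi u y w x t v)
     - (psi u x y t v w - psi u x t y v w + psi u x v y t w - psi u x w y t v)
     - (psi u t x y v w - psi u t y x v w + psi u t v x y w - psi u t w x y v)
     - (psi u v x y t w - psi u v y x t w + psi u v t x y w - psi u v w x y t)
     + (psi u w x y t v - psi u w y x t v + psi u w t x y v - psi u w v x y t)"
    by (simp add: alt algebra_simps)
  also have "null \<dots>"
    by (rule mbounds_closed(3)[OF mbounds_closed(4)[OF mbounds_closed(4)[OF
          mbounds_closed(4)[OF N(2,1)] N(3)] N(4)] N(5)])
  finally show "null (?y + ?y)" .
  have "null ((psi u v w x y t + psi u v w x y t + psi u v w x y t) - (psi u x y t v w + psi u x y t v w + psi u x y t v w)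
      - (psi u t x y v w + psi u t x y v w + psi u t x y v w) - (psi u y t x v w + psi u y t x v w + psi u y t x v w))"
    using assms by (intro mbounds_closed(4) three_psi) auto
  then show "null (?y + ?y + ?y)"
    by (simp add: algebra_simps)
qed

text \<open>The identity \<open>U \<and> T = - T \<and> U\<close> for the two triples. Dualizing each term on the left gives nine
  classes with one of \<open>u, v, w\<close> on the short side; grouped by the letter of the other triple on their
  long side, they are evaluated by \<open>psi_star\<close>.\<close>

lemma psi_exchange:
  assumes "six x y t u v w"
  shows "null ((psi u v w x y t + psi v w u x y t + psi w u v x y t)
    - (psi x y t u v w + psi y t x u v w + psi t x y u v w))"
proof -
  have dual: "null (psi u v w x y t - psi u x y t v w - psi u t x y v w - psi u y t x v w)"
    "null (psi v w u x y t - psi v x y t w u - psi v t x y w u - psi v y t x w u)"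
    "null (psi w u v x y t - psi w x y t u v - psi w t x y u v - psi w y t x u v)"
    by (rule psi_dual; use assms in auto)+
  have star: "psi x y t u v w = psi u y t x v w - psi v y t x u w + psi w y t x u v"
    "psi y t x u v w = psi u t x y v w - psi v t x y u w + psi w t x y u v"
    "psi t x y u v w = psi u x y t v w - psi v x y t u w + psi w x y t u v"
    using psi_star[of x y t u v w] psi_star[of y t x u v w] psi_star[of t x y u v w]
    by (simp_all add: algebra_simps)
  have alt: "psi v y t x w u = - psi v y t x u w" "psi v t x y w u = - psi v t x y u w"
    "psi v x y t w u = - psi v x y t u w"
    by (rule psi_alternating)+
  have "(psi u v w x y t + psi v w u x y t + psi w u v x y t)
    - (psi x y t u v w + psi y t x u v w + psi t x y u v w) =
      (psi u v w x y t - psi u x y t v w - psi u t x y v w - psi u y t x v w)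
    + (psi v w u x y t - psi v x y t w u - psi v t x y w u - psi v y t x w u)
    + (psi w u v x y t - psi w x y t u v - psi w t x y u v - psi w y t x u v)"
    by (simp add: star alt algebra_simps)
  then show ?thesis
    by (simp only: mbounds_closed(3)[OF mbounds_closed(3)[OF dual(1,2)] dual(3)])
qed

text \<open>The hexagon with sides \<open>u, v\<close> is the sum of those with sides \<open>v, g\<close> and \<open>g, u\<close>, by
  \<open>hexa_triangle\<close>. Here the doubling in \<open>psi\<close> turns a factor 1 into \<open>-1\<close> modulo 3.\<close>

lemma hexa_spare:
  assumes "six u v w x y t"
  shows "null (hexa u v x y t (tail g) + psi v w u x y t + psi u w v x y t)"
proof -
  define A where "A = hexa u v x y t (tail w) + hexa v g x y t (tail w) + hexa u g x y t (tail w)"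
  define B where "B = hexa u v x y t (tail g + tail w)"
  define C where "C = hexa v g x y t (tail w + tail w + tail w) + hexa u g x y t (tail w + tail w + tail w)"
  define R where "R = hexa v g x y t (tail w + tail u) + hexa u g x y t (tail w + tail v)"
  have "null A" unfolding A_def using assms by (rule hexa_triangle_tail)
  moreover have "null B" unfolding B_def using assms by (rule hexa_flip_spare)
  moreover have "null C" unfolding C_def
    by (rule mbounds_closed(3)[OF three_hexa[of v w u] three_hexa[of u w v]]; use assms in auto)
  moreover have "null R" unfolding R_def
    by (rule mbounds_closed(3)[OF hexa_flip hexa_flip]; use assms in auto)
  ultimately have "null (B - A + C - R)"
    by (intro mbounds_closed(3,4))
  moreover have "hexa u v x y t (tail g) + psi v w u x y t + psi u w v x y t = B - A + C - R"
    by (simp add: A_def B_def C_def R_def psi_def algebra_simps)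
  ultimately show ?thesis by (simp only:)
qed

text \<open>After expressing the hexagons of \<open>three_blk2_hexa\<close> by \<open>psi\<close>, the sum is, modulo 3, the difference of
  the two sides of \<open>psi_exchange\<close> for the triples \<open>f, a, b\<close> and \<open>e, c, d\<close>.\<close>

lemma three_blk4_bounds:
  defines "F \<equiv> blk e a b (blk f c d (blk g k l (blk m n o' z)))"
  shows "null (F + F + F)"
proof -
  have six: "six f a b e c d" using dist by (auto simp: letters_def)
  define h1 where "h1 = hexa c d f a b (tail g)"
  define h2 where "h2 = hexa a b e c d (tail g)"
  define h3 where "h3 = hexa f b e c d (tail g)"
  define h4 where "h4 = hexa e d f a b (tail g)"
  have F: "F + F + F - (h1 - h2 - h3 - h3 + h4 + h4) \<in> mbounds V (Suc (Suc (Suc (Suc j))))"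
  proof -
    have "F = blk e a b (blk f c d (tail g))" by (simp add: F_def tail_def)
    moreover have tail: "tail g \<in> mcycles ({g, k, l, m, n, o'} \<union> Z) (Suc (Suc j))"
      by (intro tail_cycle) simp
    have "{g, k, l, m, n, o'} \<union> Z \<subseteq> V - {e, a, b, f, c, d}"
      using dist sub Z by auto
    from three_blk2_hexa[OF tail _ _ this]
    have "distinct [e, a, b, f, c, d] \<Longrightarrow> {e, a, b, f, c, d} \<subseteq> V \<Longrightarrow>
        null (blk e a b (blk f c d (tail g)) + blk e a b (blk f c d (tail g)) + blk e a b (blk f c d (tail g))
          - (h1 - h2 - h3 - h3 + h4 + h4))"
      unfolding h1_def h2_def h3_def h4_def by blast
    ultimately show ?thesis
      using dist sub by simp
  qed
  have C: "null (h1 + psi d e c f a b + psi c e d f a b)" "null (h2 + psi b f a e c d + psi a f b e c d)"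
    "null (h3 + psi b a f e c d + psi f a b e c d)" "null (h4 + psi d c e f a b + psi e c d f a b)"
    unfolding h1_def h2_def h3_def h4_def by (rule hexa_spare; use six in auto)+
  have X: "null ((psi e c d f a b + psi c d e f a b + psi d e c f a b)
      - (psi f a b e c d + psi a b f e c d + psi b f a e c d))"
    using six by (rule psi_exchange)
  have T: "null (psi e c d f a b + psi e c d f a b + psi e c d f a b)"
    "null (psi f a b e c d + psi f a b e c d + psi f a b e c d)"
    by (rule three_psi; use six in auto)+
  have alt: "psi c e d f a b = - psi c d e f a b" "psi d c e f a b = - psi d e c f a b"
    "psi a f b e c d = - psi a b f e c d" "psi b a f e c d = - psi b f a e c d"
    by (rule psi_alternating)+
  have "F + F + F = (F + F + F - (h1 - h2 - h3 - h3 + h4 + h4))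
    + (h1 + psi d e c f a b + psi c e d f a b)
    + (h4 + psi d c e f a b + psi e c d f a b) + (h4 + psi d c e f a b + psi e c d f a b)
    - (h2 + psi b f a e c d + psi a f b e c d)
    - (h3 + psi b a f e c d + psi f a b e c d) - (h3 + psi b a f e c d + psi f a b e c d)
    + ((psi e c d f a b + psi c d e f a b + psi d e c f a b)
      - (psi f a b e c d + psi a b f e c d + psi b f a e c d))
    - (psi e c d f a b + psi e c d f a b + psi e c d f a b)
    + (psi f a b e c d + psi f a b e c d + psi f a b e c d)"
    by (simp add: alt algebra_simps)
  also have "null \<dots>"
    by (rule mbounds_closed(3)[OF mbounds_closed(4)[OF mbounds_closed(3)[OF mbounds_closed(4)[OF
      mbounds_closed(4)[OF mbounds_closed(4)[OF mbounds_closed(3)[OF mbounds_closed(3)[OF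
      mbounds_closed(3)[OF F C(1)] C(4)] C(4)] C(2)] C(3)] C(3)] X] T(1)] T(2)])
  finally show ?thesis .
qed

end

end

section \<open>Products of blocks\<close>

interpretation vol: exterior "{(x, y). x \<le> y} :: ('v::linorder \<times> 'v) set"
  by unfold_locales
    (auto simp: linear_order_on_def partial_order_on_def preorder_on_def refl_on_def trans_def antisym_def total_on_def)

abbreviation vol3 :: "'v::linorder \<Rightarrow> 'v \<Rightarrow> 'v \<Rightarrow> ('v set \<Rightarrow>\<^sub>0 int) \<Rightarrow> ('v set \<Rightarrow>\<^sub>0 int)" where
  "vol3 a b c v \<equiv> vol.E a (vol.E b (vol.E c v))"

locale ordered_matching_chains = matching_chains r for r :: "('v::linorder set \<times> 'v set) set"
begin

text \<open>A product of \<open>m\<close> blocks together with its volume form. The set consists of the vertices of the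
  blocks and of at most one spare vertex, which enters the volume form at the right end.\<close>

inductive block_product :: "nat \<Rightarrow> 'v set \<Rightarrow> ('v set set \<Rightarrow>\<^sub>0 int) \<Rightarrow> ('v set \<Rightarrow>\<^sub>0 int) \<Rightarrow> bool" where
  empty: "finite S \<Longrightarrow> card S \<le> 1 \<Longrightarrow> block_product 0 S (frag_of {}) (frag_of S)"
| blk: "block_product m W z v \<Longrightarrow> distinct [a, b, c] \<Longrightarrow> {a, b, c} \<inter> W = {} \<Longrightarrow>
    block_product (Suc m) ({a, b, c} \<union> W) (blk a b c z) (vol3 a b c v)"

lemma block_product_finite: "block_product m W z v \<Longrightarrow> finite W"
  by (induction rule: block_product.induct) auto

lemma card_triple_union:
  assumes "distinct [a, b, c]" "{a, b, c} \<inter> W = {}" "finite W"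
  shows "card ({a, b, c} \<union> W) = card W + 3"
  using assms by (subst card_Un_disjoint) auto

lemma block_product_cycle: "block_product m W z v \<Longrightarrow> z \<in> mcycles W m"
proof (induction rule: block_product.induct)
  case (empty S)
  have "frag_of {} \<in> mchains S 0" by (simp add: matchings_def)
  then show ?case by (intro mcyclesI) (simp_all add: simplicial_boundary_of)
next
  case (blk m W z v a b c)
  then show ?case by (intro blk_in_mcycles'[of z W]) auto
qed

text \<open>The spare vertex \<open>w\<close> does not occur in the chain: it can be dropped, or replaced by any new vertex
  \<open>s\<close>. The equation of volumes says that \<open>v'\<close> is \<open>v\<close> with \<open>w\<close> replaced by \<open>s\<close>.\<close>

lemma block_product_spare:
  assumes "block_product m W z v" "card W = Suc (3 * m)"
  obtains w where "w \<in> W" "\<And>s. s \<notin> W - {w} \<Longrightarrow>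
      \<exists>v'. block_product m (insert s (W - {w})) z v' \<and> vol.E s v = - vol.E w v'"
    "\<exists>v'. block_product m (W - {w}) z v'"
proof -
  have "\<exists>w\<in>W. (\<forall>s. s \<notin> W - {w} \<longrightarrow>
      (\<exists>v'. block_product m (insert s (W - {w})) z v' \<and> vol.E s v = - vol.E w v')) \<and>
      (\<exists>v'. block_product m (W - {w}) z v')"
    using assms
  proof (induction rule: block_product.induct)
    case (empty S)
    then obtain w where w: "S = {w}" by (metis One_nat_def card_1_singletonE mult_0_right)
    have one: "frag_of {s} = vol.E s (frag_of {})" for s :: 'v
      by (simp add: vol.E_basis vol.pos_def)
    show ?case
    proof (intro bexI[of _ w] conjI allI impI)
      fix s :: 'v
      show "\<exists>v'. block_product 0 (insert s (S - {w})) (frag_of {}) v' \<and> vol.E s (frag_of S) = - vol.E w v'"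
        by (rule exI[of _ "frag_of {s}"])
          (use block_product.empty[of "{s}"] in \<open>simp add: w one vol.E_anticommute[of s]\<close>)
      show "\<exists>v'. block_product 0 (S - {w}) (frag_of {}) v'"
        using block_product.empty[of "{}"] w by auto
    qed (simp add: w)
  next
    case (blk m W z v a b c)
    have cW: "card W = Suc (3 * m)"
      using blk.prems blk.hyps card_triple_union[of a b c W] block_product_finite[of m W z v] by auto
    from blk.IH[OF cW] obtain w where w: "w \<in> W" "\<And>s. s \<notin> W - {w} \<Longrightarrow>
      \<exists>v'. block_product m (insert s (W - {w})) z v' \<and> vol.E s v = - vol.E w v'"
      "\<exists>v'. block_product m (W - {w}) z v'" by blast
    have abc: "{a, b, c} \<union> W - {w} = {a, b, c} \<union> (W - {w})"
      using w(1) blk.hyps by auto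
    show ?case
    proof (intro bexI[of _ w] conjI allI impI)
      fix s assume s: "s \<notin> {a, b, c} \<union> W - {w}"
      then have "s \<notin> W - {w}" by auto
      from w(2)[OF this] obtain v' where v': "block_product m (insert s (W - {w})) z v'"
        "vol.E s v = - vol.E w v'" by blast
      have "block_product (Suc m) ({a, b, c} \<union> insert s (W - {w})) (blk a b c z) (vol3 a b c v')"
        using s blk.hyps abc by (intro block_product.blk[OF v'(1)]) auto
      moreover have "{a, b, c} \<union> insert s (W - {w}) = insert s ({a, b, c} \<union> W - {w})"
        using abc by auto
      moreover have "vol.E s (vol3 a b c v) = - vol.E w (vol3 a b c v')"
        using v'(2) by (simp add: vol.E_anticommute[of s] vol.E_anticommute[of w])
      ultimately show "\<exists>v'. block_product (Suc m) (insert s ({a, b, c} \<union> W - {w})) (blk a b c z) v' \<and>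
          vol.E s (vol3 a b c v) = - vol.E w v'" by auto
    next
      obtain v' where "block_product m (W - {w}) z v'" using w(3) by blast
      from block_product.blk[OF this blk.hyps(2)] show
        "\<exists>v'. block_product (Suc m) ({a, b, c} \<union> W - {w}) (blk a b c z) v'"
        unfolding abc using blk.hyps(3) by blast
    qed (use w(1) in simp)
  qed
  then show ?thesis using that by blast
qed

text \<open>Integral combinations, with their total volume. The volume belongs to the expression rather than
  to the chain; that it is determined modulo 3 by the homology class is a theorem below.\<close>

inductive combination :: "nat \<Rightarrow> 'v set \<Rightarrow> ('v set set \<Rightarrow>\<^sub>0 int) \<Rightarrow> ('v set \<Rightarrow>\<^sub>0 int) \<Rightarrow> bool" for m V where
  zero: "combination m V 0 0"
| product: "block_product m V z v \<Longrightarrow> combination m V z v"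
| diff: "combination m V y u \<Longrightarrow> combination m V z v \<Longrightarrow> combination m V (y - z) (u - v)"

lemma combination_add:
  "combination m V y u \<Longrightarrow> combination m V z v \<Longrightarrow> combination m V (y + z) (u + v)"
  using combination.diff[of m V y u "- z" "- v"] combination.diff[OF combination.zero, of m V z v] by simp

lemma combination_sum:
  "(\<And>i. i \<in> I \<Longrightarrow> combination m V (f i) (g i)) \<Longrightarrow> combination m V (sum f I) (sum g I)"
  by (induction I rule: infinite_finite_induct) (auto intro: combination.zero combination_add)

lemma combination_cmul: "combination m V z v \<Longrightarrow> combination m V (frag_cmul n z) (frag_cmul n v)"
proof (induction n rule: int_induct[of _ 0])
  case base
  show ?case by (simp add: combination.zero)
next
  case (step1 i)
  then show ?case using combination_add[of m V "frag_cmul i z" "frag_cmul i v" z v]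
    by (simp add: frag_cmul_distrib)
next
  case (step2 i)
  then show ?case using combination.diff[of m V "frag_cmul i z" "frag_cmul i v" z v]
    by (simp add: frag_cmul_diff_distrib)
qed

lemma combination_blk:
  assumes "combination m (V - {a, b, c}) z v" "distinct [a, b, c]" "{a, b, c} \<subseteq> V"
  shows "combination (Suc m) V (blk a b c z) (vol3 a b c v)"
  using assms(1)
proof induction
  case (product z v)
  have "{a, b, c} \<union> (V - {a, b, c}) = V" using assms(3) by auto
  then show ?case
    using block_product.blk[OF product assms(2)] by (auto intro: combination.product)
next
  case (diff y u z v)
  from combination.diff[OF diff.IH] show ?case by simp
qed (simp add: combination.zero)

lemma combination_cycle: "combination m V z v \<Longrightarrow> z \<in> mcycles V m"
  by (induction rule: combination.induct) (auto intro: block_product_cycle)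

definition generated :: "nat \<Rightarrow> 'v set \<Rightarrow> ('v set set \<Rightarrow>\<^sub>0 int) \<Rightarrow> bool" where
  "generated m V c \<longleftrightarrow> (\<exists>z v. combination m V z v \<and> c - z \<in> mbounds V m)"

lemma generated_add: "generated m V c \<Longrightarrow> generated m V d \<Longrightarrow> generated m V (c + d)"
  unfolding generated_def by (metis combination_add mbounds_closed(3) add_diff_add)

lemma generated_mbounds: "c \<in> mbounds V m \<Longrightarrow> generated m V c"
  unfolding generated_def by (metis combination.zero diff_zero)

lemma generated_sum: "(\<And>i. i \<in> I \<Longrightarrow> generated m V (f i)) \<Longrightarrow> generated m V (sum f I)"
  by (induction I rule: infinite_finite_induct) (auto intro: generated_add generated_mbounds)

lemma generated_blk:
  assumes "generated m (V - {a, b, c}) y" "distinct [a, b, c]" "{a, b, c} \<subseteq> V"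
  shows "generated (Suc m) V (blk a b c y)"
proof -
  obtain z v where "combination m (V - {a, b, c}) z v" "y - z \<in> mbounds (V - {a, b, c}) m"
    using assms(1) by (auto simp: generated_def)
  then show ?thesis
    using combination_blk[OF _ assms(2,3)] blk_in_mbounds[OF _ assms(2,3)]
    unfolding generated_def by (metis blk_linear(3))
qed

text \<open>The coefficients of the pairs \<open>px qy\<close> are cycles with \<open>m - 2\<close> edges on at least \<open>3m - 4\<close> vertices,
  which bound by \<open>cycles_below_bound\<close>. So a cycle is a sum of blocks, and the induction proceeds.\<close>

theorem cycles_generated:
  assumes "finite V" "card V = 3 * m \<or> card V = Suc (3 * m)" "c \<in> mcycles V m"
  shows "generated m V c"
  using assms
proof (induction m arbitrary: V c)
  case 0
  then obtain n where n: "c = frag_cmul n (frag_of {})"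
    using mchains_0_subset[of c V] by auto
  have "combination 0 V (frag_of {}) (frag_of V)"
    using 0 by (intro combination.product block_product.empty) auto
  from combination_cmul[OF this] show ?case
    unfolding generated_def n by (intro exI[of _ "frag_cmul n (frag_of {})"] exI conjI) auto
next
  case (Suc k)
  have "1 < card V" using Suc.prems(2) by auto
  then obtain p q where pq: "p \<in> V" "q \<in> V" "p \<noteq> q"
    by (metis card_le_Suc0_iff_eq Suc.prems(1) not_less One_nat_def)
  have card: "card (V - X) = card V - card X" if "X \<subseteq> V" for X
    using that Suc.prems(1) by (simp add: card_Diff_subset finite_subset)
  have filled: "\<exists>h \<in> mchains (V - {p, q, x, y}) k. bd h = lk q y (lk p x c)"
    if x: "x \<in> V - {p, q}" and y: "y \<in> V - {p, q, x}" for x y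
  proof (cases k)
    case 0
    then have "lk q y (lk p x c) = 0"
      using lk_in_mchains[of c V 0 p x] Suc.prems(3) lk_mchains_0 by auto
    then show ?thesis by (intro bexI[of _ 0]) auto
  next
    case (Suc i)
    have "lk q y (lk p x c) \<in> mcycles (V - {p, x} - {q, y}) i"
      using Suc.prems(3) Suc by (intro lk_in_mcycles) simp
    moreover have "V - {p, x} - {q, y} = V - {p, q, x, y}" by auto
    moreover have "card {p, q, x, y} = 4" using x y pq by auto
    then have "card (V - {p, q, x, y}) = card V - 4" using x y pq card by auto
    then have "i < (card (V - {p, q, x, y}) + 1) div 3"
      using Suc.prems(2) Suc by auto
    ultimately have "lk q y (lk p x c) \<in> mbounds (V - {p, q, x, y}) i"
      using Suc.prems(1) by (intro cycles_below_bound) auto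
    then show ?thesis using Suc by (auto simp: mbounds_def)
  qed
  from blk_decomposition[OF Suc.prems(1) pq Suc.prems(3) filled]
  obtain a b where ab: "\<And>x. x \<in> V - {p, q} \<Longrightarrow> a x \<in> mcycles (V - {p, q, x}) k"
    "\<And>x. x \<in> V - {p, q} \<Longrightarrow> b x \<in> mcycles (V - {p, q, x}) k"
    "c - (\<Sum>x\<in>V - {p, q}. blk p x q (a x) + blk q x p (b x)) \<in> mbounds V (Suc k)"
    by blast
  have "generated (Suc k) V (blk p x q (a x) + blk q x p (b x))" if x: "x \<in> V - {p, q}" for x
  proof -
    have "card {p, q, x} = 3" using x pq by auto
    then have "card (V - {p, q, x}) = card V - 3" using x pq card by auto
    then have "generated k (V - {p, q, x}) (a x)" "generated k (V - {p, q, x}) (b x)"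
      using ab(1,2)[OF x] Suc.prems by (auto intro!: Suc.IH)
    moreover have "V - {p, x, q} = V - {p, q, x}" "V - {q, x, p} = V - {p, q, x}" by auto
    ultimately show ?thesis
      using x pq by (intro generated_add generated_blk) auto
  qed
  then have "generated (Suc k) V (\<Sum>x\<in>V - {p, q}. blk p x q (a x) + blk q x p (b x))"
    by (rule generated_sum)
  from generated_add[OF this generated_mbounds[OF ab(3)]] show ?case by simp
qed

section \<open>Pentagons\<close>

text \<open>The pentagon with the edges \<open>px, qy, wx, pq, yw\<close>, cyclically adjacent in this order in the matching
  complex of five vertices.\<close>

definition pent :: "'v \<Rightarrow> 'v \<Rightarrow> 'v \<Rightarrow> 'v \<Rightarrow> 'v \<Rightarrow> ('v set set \<Rightarrow>\<^sub>0 int) \<Rightarrow> ('v set set \<Rightarrow>\<^sub>0 int)" where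
  "pent p x q y w z = ed p x (ed q y z) + ed q y (ed w x z) + ed w x (ed p q z)
     + ed p q (ed y w z) + ed y w (ed p x z)"

lemma pent_linear [simp]:
  "pent p x q y w 0 = 0" "pent p x q y w (a + b) = pent p x q y w a + pent p x q y w b"
  "pent p x q y w (a - b) = pent p x q y w a - pent p x q y w b"
  by (simp_all add: pent_def algebra_simps)

lemma bd_pent: "finitary z \<Longrightarrow> bd (pent p x q y w z) = pent p x q y w (bd z)"
  by (simp add: pent_def bd_E algebra_simps)

lemma blk_pent: "blk a b c (pent p x q y w z) = pent p x q y w (blk a b c z)"
  by (simp add: pent_def blk_E_commute flip: minus_add_distrib)

lemma pent_in_mchains:
  assumes "z \<in> mchains W k" "distinct [p, x, q, y, w]" "{p, x, q, y, w} \<subseteq> V" "W \<subseteq> V - {p, x, q, y, w}"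
  shows "pent p x q y w z \<in> mchains V (Suc (Suc k))"
proof -
  have "z \<in> mchains (V - {p, x, q, y, w}) k"
    by (rule mchains_mono[OF assms(1,4)])
  then show ?thesis
    unfolding pent_def using assms(2,3)
    by (intro mchains_add ed_ed_in_mchains[where X = "{p, x, q, y, w}"]) auto
qed

lemma pent_in_mbounds:
  assumes "z \<in> mbounds W k" "distinct [p, x, q, y, w]" "{p, x, q, y, w} \<subseteq> V" "W \<subseteq> V - {p, x, q, y, w}"
  shows "pent p x q y w z \<in> mbounds V (Suc (Suc k))"
proof -
  obtain u where u: "u \<in> mchains W (Suc k)" "z = bd u"
    using assms(1) by (auto simp: mbounds_def)
  then have "pent p x q y w z = bd (pent p x q y w u)"
    using mchains_finitary[OF u(1)] by (simp add: bd_pent)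
  then show ?thesis
    using pent_in_mchains[OF u(1) assms(2-)] by (auto intro: mboundsI)
qed

text \<open>Among the five pairs of adjacent edges of the pentagon, only \<open>px qy\<close> consists of an edge at \<open>p\<close>
  and an edge at \<open>q\<close>, both different from \<open>pq\<close>.\<close>

lemma lk_lk_pent:
  assumes z: "z \<in> mchains W k" and W: "{p, x, q, y, w} \<inter> W = {}" and dist: "distinct [p, x, q, y, w]"
    and s: "s \<notin> {p, q}" "t \<notin> {p, q, s}"
  shows "lk q t (lk p s (pent p x q y w z)) = (if s = x \<and> t = y then z else 0)"
proof -
  have fin: "finitary z" using z by simp
  have no: "lk p s z = 0" "lk q t z = 0"
    using lk_eq_0[OF z] W by auto
  have same: "lk q y (ed q y z) = z" "lk p x (ed p x z) = z"
    using lk_ed_same[OF z] W by auto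
  have same': "lk p x (ed p x u) = u" if "u = ed q y z \<or> u = ed y w z" for u
    using D_E_same[of u "{p, x}"] that fin no(1) lk_eq_0[OF z, of p x] W dist
    by (auto simp: D_E doubleton_eq_iff)
  have other: "{p, s} \<noteq> {q, y}" "{p, s} \<noteq> {w, x}" "{p, s} \<noteq> {p, q}" "{p, s} \<noteq> {y, w}"
     "{q, t} \<noteq> {w, x}" "{q, t} \<noteq> {p, q}" "{q, t} \<noteq> {y, w}" "{q, t} \<noteq> {p, x}"
    using dist s by (auto simp: doubleton_eq_iff)
  have px: "{p, s} \<noteq> {p, x}" if "s \<noteq> x" using that by (auto simp: doubleton_eq_iff)
  have qy: "{q, t} \<noteq> {q, y}" if "t \<noteq> y" using that by (auto simp: doubleton_eq_iff)
  show ?thesis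
  proof (cases "s = x")
    case True
    have "lk p s (pent p x q y w z) = ed q y z - ed y w z"
      using fin other no same same' True by (simp add: pent_def D_E)
    then show ?thesis
      using fin other no same qy True by (cases "t = y") (simp_all add: D_E)
  next
    case False
    then have "lk p s (pent p x q y w z) = 0"
      using fin other no px by (simp add: pent_def D_E)
    then show ?thesis using False by simp
  qed
qed

inductive pent_combination :: "nat \<Rightarrow> 'v set \<Rightarrow> ('v set set \<Rightarrow>\<^sub>0 int) \<Rightarrow> bool" for k V where
  zero: "pent_combination k V 0"
| pent: "block_product m W z v \<Longrightarrow> k = Suc (Suc m) \<Longrightarrow> distinct [p, x, q, y, w] \<Longrightarrow>
    {p, x, q, y, w} \<union> W = V \<Longrightarrow> {p, x, q, y, w} \<inter> W = {} \<Longrightarrow> pent_combination k V (pent p x q y w z)"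
| diff: "pent_combination k V y \<Longrightarrow> pent_combination k V z \<Longrightarrow> pent_combination k V (y - z)"

lemma pent_combination_add:
  "pent_combination k V y \<Longrightarrow> pent_combination k V z \<Longrightarrow> pent_combination k V (y + z)"
  using pent_combination.diff[of k V y "- z"] pent_combination.diff[OF pent_combination.zero, of k V z] by simp

lemma pent_combination_cycle: "pent_combination k V z \<Longrightarrow> z \<in> mcycles V k"
proof (induction rule: pent_combination.induct)
  case (pent m W z v p x q y w)
  have "z \<in> mcycles W m" using pent(1) by (rule block_product_cycle)
  then show ?case
    using pent pent_in_mchains[of z W m p x q y w V]
    by (intro mcyclesI) (auto simp: bd_pent)
qed auto

lemma pent_combination_blk:
  assumes "pent_combination k (V - {a, b, c}) z" "distinct [a, b, c]" "{a, b, c} \<subseteq> V"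
  shows "pent_combination (Suc k) V (blk a b c z)"
  using assms(1)
proof induction
  case (pent m W z v p x q y w)
  have "block_product (Suc m) ({a, b, c} \<union> W) (blk a b c z) (vol3 a b c v)"
    using pent assms by (intro block_product.blk) auto
  moreover have "{p, x, q, y, w} \<union> ({a, b, c} \<union> W) = V" "{p, x, q, y, w} \<inter> ({a, b, c} \<union> W) = {}"
    using pent assms by auto
  ultimately show ?case
    using pent(2,3) unfolding blk_pent by (intro pent_combination.pent) auto
next
  case (diff y z)
  from pent_combination.diff[OF diff.IH] show ?case by simp
qed (simp add: pent_combination.zero)

definition pent_generated :: "nat \<Rightarrow> 'v set \<Rightarrow> ('v set set \<Rightarrow>\<^sub>0 int) \<Rightarrow> bool" where
  "pent_generated k V c \<longleftrightarrow> (\<exists>z. pent_combination k V z \<and> c - z \<in> mbounds V k)"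

lemma pent_generated_add: "pent_generated k V c \<Longrightarrow> pent_generated k V d \<Longrightarrow> pent_generated k V (c + d)"
  unfolding pent_generated_def by (metis pent_combination_add mbounds_closed(3) add_diff_add)

lemma pent_generated_mbounds: "c \<in> mbounds V k \<Longrightarrow> pent_generated k V c"
  unfolding pent_generated_def by (metis pent_combination.zero diff_zero)

lemma pent_generated_sum: "(\<And>i. i \<in> I \<Longrightarrow> pent_generated k V (f i)) \<Longrightarrow> pent_generated k V (sum f I)"
  by (induction I rule: infinite_finite_induct) (auto intro: pent_generated_add pent_generated_mbounds)

lemma pent_generated_blk:
  assumes "pent_generated k (V - {a, b, c}) y" "distinct [a, b, c]" "{a, b, c} \<subseteq> V"
  shows "pent_generated (Suc k) V (blk a b c y)"
proof -
  obtain z where "pent_combination k (V - {a, b, c}) z" "y - z \<in> mbounds (V - {a, b, c}) k"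
    using assms(1) by (auto simp: pent_generated_def)
  then show ?thesis
    using pent_combination_blk[OF _ assms(2,3)] blk_in_mbounds[OF _ assms(2,3)]
    unfolding pent_generated_def by (metis blk_linear(3))
qed

text \<open>On \<open>3m + 1\<close> vertices each product of blocks has a spare vertex \<open>w\<close>, which completes \<open>px qy\<close> to a
  pentagon.\<close>

lemma pent_lift:
  assumes "combination m (V - {p, x, q, y}) z v" "card (V - {p, x, q, y}) = Suc (3 * m)"
    "distinct [p, x, q, y]" "{p, x, q, y} \<subseteq> V"
  obtains L where "pent_combination (Suc (Suc m)) V L"
    "\<And>s t. s \<notin> {p, q} \<Longrightarrow> t \<notin> {p, q, s} \<Longrightarrow> lk q t (lk p s L) = (if s = x \<and> t = y then z else 0)"
proof -
  have "\<exists>L. pent_combination (Suc (Suc m)) V L \<and>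
    (\<forall>s t. s \<notin> {p, q} \<longrightarrow> t \<notin> {p, q, s} \<longrightarrow> lk q t (lk p s L) = (if s = x \<and> t = y then z else 0))"
    using assms(1)
  proof induction
    case zero
    show ?case by (rule exI[of _ 0]) (simp add: pent_combination.zero)
  next
    case (product z v)
    obtain w where w: "w \<in> V - {p, x, q, y}" "\<exists>v'. block_product m (V - {p, x, q, y} - {w}) z v'"
      using block_product_spare[OF product assms(2)] by metis
    then obtain v' where v': "block_product m (V - {p, x, q, y} - {w}) z v'" by blast
    have dist: "distinct [p, x, q, y, w]" using w assms(3) by auto
    have "pent_combination (Suc (Suc m)) V (pent p x q y w z)"
      using w assms dist by (intro pent_combination.pent[OF v']) auto
    moreover have "lk q t (lk p s (pent p x q y w z)) = (if s = x \<and> t = y then z else 0)"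
      if "s \<notin> {p, q}" "t \<notin> {p, q, s}" for s t
      by (rule lk_lk_pent[OF mcycles_mchains[OF block_product_cycle[OF v']] _ dist that]) auto
    ultimately show ?case by blast
  next
    case (diff z v z' v')
    then obtain L L' where "pent_combination (Suc (Suc m)) V L" "pent_combination (Suc (Suc m)) V L'"
      "\<forall>s t. s \<notin> {p, q} \<longrightarrow> t \<notin> {p, q, s} \<longrightarrow> lk q t (lk p s L) = (if s = x \<and> t = y then z else 0)"
      "\<forall>s t. s \<notin> {p, q} \<longrightarrow> t \<notin> {p, q, s} \<longrightarrow> lk q t (lk p s L') = (if s = x \<and> t = y then z' else 0)"
      by blast
    then show ?case
      by (intro exI[of _ "L - L'"]) (auto intro: pent_combination.diff)
  qed
  then show ?thesis using that by blast
qed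

text \<open>Here the coefficients of the pairs \<open>px qy\<close> need not bound, but they are generated by products of
  blocks on \<open>3 (m - 1) + 1\<close> vertices. Subtracting pentagons from the cycle changes them into
  boundaries.\<close>

theorem cycles_pent_generated:
  assumes "finite V" "card V = 3 * m + 2" "c \<in> mcycles V (Suc m)"
  shows "pent_generated (Suc m) V c"
  using assms
proof (induction m arbitrary: V c)
  case 0
  then have "card V = 2" by simp
  then obtain p q where pq: "V = {p, q}" "p \<noteq> q" by (auto simp: card_2_iff)
  have "c \<in> mbounds V (Suc 0)"
    using pq 0 by (intro cone_cycle_bounds[of V p q]) auto
  then show ?case by (rule pent_generated_mbounds)
next
  case (Suc i)
  have "1 < card V" using Suc.prems(2) by linarith
  then obtain p q where pq: "p \<in> V" "q \<in> V" "p \<noteq> q"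
    by (metis card_le_Suc0_iff_eq Suc.prems(1) not_less One_nat_def)
  have card: "card (V - X) = card V - card X" if "X \<subseteq> V" for X
    using that Suc.prems(1) by (simp add: card_Diff_subset finite_subset)
  let ?good = "\<lambda>x y L. pent_combination (Suc (Suc i)) V L \<and>
      (\<forall>s t. s \<notin> {p, q} \<longrightarrow> t \<notin> {p, q, s} \<longrightarrow> (s, t) \<noteq> (x, y) \<longrightarrow> lk q t (lk p s L) = 0) \<and>
      lk q y (lk p x c) - lk q y (lk p x L) \<in> mbounds (V - {p, q, x, y}) i"
  have ex: "\<exists>L. ?good x y L" if x: "x \<in> V - {p, q}" and y: "y \<in> V - {p, q} - {x}" for x y
  proof -
    have set: "V - {p, x} - {q, y} = V - {p, q, x, y}" "V - {p, x, q, y} = V - {p, q, x, y}" by auto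
    have "lk q y (lk p x c) \<in> mcycles (V - {p, x} - {q, y}) i"
      using Suc.prems(3) by (intro lk_in_mcycles)
    moreover have "card {p, q, x, y} = 4" using x y pq by auto
    then have cd: "card (V - {p, q, x, y}) = Suc (3 * i)" using x y pq card Suc.prems(2) by auto
    ultimately have "generated i (V - {p, q, x, y}) (lk q y (lk p x c))"
      using Suc.prems(1) by (intro cycles_generated) (auto simp: set)
    then obtain z v where zv: "combination i (V - {p, x, q, y}) z v"
      "lk q y (lk p x c) - z \<in> mbounds (V - {p, q, x, y}) i"
      by (auto simp: generated_def set)
    obtain L where L: "pent_combination (Suc (Suc i)) V L"
      "\<And>s t. s \<notin> {p, q} \<Longrightarrow> t \<notin> {p, q, s} \<Longrightarrow> lk q t (lk p s L) = (if s = x \<and> t = y then z else 0)"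
      using pent_lift[OF zv(1)] cd x y pq by (auto simp: set)
    have "lk q y (lk p x L) = z" using L(2)[of x y] x y by auto
    then show ?thesis using L zv(2) by (intro exI[of _ L]) auto
  qed
  define L where "L x y = (SOME L. ?good x y L)" for x y
  have L: "?good x y (L x y)" if "x \<in> V - {p, q}" "y \<in> V - {p, q} - {x}" for x y
    unfolding L_def by (rule someI_ex[OF ex[OF that]])
  define P where "P = (\<Sum>x\<in>V - {p, q}. \<Sum>y\<in>V - {p, q} - {x}. L x y)"
  have sum_closed: "pent_combination k V (sum f I)" if "\<And>i. i \<in> I \<Longrightarrow> pent_combination k V (f i)" for k f and I :: "'v set"
    using that by (induction I rule: infinite_finite_induct)
      (auto intro: pent_combination.zero pent_combination_add)
  have P: "pent_combination (Suc (Suc i)) V P"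
    unfolding P_def using L by (intro sum_closed) blast
  have lk_P: "lk q y (lk p x P) = lk q y (lk p x (L x y))"
    if x: "x \<in> V - {p, q}" and y: "y \<in> V - {p, q} - {x}" for x y
  proof -
    have inner: "(\<Sum>t\<in>V - {p, q} - {s}. lk q y (lk p x (L s t))) =
        (if s = x then lk q y (lk p x (L x y)) else 0)" if s: "s \<in> V - {p, q}" for s
    proof -
      have "lk q y (lk p x (L s t)) = (if s = x \<and> t = y then lk q y (lk p x (L x y)) else 0)"
        if "t \<in> V - {p, q} - {s}" for t
        using L[OF s that] x y by auto
      then have "(\<Sum>t\<in>V - {p, q} - {s}. lk q y (lk p x (L s t))) =
          (\<Sum>t\<in>V - {p, q} - {s}. if s = x \<and> t = y then lk q y (lk p x (L x y)) else 0)"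
        by (intro sum.cong) auto
      then show ?thesis using y Suc.prems(1) by (cases "s = x") auto
    qed
    have "lk q y (lk p x P) = (\<Sum>s\<in>V - {p, q}. \<Sum>t\<in>V - {p, q} - {s}. lk q y (lk p x (L s t)))"
      by (simp add: P_def D_sum)
    also have "\<dots> = (\<Sum>s\<in>V - {p, q}. if s = x then lk q y (lk p x (L x y)) else 0)"
      using inner by (intro sum.cong) auto
    finally show ?thesis using x Suc.prems(1) by simp
  qed
  have cP: "c - P \<in> mcycles V (Suc (Suc i))"
    using Suc.prems(3) pent_combination_cycle[OF P] by simp
  have filled: "\<exists>h \<in> mchains (V - {p, q, x, y}) (Suc i). bd h = lk q y (lk p x (c - P))"
    if x: "x \<in> V - {p, q}" and y: "y \<in> V - {p, q, x}" for x y
  proof -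
    have y': "y \<in> V - {p, q} - {x}" using y by auto
    have "lk q y (lk p x (c - P)) \<in> mbounds (V - {p, q, x, y}) i"
      using L[OF x y'] lk_P[OF x y'] by simp
    then show ?thesis by (auto simp: mbounds_def)
  qed
  from blk_decomposition[OF Suc.prems(1) pq cP filled]
  obtain a b where ab: "\<And>x. x \<in> V - {p, q} \<Longrightarrow> a x \<in> mcycles (V - {p, q, x}) (Suc i)"
    "\<And>x. x \<in> V - {p, q} \<Longrightarrow> b x \<in> mcycles (V - {p, q, x}) (Suc i)"
    "c - P - (\<Sum>x\<in>V - {p, q}. blk p x q (a x) + blk q x p (b x)) \<in> mbounds V (Suc (Suc i))"
    by blast
  have "pent_generated (Suc (Suc i)) V (blk p x q (a x) + blk q x p (b x))" if x: "x \<in> V - {p, q}" for x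
  proof -
    have "card {p, q, x} = 3" using x pq by auto
    then have "card (V - {p, q, x}) = 3 * i + 2" using x pq card Suc.prems(2) by auto
    then have "pent_generated (Suc i) (V - {p, q, x}) (a x)" "pent_generated (Suc i) (V - {p, q, x}) (b x)"
      using ab(1,2)[OF x] Suc.prems(1) by (auto intro!: Suc.IH)
    moreover have "V - {p, x, q} = V - {p, q, x}" "V - {q, x, p} = V - {p, q, x}" by auto
    ultimately show ?thesis
      using x pq by (intro pent_generated_add pent_generated_blk) auto
  qed
  then have "pent_generated (Suc (Suc i)) V (\<Sum>x\<in>V - {p, q}. blk p x q (a x) + blk q x p (b x))"
    by (rule pent_generated_sum)
  from pent_generated_add[OF this pent_generated_mbounds[OF ab(3)]]
  have "pent_generated (Suc (Suc i)) V (c - P)" by simp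
  moreover have "pent_generated (Suc (Suc i)) V P"
    using P unfolding pent_generated_def by (intro exI[of _ P]) auto
  ultimately show ?case
    using pent_generated_add by fastforce
qed

end

section \<open>The torsion bound\<close>

context ordered_matching_chains
begin

lemma block_product_SucE:
  assumes "block_product (Suc m) V z v"
  obtains a b c W z' v' where "block_product m W z' v'" "distinct [a, b, c]" "{a, b, c} \<inter> W = {}"
    "V = {a, b, c} \<union> W" "z = blk a b c z'" "v = vol3 a b c v'" "finite W" "card V = card W + 3"
  using assms
proof cases
  case (blk W z v a b c)
  then show ?thesis
    using that card_triple_union[of a b c W] block_product_finite by metis
qed

text \<open>Either the first two blocks and the spare vertex, or the first four blocks, are enough; the other
  blocks are carried along as a cycle on disjoint vertices.\<close>

lemma three_block_product:
  assumes "block_product m V z v" "m \<ge> 4 \<or> m \<ge> 2 \<and> card V = Suc (3 * m)"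
  shows "z + z + z \<in> mbounds V m"
proof -
  have "2 \<le> m" using assms(2) by auto
  then obtain i where i: "m = Suc (Suc i)" using le_Suc_ex[of 2 m] by auto
  obtain a b c W z1 v1 where 1: "block_product (Suc i) W z1 v1" "distinct [a, b, c]" "{a, b, c} \<inter> W = {}"
    "V = {a, b, c} \<union> W" "z = blk a b c z1" "card V = card W + 3"
    using assms(1) unfolding i by (rule block_product_SucE) blast
  obtain d e f X z2 v2 where 2: "block_product i X z2 v2" "distinct [d, e, f]" "{d, e, f} \<inter> X = {}"
    "W = {d, e, f} \<union> X" "z1 = blk d e f z2" "card W = card X + 3"
    using 1(1) by (rule block_product_SucE) blast
  show ?thesis
  proof (cases "card V = Suc (3 * m)")
    case True
    then have "card X = Suc (3 * i)" using 1 2 i by simp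
    from block_product_spare[OF 2(1) this] obtain w v' where w: "w \<in> X" "block_product i (X - {w}) z2 v'"
      by metis
    have "distinct [a, b, c, d, e, f, w]" "{a, b, c, d, e, f, w} \<subseteq> V - (X - {w})" "X - {w} \<subseteq> V"
      using 1 2 w by auto
    from three_blk2_bounds[OF block_product_cycle[OF w(2)] this(3,1,2)]
    show ?thesis unfolding i 1(5) 2(5) .
  next
    case False
    then have "2 \<le> i" using assms(2) i by auto
    then obtain j where j: "i = Suc (Suc j)" using le_Suc_ex[of 2 i] by auto
    obtain g k l Y z3 v3 where 3: "block_product (Suc j) Y z3 v3" "distinct [g, k, l]" "{g, k, l} \<inter> Y = {}"
      "X = {g, k, l} \<union> Y" "z2 = blk g k l z3" "card X = card Y + 3"
      using 2(1) unfolding j by (rule block_product_SucE) blast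
    obtain s t u U z4 v4 where 4: "block_product j U z4 v4" "distinct [s, t, u]" "{s, t, u} \<inter> U = {}"
      "Y = {s, t, u} \<union> U" "z3 = blk s t u z4" "card Y = card U + 3"
      using 3(1) by (rule block_product_SucE) blast
    have "distinct [a, b, c, d, e, f, g, k, l, s, t, u]"
      "{a, b, c, d, e, f, g, k, l, s, t, u} \<subseteq> V - U" "U \<subseteq> V"
      using 1(2-4) 2(2-4) 3(2-4) 4(2-4) by auto
    from three_blk4_bounds[OF block_product_cycle[OF 4(1)] this(3,1,2)]
    show ?thesis unfolding i j 1(5) 2(5) 3(5) 4(5) .
  qed
qed

lemma three_bounds_transfer:
  assumes "c - z \<in> mbounds V m" "z + z + z \<in> mbounds V m"
  shows "c + c + c \<in> mbounds V m"
proof -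
  have "c + c + c = (c - z) + ((c - z) + ((c - z) + (z + z + z)))"
    by (simp add: algebra_simps)
  then show ?thesis
    using mbounds_closed(3)[OF assms(1) mbounds_closed(3)[OF assms(1) mbounds_closed(3)[OF assms]]]
    by (simp only:)
qed

lemma three_cycle_bounds:
  assumes "finite V" "card V = 3 * m \<or> card V = Suc (3 * m)" "m \<ge> 4 \<or> m \<ge> 2 \<and> card V = Suc (3 * m)"
    and "c \<in> mcycles V m"
  shows "c + c + c \<in> mbounds V m"
proof -
  obtain z v where z: "combination m V z v" "c - z \<in> mbounds V m"
    using cycles_generated[OF assms(1,2,4)] by (auto simp: generated_def)
  have "z + z + z \<in> mbounds V m"
    using z(1)
  proof induction
    case (product z v)
    then show ?case using assms(3) by (rule three_block_product)
  next
    case (diff y u z v)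
    have "y - z + (y - z) + (y - z) = (y + y + y) - (z + z + z)" by (simp add: algebra_simps)
    then show ?case using mbounds_closed(4)[OF diff.IH] by (simp only:)
  qed simp
  with z(2) show ?thesis by (rule three_bounds_transfer)
qed

lemma three_pent_cycle_bounds:
  assumes "finite V" "card V = 3 * m + 2" "m \<ge> 5" "c \<in> mcycles V (Suc m)"
  shows "c + c + c \<in> mbounds V (Suc m)"
proof -
  obtain z where z: "pent_combination (Suc m) V z" "c - z \<in> mbounds V (Suc m)"
    using cycles_pent_generated[OF assms(1,2,4)] by (auto simp: pent_generated_def)
  have "z + z + z \<in> mbounds V (Suc m)"
    using z(1)
  proof induction
    case (pent i W z v p x q y w)
    then have "z + z + z \<in> mbounds W i" using assms(3) by (intro three_block_product) auto
    then have "pent p x q y w (z + z + z) \<in> mbounds V (Suc (Suc i))"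
      using pent by (intro pent_in_mbounds[of _ W]) auto
    then show ?case using pent(2) by simp
  next
    case (diff y z)
    have "y - z + (y - z) + (y - z) = (y + y + y) - (z + z + z)" by (simp add: algebra_simps)
    then show ?case using mbounds_closed(4)[OF diff.IH] by (simp only:)
  qed simp
  with z(2) show ?thesis by (rule three_bounds_transfer)
qed

end

section \<open>The volume form\<close>

definition threefold :: "('a \<Rightarrow>\<^sub>0 int) \<Rightarrow> bool" where
  "threefold v \<longleftrightarrow> (\<exists>u. v = frag_cmul 3 u)"

lemma threefold_closed [simp]:
  "threefold 0" "threefold u \<Longrightarrow> threefold v \<Longrightarrow> threefold (u + v)"
  "threefold u \<Longrightarrow> threefold v \<Longrightarrow> threefold (u - v)" "threefold u \<Longrightarrow> threefold (- u)"
  "threefold (v + v + v)"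
proof -
  show "threefold 0" unfolding threefold_def by (rule exI[of _ 0]) simp
  show "threefold (u + v)" if "threefold u" "threefold v"
    using that unfolding threefold_def by (metis frag_cmul_distrib2)
  show "threefold (u - v)" if uv: "threefold u" "threefold v"
  proof -
    from uv obtain x y where "u = frag_cmul 3 x" "v = frag_cmul 3 y" by (auto simp: threefold_def)
    then have "u - v = frag_cmul 3 (x - y)"
      by (intro poly_mapping_eqI) (simp add: lookup_minus)
    then show ?thesis unfolding threefold_def by blast
  qed
  show "threefold (- u)" if "threefold u"
  proof -
    from that obtain x where "u = frag_cmul 3 x" by (auto simp: threefold_def)
    then have "- u = frag_cmul 3 (- x)"
      by (intro poly_mapping_eqI) simp
    then show ?thesis unfolding threefold_def by blast
  qed
  have "v + v + v = frag_cmul 3 v"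
    by (intro poly_mapping_eqI) (simp add: lookup_add)
  then show "threefold (v + v + v)" unfolding threefold_def by blast
qed

lemma threefold_sum: "(\<And>i. i \<in> I \<Longrightarrow> threefold (f i)) \<Longrightarrow> threefold (sum f I)"
  by (induction I rule: infinite_finite_induct) auto

lemma sum_off_diagonal_swap:
  fixes f :: "'a \<Rightarrow> 'a \<Rightarrow> 'b::comm_monoid_add"
  assumes "finite I"
  shows "(\<Sum>x\<in>I. \<Sum>y\<in>I - {x}. f x y) = (\<Sum>y\<in>I. \<Sum>x\<in>I - {y}. f x y)"
proof -
  have 1: "(\<Sum>y\<in>I - {x}. f x y) = (\<Sum>y\<in>I. if x = y then 0 else f x y)" for x
    using assms by (intro sum.mono_neutral_cong_left) auto
  have 2: "(\<Sum>x\<in>I - {y}. f x y) = (\<Sum>x\<in>I. if x = y then 0 else f x y)" for y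
    using assms by (intro sum.mono_neutral_cong_left) auto
  show ?thesis unfolding 1 2 by (rule sum.swap)
qed

context ordered_matching_chains
begin

lemma threefold_E: "threefold v \<Longrightarrow> threefold (vol.E a v)"
  by (auto simp: threefold_def vol.E_cmul)

lemma vol3_commute: "vol.E x (vol3 a b c u) = - vol3 a b c (vol.E x u)"
  by (simp add: vol.E_anticommute[of x])

lemma vol3_vol3_commute: "vol3 a b c (vol3 d e f u) = - vol3 d e f (vol3 a b c u)"
  by (simp add: vol3_commute[of _ d e f])

definition centred :: "'v \<Rightarrow> nat \<Rightarrow> 'v set \<Rightarrow> ('v set set \<Rightarrow>\<^sub>0 int) \<Rightarrow> ('v set \<Rightarrow>\<^sub>0 int) \<Rightarrow> bool" where
  "centred p m V z v \<longleftrightarrow> (\<exists>b c W z' v'. block_product m W z' v' \<and> distinct [p, b, c] \<and>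
    {p, b, c} \<inter> W = {} \<and> V = {p, b, c} \<union> W \<and>
    z - blk p b c z' \<in> mbounds V (Suc m) \<and> v = vol3 p b c v')"

lemma centredI:
  assumes "block_product m W z' v'" "distinct [p, b, c]" "{p, b, c} \<inter> W = {}" "V = {p, b, c} \<union> W"
    "z - blk p b c z' \<in> mbounds V (Suc m)" "v = vol3 p b c v'"
  shows "centred p m V z v"
  unfolding centred_def using assms by blast

text \<open>If \<open>p\<close> is not already the centre of the block, it becomes so by a move on the tetrahedron formed by
  the block and the spare vertex. These moves preserve the volume form.\<close>

lemma centred_head:
  assumes prod: "block_product m W z v" and card: "card W = Suc (3 * m)"
    and dist: "distinct [a, b, c]" "{a, b, c} \<inter> W = {}" and V: "V = {a, b, c} \<union> W"
    and p: "p \<in> {a, b, c} \<or> m = 0 \<and> p \<in> W"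
  shows "centred p m V (blk a b c z) (vol3 a b c v)"
proof -
  obtain w where w: "w \<in> W" "\<And>s. s \<notin> W - {w} \<Longrightarrow>
      \<exists>v'. block_product m (insert s (W - {w})) z v' \<and> vol.E s v = - vol.E w v'"
    and "\<exists>v'. block_product m (W - {w}) z v'"
    using block_product_spare[OF prod card] by metis
  then have z: "z \<in> mcycles (W - {w}) m" using block_product_cycle by blast
  have sub: "{a, b, c, w} \<subseteq> V" "W - {w} \<subseteq> V - {a, b, c, w}" and dw: "distinct [a, b, c, w]"
    using V w(1) dist by auto
  consider "p = a" | "p = b" | "p = c" | "p \<notin> {a, b, c}" "m = 0" "p \<in> W" using p by auto
  then show ?thesis
  proof cases
    case 1
    then show ?thesis
      using assms by (intro centredI[OF prod, of p b c]) auto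
  next
    case 2
    obtain v' where v': "block_product m (insert c (W - {w})) z v'" "vol.E c v = - vol.E w v'"
      using w(2)[of c] dist by auto
    show ?thesis
    proof (rule centredI[OF v'(1)])
      show "blk a b c z - blk p a w z \<in> mbounds V (Suc m)"
        using blk_rotate[OF z dw sub] 2 by (simp add: homologous_def)
      show "vol3 a b c v = vol3 p a w v'"
        using v'(2) 2 by (simp add: vol.E_anticommute[of a b])
    qed (use 2 dist dw V w(1) in auto)
  next
    case 3
    obtain v' where v': "block_product m (insert b (W - {w})) z v'" "vol.E b v = - vol.E w v'"
      using w(2)[of b] dist by auto
    show ?thesis
    proof (rule centredI[OF v'(1)])
      have "homologous V (Suc m) (blk a c b z) (blk c a w z)"
        using dw sub by (intro blk_rotate[OF z]) auto
      from homologous_minus[OF this] show "blk a b c z - blk p w a z \<in> mbounds V (Suc m)"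
        using 3 by (simp add: homologous_def blk_commute[of a b c] blk_commute[of c w a])
      show "vol3 a b c v = vol3 p w a v'"
        using v'(2) 3 by (simp add: vol.E_anticommute[of b c] vol.E_anticommute[of a c] vol.E_anticommute[of a w])
    qed (use 3 dist dw V w(1) in auto)
  next
    case 4
    then have "p = w" using card w(1) by (metis One_nat_def card_1_singletonE mult_0_right singletonD)
    obtain v' where v': "block_product m (insert a (W - {w})) z v'" "vol.E a v = - vol.E w v'"
      using w(2)[of a] dist by auto
    show ?thesis
    proof (rule centredI[OF v'(1)])
      show "blk a b c z - blk p c b z \<in> mbounds V (Suc m)"
        using blk_exchange[OF z dw sub] \<open>p = w\<close> by (simp add: homologous_def blk_commute[of w c b])
      have "vol3 a b c v = vol3 b c a v"
        by (simp add: vol.E_anticommute[of a])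
      then show "vol3 a b c v = vol3 p c b v'"
        using v'(2) \<open>p = w\<close> by (simp add: vol.E_anticommute[of b c] vol.E_anticommute[of c w] vol.E_anticommute[of b w])
    qed (use \<open>p = w\<close> dist dw V w(1) in auto)
  qed
qed

lemma block_product_centred:
  assumes "block_product (Suc m) V z v" "card V = Suc (3 * Suc m)" "p \<in> V"
  shows "centred p m V z v"
  using assms
proof (induction m arbitrary: V z v)
  case 0
  obtain a b c W z' v' where *: "block_product 0 W z' v'" "distinct [a, b, c]" "{a, b, c} \<inter> W = {}"
    "V = {a, b, c} \<union> W" "z = blk a b c z'" "v = vol3 a b c v'" "card V = card W + 3"
    using 0(1) by (rule block_product_SucE) blast
  then show ?case
    unfolding *(5,6) using 0 by (intro centred_head) auto
next
  case (Suc m)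
  obtain a b c W z' v' where *: "block_product (Suc m) W z' v'" "distinct [a, b, c]" "{a, b, c} \<inter> W = {}"
    "V = {a, b, c} \<union> W" "z = blk a b c z'" "v = vol3 a b c v'" "card V = card W + 3"
    using Suc.prems(1) by (rule block_product_SucE) blast
  have card: "card W = Suc (3 * Suc m)" using *(7) Suc.prems(2) by simp
  show ?case
  proof (cases "p \<in> {a, b, c}")
    case True
    then show ?thesis
      unfolding *(5,6) using *(1-4) card by (intro centred_head) auto
  next
    case False
    then have "p \<in> W" using *(4) Suc.prems(3) by auto
    from Suc.IH[OF *(1) card this] obtain d e X y u where X: "block_product m X y u" "distinct [p, d, e]"
      "{p, d, e} \<inter> X = {}" "W = {p, d, e} \<union> X" "z' - blk p d e y \<in> mbounds W (Suc m)" "v' = vol3 p d e u"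
      unfolding centred_def by blast
    show ?thesis
    proof (rule centredI)
      show "block_product (Suc m) ({a, b, c} \<union> X) (blk a b c y) (vol3 a b c u)"
        using X *(2,3) by (intro block_product.blk) auto
      have "V - {a, b, c} = W" using *(3,4) by auto
      then have "blk a b c (z' - blk p d e y) \<in> mbounds V (Suc (Suc m))"
        using X(5) *(2,4) by (intro blk_in_mbounds) auto
      then show "z - blk p e d (blk a b c y) \<in> mbounds V (Suc (Suc m))"
        by (simp add: *(5) blk_blk_commute[of a] blk_commute[of p e d])
      show "v = vol3 p e d (vol3 a b c u)"
        by (simp add: *(6) X(6) vol3_vol3_commute[of a b c] vol.E_anticommute[of d e])
    qed (use X *(2,3,4) in auto)
  qed
qed

section \<open>Moving two vertices into one block\<close>

text \<open>Up to boundaries, and up to multiples of 3 in the volume, every product of blocks can be given a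
  first block that contains both \<open>p\<close> and \<open>q\<close>, centred at one of them.\<close>

definition split_off :: "'v \<Rightarrow> 'v \<Rightarrow> nat \<Rightarrow> 'v set \<Rightarrow> ('v set set \<Rightarrow>\<^sub>0 int) \<Rightarrow> ('v set \<Rightarrow>\<^sub>0 int) \<Rightarrow> bool" where
  "split_off p q m V z v \<longleftrightarrow> (\<exists>A S B T.
    (\<forall>x\<in>V - {p, q}. combination m (V - {p, q, x}) (A x) (S x) \<and> combination m (V - {p, q, x}) (B x) (T x)) \<and>
    z - (\<Sum>x\<in>V - {p, q}. blk p x q (A x) + blk q x p (B x)) \<in> mbounds V (Suc m) \<and>
    threefold (v - (\<Sum>x\<in>V - {p, q}. vol3 p x q (S x) + vol3 q x p (T x))))"

lemma split_offI:
  assumes "\<And>x. x \<in> V - {p, q} \<Longrightarrow> combination m (V - {p, q, x}) (A x) (S x)"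
    "\<And>x. x \<in> V - {p, q} \<Longrightarrow> combination m (V - {p, q, x}) (B x) (T x)"
    "z - (\<Sum>x\<in>V - {p, q}. blk p x q (A x) + blk q x p (B x)) \<in> mbounds V (Suc m)"
    "threefold (v - (\<Sum>x\<in>V - {p, q}. vol3 p x q (S x) + vol3 q x p (T x)))"
  shows "split_off p q m V z v"
  unfolding split_off_def using assms by blast

lemma split_off_congruent:
  assumes "z \<in> mbounds V (Suc m)" "threefold v"
  shows "split_off p q m V z v"
  by (rule split_offI[where A = "\<lambda>_. 0" and S = "\<lambda>_. 0" and B = "\<lambda>_. 0" and T = "\<lambda>_. 0"])
    (use assms in \<open>simp_all add: combination.zero\<close>)

lemma split_off_diff:
  assumes "split_off p q m V z v" "split_off p q m V z' v'"
  shows "split_off p q m V (z - z') (v - v')"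
proof -
  obtain A S B T where 1: "\<And>x. x \<in> V - {p, q} \<Longrightarrow>
      combination m (V - {p, q, x}) (A x) (S x) \<and> combination m (V - {p, q, x}) (B x) (T x)"
    "z - (\<Sum>x\<in>V - {p, q}. blk p x q (A x) + blk q x p (B x)) \<in> mbounds V (Suc m)"
    "threefold (v - (\<Sum>x\<in>V - {p, q}. vol3 p x q (S x) + vol3 q x p (T x)))"
    using assms(1) unfolding split_off_def by blast
  obtain A' S' B' T' where 2: "\<And>x. x \<in> V - {p, q} \<Longrightarrow>
      combination m (V - {p, q, x}) (A' x) (S' x) \<and> combination m (V - {p, q, x}) (B' x) (T' x)"
    "z' - (\<Sum>x\<in>V - {p, q}. blk p x q (A' x) + blk q x p (B' x)) \<in> mbounds V (Suc m)"
    "threefold (v' - (\<Sum>x\<in>V - {p, q}. vol3 p x q (S' x) + vol3 q x p (T' x)))"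
    using assms(2) unfolding split_off_def by blast
  show ?thesis
  proof (rule split_offI[where A = "\<lambda>x. A x - A' x" and S = "\<lambda>x. S x - S' x" and B = "\<lambda>x. B x - B' x"
        and T = "\<lambda>x. T x - T' x"])
    have "z - z' - (\<Sum>x\<in>V - {p, q}. blk p x q (A x - A' x) + blk q x p (B x - B' x)) =
        (z - (\<Sum>x\<in>V - {p, q}. blk p x q (A x) + blk q x p (B x)))
        - (z' - (\<Sum>x\<in>V - {p, q}. blk p x q (A' x) + blk q x p (B' x)))"
      by (simp add: sum.distrib sum_subtractf algebra_simps)
    then show "z - z' - (\<Sum>x\<in>V - {p, q}. blk p x q (A x - A' x) + blk q x p (B x - B' x)) \<in> mbounds V (Suc m)"
      using mbounds_closed(4)[OF 1(2) 2(2)] by (simp only:)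
    have "v - v' - (\<Sum>x\<in>V - {p, q}. vol3 p x q (S x - S' x) + vol3 q x p (T x - T' x)) =
        (v - (\<Sum>x\<in>V - {p, q}. vol3 p x q (S x) + vol3 q x p (T x)))
        - (v' - (\<Sum>x\<in>V - {p, q}. vol3 p x q (S' x) + vol3 q x p (T' x)))"
      by (simp add: sum.distrib sum_subtractf algebra_simps)
    then show "threefold (v - v' - (\<Sum>x\<in>V - {p, q}. vol3 p x q (S x - S' x) + vol3 q x p (T x - T' x)))"
      using threefold_closed(3)[OF 1(3) 2(3)] by (simp only:)
  qed (use 1(1) 2(1) in \<open>auto intro: combination.diff\<close>)
qed

lemma split_off_add:
  assumes "split_off p q m V z v" "split_off p q m V z' v'"
  shows "split_off p q m V (z + z') (v + v')"
  using split_off_diff[OF assms(1) split_off_diff[OF split_off_congruent assms(2)], of 0 0] by simp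

lemma split_off_single:
  assumes "finite V" "x \<in> V - {p, q}" "combination m (V - {p, q, x}) y u"
  shows "split_off p q m V (blk p x q y) (vol3 p x q u)" "split_off p q m V (blk q x p y) (vol3 q x p u)"
proof -
  let ?A = "\<lambda>t. if t = x then y else 0" and ?S = "\<lambda>t. if t = x then u else 0"
  have "(\<Sum>t\<in>V - {p, q}. blk p t q (?A t) + blk q t p 0) = (\<Sum>t\<in>V - {p, q}. if t = x then blk p x q y else 0)"
    "(\<Sum>t\<in>V - {p, q}. blk p t q 0 + blk q t p (?A t)) = (\<Sum>t\<in>V - {p, q}. if t = x then blk q x p y else 0)"
    "(\<Sum>t\<in>V - {p, q}. vol3 p t q (?S t) + vol3 q t p 0) = (\<Sum>t\<in>V - {p, q}. if t = x then vol3 p x q u else 0)"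
    "(\<Sum>t\<in>V - {p, q}. vol3 p t q 0 + vol3 q t p (?S t)) = (\<Sum>t\<in>V - {p, q}. if t = x then vol3 q x p u else 0)"
    by (intro sum.cong; simp)+
  note sums = this
  show "split_off p q m V (blk p x q y) (vol3 p x q u)"
    by (rule split_offI[where A = ?A and S = ?S and B = "\<lambda>_. 0" and T = "\<lambda>_. 0"])
      (use assms in \<open>simp_all only: sums\<close>, auto simp: combination.zero)
  show "split_off p q m V (blk q x p y) (vol3 q x p u)"
    by (rule split_offI[where B = ?A and T = ?S and A = "\<lambda>_. 0" and S = "\<lambda>_. 0"])
      (use assms in \<open>simp_all only: sums\<close>, auto simp: combination.zero)
qed

text \<open>The pair \<open>px qy\<close>, for \<open>x\<close> in \<open>{b, c}\<close> and \<open>y\<close> in \<open>{d, e}\<close>, is multiplied by the edge that joins the other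
  element of \<open>{b, c}\<close> to the other element of \<open>{d, e}\<close>; with this choice all coefficients are blocks.\<close>

lemma blk2_separate:
  assumes "z \<in> mcycles Z k" "distinct [p, b, c, q, d, e]" "{p, b, c, q, d, e} \<subseteq> V" "Z \<subseteq> V - {p, b, c, q, d, e}"
  shows "blk p b c (blk q d e z) - (blk p b q (blk c e d z) - blk p c q (blk b e d z)
    - blk q d p (blk e c b z) + blk q e p (blk d c b z)) \<in> mbounds V (Suc (Suc k))"
proof (rule mboundsI)
  let ?t = "\<lambda>x y s t. ed p x (ed q y (ed s t z))"
  show "?t b d c e - ?t b e c d - ?t c d b e + ?t c e b d \<in> mchains V (Suc (Suc (Suc k)))"
    using assms(2,3,4)
    by (intro mchains_add mchains_diff ed_in_mchains mchains_mono[OF mcycles_mchains[OF assms(1)]]) auto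
  show "bd (?t b d c e - ?t b e c d - ?t c d b e + ?t c e b d) =
    blk p b c (blk q d e z) - (blk p b q (blk c e d z) - blk p c q (blk b e d z)
    - blk q d p (blk e c b z) + blk q e p (blk d c b z))"
    using assms(1) by (simp add: bd_E blk_def algebra_simps insert_commute)
qed

text \<open>Make \<open>p\<close> a centre. If \<open>q\<close> is in the same block, nothing is left to do. If \<open>q\<close> is the spare
  vertex, the block is the difference of two blocks through \<open>pq\<close>, of volumes \<open>-v\<close> and \<open>v\<close>, and \<open>-2v\<close>
  agrees with \<open>v\<close> modulo 3. Otherwise make \<open>q\<close> a centre as well and use \<open>blk2_separate\<close>; all four
  products on the right have volume \<open>v\<close>, and \<open>4v\<close> agrees with \<open>v\<close> modulo 3.\<close>

lemma split_off_product:
  assumes "block_product (Suc m) V z v" "card V = Suc (3 * Suc m)" "p \<in> V" "q \<in> V" "p \<noteq> q"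
  shows "split_off p q m V z v"
proof -
  have fin: "finite V" using assms(1) by (rule block_product_finite)
  obtain b c W z' v' where W: "block_product m W z' v'" "distinct [p, b, c]" "{p, b, c} \<inter> W = {}"
    "V = {p, b, c} \<union> W" "z - blk p b c z' \<in> mbounds V (Suc m)" "v = vol3 p b c v'"
    using block_product_centred[OF assms(1,2,3)] unfolding centred_def by blast
  have cW: "card W = Suc (3 * m)"
    using card_triple_union[of p b c W] W block_product_finite[OF W(1)] assms(2) by simp
  have "split_off p q m V (blk p b c z') v"
  proof (cases "q \<in> {b, c}")
    case True
    then consider "q = b" | "q = c" by auto
    then show ?thesis
    proof cases
      case 1
      have "V - {p, q, c} = W" using 1 W by auto
      then have "split_off p q m V (blk p c q z') (vol3 p c q v')"
        using W 1 by (intro split_off_single[OF fin]) (auto intro: combination.product)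
      from split_off_diff[OF split_off_congruent this, of 0 0] show ?thesis
        using 1 by (simp add: W(6) blk_commute[of p b c] vol.E_anticommute[of b c])
    next
      case 2
      have "V - {p, q, b} = W" using 2 W by auto
      then have "split_off p q m V (blk p b q z') (vol3 p b q v')"
        using W 2 by (intro split_off_single[OF fin]) (auto intro: combination.product)
      then show ?thesis using 2 W(6) by simp
    qed
  next
    case False
    then have q: "q \<in> W" using W(4) assms(4,5) by auto
    show ?thesis
    proof (cases m)
      case 0
      then have Wq: "W = {q}" using cW q by (metis One_nat_def card_1_singletonE mult_0_right singletonD)
      obtain w where w: "w \<in> W" "\<And>s. s \<notin> W - {w} \<Longrightarrow>
        \<exists>v''. block_product m (insert s (W - {w})) z' v'' \<and> vol.E s v' = - vol.E w v''"
        using block_product_spare[OF W(1) cW] by metis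
      then have "w = q" using Wq by simp
      with w(2)[of c] w(2)[of b] Wq obtain v1 v2 where v12:
        "block_product m {c} z' v1" "vol.E c v' = - vol.E q v1"
        "block_product m {b} z' v2" "vol.E b v' = - vol.E q v2" by auto
      have set: "V - {p, q, b} = {c}" "V - {p, q, c} = {b}" using W(2,3,4) Wq by auto
      have bc: "b \<in> V - {p, q}" "c \<in> V - {p, q}" using W(2,3,4) Wq by auto
      have "combination m (V - {p, q, b}) z' v1" "combination m (V - {p, q, c}) z' v2"
        unfolding set by (intro combination.product v12)+
      from split_off_diff[OF split_off_single(1)[OF fin bc(1) this(1)] split_off_single(1)[OF fin bc(2) this(2)]]
      have "split_off p q m V (blk p b q z' - blk p c q z') (vol3 p b q v1 - vol3 p c q v2)" .
      moreover have "vol3 p b q v1 = - v"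
        by (simp add: W(6) v12(2))
      moreover have "vol3 p c q v2 = v"
        using v12(4) by (simp add: W(6) vol.E_anticommute[of b c])
      moreover have "blk p b q z' - blk p c q z' = blk p b c z'"
        by (simp add: blk_def)
      ultimately have "split_off p q m V (blk p b c z') (- v - v)" by simp
      from split_off_add[OF this split_off_congruent[OF mbounds_closed(1) threefold_closed(5)[of v]]]
      show ?thesis by (simp add: algebra_simps)
    next
      case (Suc i)
      obtain d e X y u where X: "block_product i X y u" "distinct [q, d, e]"
        "{q, d, e} \<inter> X = {}" "W = {q, d, e} \<union> X" "z' - blk q d e y \<in> mbounds W (Suc i)" "v' = vol3 q d e u"
        using block_product_centred[of i W z' v' q] W(1) cW q Suc unfolding centred_def by blast
      have dist: "distinct [p, b, c, q, d, e]" and sub: "{p, b, c, q, d, e} \<subseteq> V" "X \<subseteq> V - {p, b, c, q, d, e}"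
        using W(2,3,4) X(2,3,4) by auto
      have parts: "V - {p, q, b} = {c, e, d} \<union> X" "V - {p, q, c} = {b, e, d} \<union> X"
        "V - {p, q, d} = {e, c, b} \<union> X" "V - {p, q, e} = {d, c, b} \<union> X"
        using W(2,3,4) X(2,3,4) by auto
      have in_V: "b \<in> V - {p, q}" "c \<in> V - {p, q}" "d \<in> V - {p, q}" "e \<in> V - {p, q}"
        using dist sub by auto
      have comb: "combination m ({x, s, t} \<union> X) (blk x s t y) (vol3 x s t u)"
        if "distinct [x, s, t]" "{x, s, t} \<inter> X = {}" for x s t
        unfolding Suc using that by (intro combination.product block_product.blk[OF X(1)])
      have "combination m (V - {p, q, b}) (blk c e d y) (vol3 c e d u)"
        "combination m (V - {p, q, c}) (blk b e d y) (vol3 b e d u)"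
        "combination m (V - {p, q, d}) (blk e c b y) (vol3 e c b u)"
        "combination m (V - {p, q, e}) (blk d c b y) (vol3 d c b u)"
        unfolding parts using dist sub(2) by (intro comb; auto)+
      note pieces = split_off_single(1)[OF fin in_V(1) this(1)] split_off_single(1)[OF fin in_V(2) this(2)]
        split_off_single(2)[OF fin in_V(3) this(3)] split_off_single(2)[OF fin in_V(4) this(4)]
      from split_off_add[OF split_off_diff[OF split_off_diff[OF pieces(1,2)] pieces(3)] pieces(4)]
      have four: "split_off p q m V (blk p b q (blk c e d y) - blk p c q (blk b e d y)
          - blk q d p (blk e c b y) + blk q e p (blk d c b y))
        (vol3 p b q (vol3 c e d u) - vol3 p c q (vol3 b e d u)
          - vol3 q d p (vol3 e c b u) + vol3 q e p (vol3 d c b u))" .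
      have sorted: "vol3 p b q (vol3 c e d u) = v" "vol3 p c q (vol3 b e d u) = - v"
        "vol3 q d p (vol3 e c b u) = - v" "vol3 q e p (vol3 d c b u) = v"
        by (simp_all add: W(6) X(6) vol.E_anticommute[of q p] vol.E_anticommute[of q b] vol.E_anticommute[of q c]
           vol.E_anticommute[of c b] vol.E_anticommute[of d p] vol.E_anticommute[of d b] vol.E_anticommute[of d c]
           vol.E_anticommute[of e p] vol.E_anticommute[of e b] vol.E_anticommute[of e c] vol.E_anticommute[of e d])
      have "blk p b c (blk q d e y) - (blk p b q (blk c e d y) - blk p c q (blk b e d y)
          - blk q d p (blk e c b y) + blk q e p (blk d c b y)) \<in> mbounds V (Suc m)"
        unfolding Suc by (rule blk2_separate[OF block_product_cycle[OF X(1)] dist sub])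
      moreover have "V - {p, b, c} = W" using W(2,3,4) by auto
      then have "blk p b c (z' - blk q d e y) \<in> mbounds V (Suc m)"
        using X(5) W(2,4) Suc by (intro blk_in_mbounds) auto
      ultimately have "blk p b c (z' - blk q d e y) + (blk p b c (blk q d e y) - (blk p b q (blk c e d y)
          - blk p c q (blk b e d y) - blk q d p (blk e c b y) + blk q e p (blk d c b y))) \<in> mbounds V (Suc m)"
        by (intro mbounds_closed(3))
      then have "blk p b c z' - (blk p b q (blk c e d y)
          - blk p c q (blk b e d y) - blk q d p (blk e c b y) + blk q e p (blk d c b y)) \<in> mbounds V (Suc m)"
        by (simp add: algebra_simps)
      from split_off_add[OF split_off_congruent[OF this threefold_closed(4)[OF threefold_closed(5)[of v]]] four]
      show ?thesis by (simp add: sorted algebra_simps)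
    qed
  qed
  from split_off_add[OF split_off_congruent[OF W(5) threefold_closed(1)] this] show ?thesis by simp
qed

lemma split_off_combination:
  assumes "combination (Suc m) V z v" "card V = Suc (3 * Suc m)" "p \<in> V" "q \<in> V" "p \<noteq> q"
  shows "split_off p q m V z v"
  using assms(1)
proof induction
  case zero
  show ?case by (intro split_off_congruent) auto
next
  case (product z v)
  then show ?case using assms(2-) by (rule split_off_product)
next
  case (diff y u z v)
  then show ?case by (intro split_off_diff)
qed

text \<open>The sign comes from moving \<open>y\<close> past the \<open>3m\<close> factors of the volume form.\<close>

lemma block_product_add_spare:
  assumes "block_product m W z v" "card W = 3 * m" "y \<notin> W"
  shows "block_product m (insert y W) z (frag_cmul ((-1) ^ m) (vol.E y v))"
  using assms
proof (induction rule: block_product.induct)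
  case (empty S)
  then have "S = {}" by simp
  moreover have "vol.E y (frag_of {}) = frag_of {y}"
    by (simp add: vol.E_basis vol.pos_def)
  ultimately show ?case using block_product.empty[of "{y}"] by simp
next
  case (blk m W z v a b c)
  have "card W = 3 * m"
    using blk card_triple_union[of a b c W] block_product_finite[of m W z v] by auto
  then have "block_product m (insert y W) z (frag_cmul ((-1) ^ m) (vol.E y v))"
    using blk by simp
  from block_product.blk[OF this blk.hyps(2)]
  have "block_product (Suc m) ({a, b, c} \<union> insert y W) (blk a b c z) (vol3 a b c (frag_cmul ((-1) ^ m) (vol.E y v)))"
    using blk by auto
  moreover have "vol3 a b c (frag_cmul ((-1) ^ m) (vol.E y v)) = frag_cmul ((-1) ^ Suc m) (vol.E y (vol3 a b c v))"
    by (intro poly_mapping_eqI) (simp add: vol.E_cmul vol3_commute[of y])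
  moreover have "{a, b, c} \<union> insert y W = insert y ({a, b, c} \<union> W)" by auto
  ultimately show ?case by simp
qed

lemma combination_add_spare:
  assumes "combination m W z v" "card W = 3 * m" "y \<notin> W"
  shows "combination m (insert y W) z (frag_cmul ((-1) ^ m) (vol.E y v))"
  using assms(1)
proof induction
  case (diff z v z' v')
  have "frag_cmul ((-1) ^ m) (vol.E y (v - v')) =
      frag_cmul ((-1) ^ m) (vol.E y v) - frag_cmul ((-1) ^ m) (vol.E y v')"
    by (intro poly_mapping_eqI) (simp add: lookup_minus algebra_simps)
  then show ?case using combination.diff[OF diff.IH] by simp
qed (use assms(2,3) in \<open>auto intro: combination.zero combination.product block_product_add_spare\<close>)

text \<open>Induction on the number of blocks. Move \<open>p\<close> and \<open>q\<close> into the first block, so that the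
combination becomes \<open>\<Sum> B p x q (A x) + B q x p (B x)\<close>, and write it as \<open>bd u\<close>. Comparing the
coefficients of \<open>px\<close> shows that \<open>A x\<close> bounds once the coefficients \<open>g x y\<close> of \<open>px qy\<close> in \<open>u\<close>,
for all \<open>y\<close>, are added to it; comparing those of \<open>qy\<close>, the same \<open>g x y\<close> must be subtracted from
\<open>B y\<close>. Each \<open>g x y\<close> is a cycle and hence homologous to a combination of products of blocks, in
which \<open>y\<close>, respectively \<open>x\<close>, is the spare vertex. The induction hypothesis computes the volumes of
all \<open>A x\<close> and \<open>B y\<close> modulo 3 in terms of those of the \<open>g x y\<close>, and in the total volume every
\<open>g x y\<close> occurs twice with opposite signs.\<close>

theorem bounding_combination_threefold:
  assumes "finite V" "card V = Suc (3 * m)" "combination m V z v" "z \<in> mbounds V m"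
  shows "threefold v"
  using assms
proof (induction m arbitrary: V z v)
  case 0
  have "\<exists>n. z = frag_cmul n (frag_of {}) \<and> v = frag_cmul n (frag_of V)"
    using 0(3)
  proof induction
    case zero
    show ?case by (rule exI[of _ 0]) simp
  next
    case (product z v)
    then have "z = frag_of {} \<and> v = frag_of V" by cases auto
    then show ?case by (intro exI[of _ 1]) simp
  next
    case (diff y u z v)
    then show ?case by (metis frag_cmul_diff_distrib)
  qed
  then obtain n where n: "z = frag_cmul n (frag_of {})" "v = frag_cmul n (frag_of V)" by blast
  obtain u where u: "u \<in> mchains V (Suc 0)" "z = bd u"
    using 0(4) by (auto simp: mbounds_def)
  have "M \<notin> Poly_Mapping.keys u" for M
  proof
    assume "M \<in> Poly_Mapping.keys u"
    then have "M \<in> matchings V" "card M = 1" using u(1) by (auto simp: mchains_def)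
    then obtain e where "e \<subseteq> V" "card e = 2"
      by (auto simp: matchings_def card_1_singleton_iff)
    then show False using card_mono[OF 0(1), of e] 0(2) by simp
  qed
  then have "u = 0" by (metis all_not_in_conv keys_eq_empty)
  then have "n = 0" using n u by simp
  then show ?case using n by simp
next
  case (Suc m)
  have fin: "finite V" by fact
  have "1 < card V" using Suc.prems(2) by simp
  then obtain p q where pq: "p \<in> V" "q \<in> V" "p \<noteq> q"
    by (metis card_le_Suc0_iff_eq Suc.prems(1) not_less One_nat_def)
  have card: "card (V - X) = card V - card X" if "X \<subseteq> V" for X
    using that fin by (simp add: card_Diff_subset finite_subset)
  let ?V = "V - {p, q}"
  obtain A S B T where
    A: "\<And>x. x \<in> ?V \<Longrightarrow> combination m (V - {p, q, x}) (A x) (S x)" and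
    B: "\<And>x. x \<in> ?V \<Longrightarrow> combination m (V - {p, q, x}) (B x) (T x)" and
    z: "z - (\<Sum>x\<in>?V. blk p x q (A x) + blk q x p (B x)) \<in> mbounds V (Suc m)" and
    v: "threefold (v - (\<Sum>x\<in>?V. vol3 p x q (S x) + vol3 q x p (T x)))"
    using split_off_combination[OF Suc.prems(3,2) pq] unfolding split_off_def by blast
  define s where "s = (\<Sum>x\<in>?V. blk p x q (A x) + blk q x p (B x))"
  have "s \<in> mbounds V (Suc m)"
    using mbounds_closed(4)[OF Suc.prems(4) z] by (simp add: s_def)
  then obtain u where u: "u \<in> mchains V (Suc (Suc m))" "bd u = s" by (auto simp: mbounds_def)
  have fin_u: "finitary u" using u(1) by simp
  have chA: "A x \<in> mchains (V - {p, q, x}) m" and chB: "B x \<in> mchains (V - {p, q, x}) m" if "x \<in> ?V" for x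
    using combination_cycle[OF A[OF that]] combination_cycle[OF B[OF that]] by auto
  have lk_s: "lk p x s = A x" "lk q x s = B x" if x: "x \<in> ?V" for x
    unfolding s_def using fin pq chA chB x by (intro lk_blk_sum[where k = m]; simp)+
  define g where "g x y = lk q y (lk p x u)" for x y
  have g: "g x y \<in> mcycles (V - {p, q, x, y}) m" if x: "x \<in> ?V" and y: "y \<in> ?V - {x}" for x y
  proof (rule mcyclesI)
    have "V - {p, x} - {q, y} = V - {p, q, x, y}" by auto
    then show "g x y \<in> mchains (V - {p, q, x, y}) m"
      unfolding g_def using u(1) lk_in_mchains[of "lk p x u" "V - {p, x}" m q y] lk_in_mchains[of u V "Suc m" p x]
      by simp
    have "bd (g x y) = lk q y (lk p x s)"
      using fin_u by (simp add: g_def D_bd flip: u(2))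
    also have "\<dots> = 0"
      using lk_eq_0[OF chA[OF x], of q y] by (simp add: lk_s(1)[OF x])
    finally show "bd (g x y) = 0" .
  qed
  have card4: "card (V - {p, q, x, y}) = 3 * m" if "x \<in> ?V" "y \<in> ?V - {x}" for x y
  proof -
    have "card {p, q, x, y} = 4" using that pq by auto
    then show ?thesis using that pq card Suc.prems(2) by auto
  qed
  have "\<forall>x y. \<exists>h w. x \<in> ?V \<longrightarrow> y \<in> ?V - {x} \<longrightarrow>
      combination m (V - {p, q, x, y}) h w \<and> g x y - h \<in> mbounds (V - {p, q, x, y}) m"
    using cycles_generated[OF _ _ g] card4 fin unfolding generated_def by blast
  then obtain h w where h: "\<And>x y. x \<in> ?V \<Longrightarrow> y \<in> ?V - {x} \<Longrightarrow> combination m (V - {p, q, x, y}) (h x y) (w x y)"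
    and gh: "\<And>x y. x \<in> ?V \<Longrightarrow> y \<in> ?V - {x} \<Longrightarrow> g x y - h x y \<in> mbounds (V - {p, q, x, y}) m"
    by metis
  let ?e = "\<lambda>v. frag_cmul ((-1) ^ m) v"
  have spare: "combination m (V - {p, q, x}) (h x y) (?e (vol.E y (w x y)))"
    "combination m (V - {p, q, y}) (h x y) (?e (vol.E x (w x y)))"
    "g x y - h x y \<in> mbounds (V - {p, q, x}) m" "g x y - h x y \<in> mbounds (V - {p, q, y}) m"
    if x: "x \<in> ?V" and y: "y \<in> ?V - {x}" for x y
  proof -
    have set: "insert y (V - {p, q, x, y}) = V - {p, q, x}" "insert x (V - {p, q, x, y}) = V - {p, q, y}"
      using x y by auto
    show "combination m (V - {p, q, x}) (h x y) (?e (vol.E y (w x y)))"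
      "combination m (V - {p, q, y}) (h x y) (?e (vol.E x (w x y)))"
      using combination_add_spare[OF h[OF x y] card4[OF x y], of y]
        combination_add_spare[OF h[OF x y] card4[OF x y], of x] by (simp_all add: set)
    show "g x y - h x y \<in> mbounds (V - {p, q, x}) m" "g x y - h x y \<in> mbounds (V - {p, q, y}) m"
      by (rule mbounds_mono[OF gh[OF x y]]; auto)+
  qed
  have card3: "card (V - {p, q, x}) = Suc (3 * m)" if "x \<in> ?V" for x
  proof -
    have "card {p, q, x} = 3" using that pq by auto
    then show ?thesis using that pq card Suc.prems(2) by auto
  qed
  have S: "threefold (S x + (\<Sum>y\<in>?V - {x}. ?e (vol.E y (w x y))))" if x: "x \<in> ?V" for x
  proof (rule Suc.IH)
    show "finite (V - {p, q, x})" using fin by simp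
    show "card (V - {p, q, x}) = Suc (3 * m)" by (rule card3[OF x])
    show "combination m (V - {p, q, x}) (A x + (\<Sum>y\<in>?V - {x}. h x y)) (S x + (\<Sum>y\<in>?V - {x}. ?e (vol.E y (w x y))))"
      using spare(1)[OF x] by (intro combination_add combination_sum A[OF x])
    have px: "lk p x u \<in> mchains (V - {p, x}) (Suc m)" using u(1) by (rule lk_in_mchains)
    define a' where "a' = lk p x u - (\<Sum>y\<in>V - {p, x} - {q}. ed q y (g x y))"
    have set: "V - {p, x} - {q} = V - {p, q, x}" "?V - {x} = V - {p, q, x}" by auto
    have a': "a' \<in> mchains (V - {p, q, x}) (Suc m)"
      using ed_mchains_decomposition[OF _ _ px, of q] fin pq x unfolding a'_def g_def set by auto
    have "bd (ed q y (g x y)) = g x y" if "y \<in> V - {p, q, x}" for y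
      using g[OF x, of y] that by (simp add: set bd_E)
    then have "bd a' = - A x - (\<Sum>y\<in>V - {p, q, x}. g x y)"
      using fin_u lk_s(1)[OF x] D_bd[OF fin_u, of "{p, x}"] by (simp add: a'_def set bd_sum u(2))
    then have "- A x - (\<Sum>y\<in>V - {p, q, x}. g x y) \<in> mbounds (V - {p, q, x}) m"
      using a' by (auto intro: mboundsI)
    moreover have "(\<Sum>y\<in>V - {p, q, x}. g x y - h x y) \<in> mbounds (V - {p, q, x}) m"
      using spare(3)[OF x] by (intro mbounds_sum) (auto simp: set)
    ultimately have "- (- A x - (\<Sum>y\<in>V - {p, q, x}. g x y) + (\<Sum>y\<in>V - {p, q, x}. g x y - h x y)) \<in> mbounds (V - {p, q, x}) m"
      by (intro mbounds_closed(2,3))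
    then show "A x + (\<Sum>y\<in>?V - {x}. h x y) \<in> mbounds (V - {p, q, x}) m"
      by (simp add: set sum_subtractf algebra_simps)
  qed
  have T: "threefold (T y - (\<Sum>x\<in>?V - {y}. ?e (vol.E x (w x y))))" if y: "y \<in> ?V" for y
  proof (rule Suc.IH)
    have xy: "x \<in> ?V \<and> y \<in> ?V - {x}" if "x \<in> ?V - {y}" for x using that y by auto
    show "finite (V - {p, q, y})" using fin by simp
    show "card (V - {p, q, y}) = Suc (3 * m)" by (rule card3[OF y])
    have "combination m (V - {p, q, y}) (\<Sum>x\<in>?V - {y}. h x y) (\<Sum>x\<in>?V - {y}. ?e (vol.E x (w x y)))"
      using spare(2) xy by (intro combination_sum) blast
    then show "combination m (V - {p, q, y}) (B y - (\<Sum>x\<in>?V - {y}. h x y)) (T y - (\<Sum>x\<in>?V - {y}. ?e (vol.E x (w x y))))"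
      by (intro combination.diff B[OF y])
    have qy: "lk q y u \<in> mchains (V - {q, y}) (Suc m)" using u(1) by (rule lk_in_mchains)
    have anti: "lk p x (lk q y u) = - g x y" for x
      unfolding g_def by (rule D_D_anticommute[OF fin_u])
    define b' where "b' = lk q y u + (\<Sum>x\<in>V - {q, y} - {p}. ed p x (g x y))"
    have set: "V - {q, y} - {p} = V - {p, q, y}" "?V - {y} = V - {p, q, y}" by auto
    have b': "b' \<in> mchains (V - {p, q, y}) (Suc m)"
      using ed_mchains_decomposition[OF _ _ qy, of p] fin pq y unfolding b'_def anti set by (auto simp: sum_negf)
    have "bd (ed p x (g x y)) = g x y" if "x \<in> V - {p, q, y}" for x
      using g[of x y] xy[of x] that by (simp add: set bd_E)
    then have "bd b' = - B y + (\<Sum>x\<in>V - {p, q, y}. g x y)"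
      using fin_u lk_s(2)[OF y] D_bd[OF fin_u, of "{q, y}"] by (simp add: b'_def set bd_sum u(2))
    then have "- B y + (\<Sum>x\<in>V - {p, q, y}. g x y) \<in> mbounds (V - {p, q, y}) m"
      using b' by (auto intro: mboundsI)
    moreover have "(\<Sum>x\<in>V - {p, q, y}. g x y - h x y) \<in> mbounds (V - {p, q, y}) m"
      using spare(4) xy by (intro mbounds_sum) (auto simp: set)
    ultimately have "- (- B y + (\<Sum>x\<in>V - {p, q, y}. g x y) - (\<Sum>x\<in>V - {p, q, y}. g x y - h x y)) \<in> mbounds (V - {p, q, y}) m"
      by (intro mbounds_closed(2,4))
    then show "B y - (\<Sum>x\<in>?V - {y}. h x y) \<in> mbounds (V - {p, q, y}) m"
      by (simp add: set sum_subtractf algebra_simps)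
  qed
  have swap: "vol3 q y p (vol.E x c) = vol3 p x q (vol.E y c)" for x y c
    by (simp add: vol.E_anticommute[of q p] vol.E_anticommute[of q x] vol.E_anticommute[of y p] vol.E_anticommute[of y x]
      vol.E_anticommute[of y q])
  have "(\<Sum>x\<in>?V. \<Sum>y\<in>?V - {x}. vol3 p x q (?e (vol.E y (w x y)))) =
      (\<Sum>y\<in>?V. \<Sum>x\<in>?V - {y}. vol3 p x q (?e (vol.E y (w x y))))"
    using fin by (intro sum_off_diagonal_swap) simp
  also have "\<dots> = (\<Sum>y\<in>?V. \<Sum>x\<in>?V - {y}. vol3 q y p (?e (vol.E x (w x y))))"
    by (simp add: vol.E_cmul swap)
  finally have cancel: "(\<Sum>x\<in>?V. \<Sum>y\<in>?V - {x}. vol3 p x q (?e (vol.E y (w x y)))) =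
      (\<Sum>y\<in>?V. \<Sum>x\<in>?V - {y}. vol3 q y p (?e (vol.E x (w x y))))" .
  have "threefold (\<Sum>x\<in>?V. vol3 p x q (S x + (\<Sum>y\<in>?V - {x}. ?e (vol.E y (w x y)))))"
    by (intro threefold_sum threefold_E S)
  moreover have "threefold (\<Sum>y\<in>?V. vol3 q y p (T y - (\<Sum>x\<in>?V - {y}. ?e (vol.E x (w x y)))))"
    by (intro threefold_sum threefold_E T)
  ultimately have "threefold ((\<Sum>x\<in>?V. vol3 p x q (S x + (\<Sum>y\<in>?V - {x}. ?e (vol.E y (w x y)))))
      + (\<Sum>y\<in>?V. vol3 q y p (T y - (\<Sum>x\<in>?V - {y}. ?e (vol.E x (w x y))))))"
    by (rule threefold_closed(2))
  also have "(\<Sum>x\<in>?V. vol3 p x q (S x + (\<Sum>y\<in>?V - {x}. ?e (vol.E y (w x y)))))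
      + (\<Sum>y\<in>?V. vol3 q y p (T y - (\<Sum>x\<in>?V - {y}. ?e (vol.E x (w x y)))))
    = (\<Sum>x\<in>?V. vol3 p x q (S x) + vol3 q x p (T x))"
    using cancel by (simp add: vol.E_sum sum.distrib sum_subtractf)
  finally have "threefold (\<Sum>x\<in>?V. vol3 p x q (S x) + vol3 q x p (T x))" .
  from threefold_closed(2)[OF v this] show ?case by simp
qed

text \<open>The volume of a single product of blocks is a unit, and so not a multiple of 3.\<close>

lemma vol_E_basis_unit:
  assumes "v = frag_of W \<or> v = - frag_of W" "finite W" "a \<notin> W"
  shows "vol.E a v = frag_of (insert a W) \<or> vol.E a v = - frag_of (insert a W)"
proof -
  have "vol.E a (frag_of W) = frag_of (insert a W) \<or> vol.E a (frag_of W) = - frag_of (insert a W)"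
    using assms(2,3) by (cases "even (vol.pos a W)") (auto simp: vol.E_basis)
  then show ?thesis using assms(1) by auto
qed

lemma block_product_volume:
  "block_product m W z v \<Longrightarrow> v = frag_of W \<or> v = - frag_of W"
proof (induction rule: block_product.induct)
  case (blk m W z v a b c)
  have fin: "finite W" using blk(1) by (rule block_product_finite)
  have "vol.E c v = frag_of (insert c W) \<or> vol.E c v = - frag_of (insert c W)"
    using blk fin by (intro vol_E_basis_unit) auto
  then have "vol.E b (vol.E c v) = frag_of (insert b (insert c W)) \<or> vol.E b (vol.E c v) = - frag_of (insert b (insert c W))"
    using blk fin by (intro vol_E_basis_unit) auto
  then have "vol3 a b c v = frag_of (insert a (insert b (insert c W))) \<or> vol3 a b c v = - frag_of (insert a (insert b (insert c W)))"
    using blk fin by (intro vol_E_basis_unit) auto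
  then show ?case by simp
qed simp

theorem block_product_not_bounding:
  assumes "block_product m V z v" "card V = Suc (3 * m)"
  shows "z \<notin> mbounds V m"
proof
  assume "z \<in> mbounds V m"
  then have "threefold v"
    using assms block_product_finite[OF assms(1)]
    by (intro bounding_combination_threefold[of V m z v]) (auto intro: combination.product)
  then obtain u where "v = frag_cmul 3 u" by (auto simp: threefold_def)
  then have "Poly_Mapping.lookup v V = 3 * Poly_Mapping.lookup u V" by simp
  moreover have "Poly_Mapping.lookup v V = 1 \<or> Poly_Mapping.lookup v V = - 1"
    using block_product_volume[OF assms(1)] by auto
  ultimately show False by presburger
qed

lemma block_product_not_bounding':
  assumes "block_product m W z v" "card W = 3 * m" "s \<notin> W"
  shows "z \<notin> mbounds (insert s W) m"
  using block_product_not_bounding[OF block_product_add_spare[OF assms]] assms(2,3)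
    block_product_finite[OF assms(1)] by simp

lemma block_product_exists:
  assumes "finite V" "card V = 3 * m \<or> card V = Suc (3 * m)"
  shows "\<exists>z v. block_product m V z v"
  using assms
proof (induction m arbitrary: V)
  case 0
  then have "block_product 0 V (frag_of {}) (frag_of V)"
    by (intro block_product.empty) auto
  then show ?case by blast
next
  case (Suc m)
  have "3 \<le> card V" using Suc.prems(2) by auto
  then obtain T where "T \<subseteq> V" "card T = 3" by (meson obtain_subset_with_card_n)
  then obtain a b c where abc: "T = {a, b, c}" "distinct [a, b, c]"
    by (auto simp: card_3_iff)
  have "card (V - T) = card V - 3"
    using \<open>T \<subseteq> V\<close> \<open>card T = 3\<close> Suc.prems(1) by (simp add: card_Diff_subset finite_subset)
  then obtain z v where "block_product m (V - T) z v"
    using Suc.IH[of "V - T"] Suc.prems by auto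
  from block_product.blk[OF this abc(2)] have "block_product (Suc m) ({a, b, c} \<union> (V - T)) (blk a b c z) (vol3 a b c v)"
    using abc(1) by auto
  moreover have "{a, b, c} \<union> (V - T) = V" using abc(1) \<open>T \<subseteq> V\<close> by auto
  ultimately show ?case by auto
qed

theorem nonbounding_cycle:
  assumes "finite V" "card V = 3 * m \<or> card V = Suc (3 * m)" "s \<notin> V"
  obtains c where "c \<in> mcycles V m" "c \<notin> mbounds V m"
proof -
  obtain z v where z: "block_product m V z v"
    using block_product_exists[OF assms(1,2)] by blast
  have "z \<notin> mbounds V m"
    using assms(2)
  proof
    assume "card V = 3 * m"
    from block_product_not_bounding'[OF z this assms(3)] show ?thesis
      using mbounds_mono[of z V m "insert s V"] by blast
  next
    assume "card V = Suc (3 * m)"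
    with z show ?thesis by (rule block_product_not_bounding)
  qed
  then show ?thesis using that[OF block_product_cycle[OF z]] by blast
qed

text \<open>If a pentagon \<open>pxqyw\<close> times a product of blocks were the boundary of \<open>u\<close>, then the product of
  blocks would be the boundary of the coefficient of \<open>px qy\<close> in \<open>u\<close>, a chain that may use \<open>w\<close>
  in addition to the vertices of the blocks.\<close>

theorem nonbounding_pent_cycle:
  assumes "finite V" "card V = 3 * m + 5"
  obtains c where "c \<in> mcycles V (Suc (Suc m))" "c \<notin> mbounds V (Suc (Suc m))"
proof -
  obtain X where X: "X \<subseteq> V" "card X = 5"
    using obtain_subset_with_card_n[of 5 V] assms(2) by auto
  have "finite X" using X(2) card.infinite by fastforce
  then obtain xs where "set xs = X" "distinct xs" by (metis finite_distinct_list)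
  then have "length xs = 5" using X(2) distinct_card by fastforce
  then obtain p x q y w where xs: "xs = [p, x, q, y, w]"
    by (auto simp: length_Suc_conv eval_nat_numeral)
  then have dist: "distinct [p, x, q, y, w]" and set: "{p, x, q, y, w} = X"
    using \<open>set xs = X\<close> \<open>distinct xs\<close> by auto
  have card: "card (V - X) = 3 * m"
    using X assms \<open>finite X\<close> by (simp add: card_Diff_subset)
  then obtain z v where z: "block_product m (V - X) z v"
    using block_product_exists[of "V - X" m] assms(1) by auto
  define L where "L = pent p x q y w z"
  have "pent_combination (Suc (Suc m)) V L"
    unfolding L_def using X(1) set dist by (intro pent_combination.pent[OF z]) auto
  then have "L \<in> mcycles V (Suc (Suc m))" by (rule pent_combination_cycle)
  moreover have "L \<notin> mbounds V (Suc (Suc m))"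
  proof
    assume "L \<in> mbounds V (Suc (Suc m))"
    then obtain u where u: "u \<in> mchains V (Suc (Suc (Suc m)))" "L = bd u"
      by (auto simp: mbounds_def)
    have "lk q y (lk p x L) = z"
      unfolding L_def using lk_lk_pent[OF mcycles_mchains[OF block_product_cycle[OF z]] _ dist, of x y] set dist
      by auto
    moreover have "lk q y (lk p x L) = bd (lk q y (lk p x u))"
      using mchains_finitary[OF u(1)] by (simp add: u(2) D_bd)
    moreover have "lk q y (lk p x u) \<in> mchains (V - {p, x} - {q, y}) (Suc m)"
      using u(1) by (intro lk_in_mchains)
    ultimately have "z \<in> mbounds (V - {p, x} - {q, y}) m" by (auto intro: mboundsI)
    moreover have "V - {p, x} - {q, y} = insert w (V - X)"
      using X(1) set dist by auto
    ultimately show False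
      using block_product_not_bounding'[OF z card, of w] set by auto
  qed
  ultimately show ?thesis by (rule that)
qed

end

section \<open>The homology groups\<close>

text \<open>The elements outside of \<open>A\<close> are well-ordered and put on top.\<close>

lemma linear_order_on_extends:
  assumes "linear_order_on A r"
  obtains r' where "linear_order_on UNIV r'" "\<And>x y. x \<in> A \<Longrightarrow> y \<in> A \<Longrightarrow> (x, y) \<in> r' \<longleftrightarrow> (x, y) \<in> r"
proof -
  obtain s where s: "well_order_on (- A) s"
    using well_order_on by blast
  then have s: "linear_order_on (- A) s"
    by (simp add: well_order_on_def)
  let ?r = "r \<union> A \<times> (- A) \<union> s"
  have field: "r \<subseteq> A \<times> A" "s \<subseteq> (- A) \<times> (- A)"
    using assms s by (auto simp: order_on_defs refl_on_def)
  have "linear_order_on UNIV ?r"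
    unfolding order_on_defs
  proof (intro conjI)
    show "refl ?r"
      using assms s by (auto simp: order_on_defs refl_on_def)
    have r: "trans r" "antisym r" "total_on A r" and s': "trans s" "antisym s" "total_on (- A) s"
      using assms s by (auto simp: order_on_defs)
    show "trans ?r"
    proof (rule transI)
      fix x y z assume "(x, y) \<in> ?r" "(y, z) \<in> ?r"
      then show "(x, z) \<in> ?r"
        using field transD[OF r(1), of x y z] transD[OF s'(1), of x y z] by blast
    qed
    show "antisym ?r"
    proof (rule antisymI)
      fix x y assume "(x, y) \<in> ?r" "(y, x) \<in> ?r"
      then show "x = y"
        using field antisymD[OF r(2), of x y] antisymD[OF s'(2), of x y] by blast
    qed
    show "total_on UNIV ?r"
      using r(3) s'(3) unfolding total_on_def by blast
  qed auto
  then show ?thesis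
    by (rule that) (use field in auto)
qed

lemma matching_complex_eq: "matching_complex n = matchings {1..n}"
proof -
  have "finite M" if "M \<subseteq> complete_graph_edges n" for M
  proof (rule finite_subset[OF that])
    have "complete_graph_edges n \<subseteq> Pow {1..n}" by (auto simp: complete_graph_edges_def)
    then show "finite (complete_graph_edges n)" by (rule finite_subset) simp
  qed
  then show ?thesis
    unfolding matching_complex_def matchings_def complete_graph_edges_def by blast
qed

lemma simplicial_boundary_cong:
  assumes "\<And>x y. x \<in> \<Union>K \<Longrightarrow> y \<in> \<Union>K \<Longrightarrow> (x, y) \<in> r \<longleftrightarrow> (x, y) \<in> r'" "Poly_Mapping.keys c \<subseteq> K"
  shows "simplicial_boundary r c = simplicial_boundary r' c"
  unfolding simplicial_boundary_def
proof (rule frag_extend_eq)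
  fix \<sigma> assume "\<sigma> \<in> Poly_Mapping.keys c"
  then have "\<sigma> \<subseteq> \<Union>K" using assms(2) by auto
  then have "{w \<in> \<sigma>. (w, v) \<in> r \<and> w \<noteq> v} = {w \<in> \<sigma>. (w, v) \<in> r' \<and> w \<noteq> v}" if "v \<in> \<sigma>" for v
    using assms(1) that by blast
  then show "(\<Sum>v\<in>\<sigma>. frag_cmul ((- 1) ^ card {w \<in> \<sigma>. (w, v) \<in> r \<and> w \<noteq> v}) (frag_of (\<sigma> - {v}))) =
     (\<Sum>v\<in>\<sigma>. frag_cmul ((- 1) ^ card {w \<in> \<sigma>. (w, v) \<in> r' \<and> w \<noteq> v}) (frag_of (\<sigma> - {v})))"
    by (intro sum.cong) auto
qed

lemma homology_group_conditions:
  assumes K: "abstract_simplicial_complex K" and r: "linear_order_on (\<Union>K) r"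
  shows elementary_3_group_homology: "(\<And>c. c \<in> simplicial_cycles r K p \<Longrightarrow> c + c + c \<in> simplicial_boundaries r K p) \<Longrightarrow>
      elementary_3_group (reduced_simplicial_homology_group r K p)"
    and nontrivial_homology: "c \<in> simplicial_cycles r K p \<Longrightarrow> c \<notin> simplicial_boundaries r K p \<Longrightarrow>
      \<not> trivial_group (reduced_simplicial_homology_group r K p)"
proof -
  let ?C = "simplicial_chain_group K"
  have grp: "group (?C q)" "comm_group (?C q)" for q
    by (simp_all add: simplicial_chain_group_def abelian_free_Abelian_group)
  have hom: "group_hom (?C q) (?C (q - 1)) (simplicial_boundary r)" for q
    using grp(1) simplicial_boundary_in_chain_group[OF K, of _ q r]
    by (auto simp: group_hom_def group_hom_axioms_def hom_def simplicial_boundary_add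
        simplicial_chain_group_def)
  let ?Z = "subgroup_generated (?C p) (simplicial_cycles r K p)" and ?B = "simplicial_boundaries r K p"
  have Z: "subgroup (simplicial_cycles r K p) (?C p)"
    unfolding simplicial_cycles_def by (rule group_hom.subgroup_kernel[OF hom])
  have B: "subgroup ?B (?C p)"
    using group_hom.img_is_subgroup[OF hom[of "p + 1"]] by (simp add: simplicial_boundaries_def)
  have carZ: "carrier ?Z = simplicial_cycles r K p"
    by (rule subgroup.carrier_subgroup_generated_subgroup[OF Z])
  have one: "one (?C q) = 0" for q
    by (simp add: simplicial_chain_group_def)
  then have "?B \<subseteq> simplicial_cycles r K p"
    using B simplicial_boundary_boundary[OF K r, of _ "p + 1"]
    by (auto simp: simplicial_cycles_def simplicial_boundaries_def kernel_def
        dest: subgroup.mem_carrier)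
  then have BZ: "subgroup ?B ?Z"
    using B carZ by (simp add: group.subgroup_of_subgroup_generated grp(1))
  have Zc: "comm_group ?Z"
    using grp by (simp add: group.abelian_subgroup_generated)
  then have Zg: "group ?Z" by (simp add: comm_group_def)
  have normal: "?B \<lhd> ?Z"
    by (rule comm_group.normal_iff_subgroup[THEN iffD2, OF Zc BZ])
  have comm: "comm_group (reduced_simplicial_homology_group r K p)"
    using K r by (rule comm_group_reduced_simplicial_homology_group)
  have H: "reduced_simplicial_homology_group r K p = ?Z Mod ?B"
    by (simp add: reduced_simplicial_homology_group_def)
  have pow: "c [^]\<^bsub>?Z\<^esub> (3::nat) = c + c + c" if "c \<in> simplicial_cycles r K p" for c
  proof -
    have "c [^]\<^bsub>?Z\<^esub> (3::nat) = frag_cmul 3 c"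
      using that by (simp add: pow_subgroup_generated simplicial_chain_group_def)
    also have "\<dots> = c + c + c"
      by (intro poly_mapping_eqI) (simp add: lookup_add)
    finally show ?thesis .
  qed
  show "elementary_3_group (reduced_simplicial_homology_group r K p)"
    if "\<And>c. c \<in> simplicial_cycles r K p \<Longrightarrow> c + c + c \<in> ?B"
    unfolding elementary_3_group_def
  proof (intro conjI ballI comm)
    fix x assume "x \<in> carrier (reduced_simplicial_homology_group r K p)"
    then obtain c where c: "c \<in> simplicial_cycles r K p" "x = ?B #>\<^bsub>?Z\<^esub> c"
      unfolding H carrier_FactGroup carZ by blast
    have "x [^]\<^bsub>?Z Mod ?B\<^esub> (3::nat) = ?B #>\<^bsub>?Z\<^esub> (c [^]\<^bsub>?Z\<^esub> (3::nat))"
      unfolding c(2) by (rule normal.FactGroup_pow[OF normal]) (simp add: carZ c(1))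
    also have "\<dots> = ?B"
      unfolding pow[OF c(1)] using that[OF c(1)] BZ Zg
      by (meson group.coset_join2 subgroup.mem_carrier)
    finally show "x [^]\<^bsub>reduced_simplicial_homology_group r K p\<^esub> (3::nat) = \<one>\<^bsub>reduced_simplicial_homology_group r K p\<^esub>"
      unfolding H by simp
  qed
  show "\<not> trivial_group (reduced_simplicial_homology_group r K p)"
    if c: "c \<in> simplicial_cycles r K p" "c \<notin> ?B"
  proof
    assume "trivial_group (reduced_simplicial_homology_group r K p)"
    then have "carrier (?Z Mod ?B) = {?B}"
      unfolding H trivial_group_def by simp
    then have "?B #>\<^bsub>?Z\<^esub> c = ?B"
      using c(1) by (auto simp: carrier_FactGroup carZ)
    then have "c \<in> ?B"
      using group.coset_join1[OF Zg _ _ BZ, of c] c(1) carZ subgroup.subset[OF BZ] by simp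
    then show False using c(2) by simp
  qed
qed

theorem theorem1p6:
  fixes n :: nat and r :: "(nat set \<times> nat set) set"
  assumes "n = 7 \<or> n = 10 \<or> n \<ge> 12" and "n \<noteq> 14"
    and "linear_order_on (complete_graph_edges n) r"
  shows "elementary_3_group (reduced_simplicial_homology_group r (matching_complex n) (nu n)) \<and>
    \<not> trivial_group (reduced_simplicial_homology_group r (matching_complex n) (nu n))"
proof -
  let ?K = "matching_complex n" and ?V = "{1..n}"
  obtain r' where r': "linear_order_on UNIV r'"
    "\<And>x y. x \<in> \<Union>?K \<Longrightarrow> y \<in> \<Union>?K \<Longrightarrow> (x, y) \<in> r' \<longleftrightarrow> (x, y) \<in> r"
    using linear_order_on_extends[OF assms(3)] unfolding vertices_matching_complex by metis
  interpret ordered_matching_chains r'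
    by unfold_locales (rule r'(1))
  define k where "k = (n + 1) div 3"
  have nu: "nu n = int k - 1"
    using floor_divide_of_nat_eq[where 'a = real, of "n + 1" 3] by (simp add: nu_def k_def add.commute)
  have chain_group: "carrier (simplicial_chain_group ?K (int j - 1)) = mchains ?V j" for j
    unfolding carrier_simplicial_chain_group faces_def matching_complex_eq mchains_def by auto
  have bd: "simplicial_boundary r c = simplicial_boundary r' c" if "c \<in> mchains ?V j" for c j
    by (rule simplicial_boundary_cong[of ?K])
      (use r'(2) that in \<open>auto simp: mchains_def matching_complex_eq\<close>)
  have cycles: "simplicial_cycles r ?K (nu n) = mcycles ?V k"
    using bd[of _ k] unfolding simplicial_cycles_def kernel_def nu chain_group mcycles_def
    by (auto simp: simplicial_chain_group_def)
  have boundaries: "simplicial_boundaries r ?K (nu n) = mbounds ?V k"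
  proof -
    have "nu n + 1 = int (Suc k) - 1" by (simp add: nu)
    then show ?thesis
      unfolding simplicial_boundaries_def mbounds_def by (simp only: chain_group) (auto simp: bd)
  qed
  have K: "abstract_simplicial_complex ?K" by (rule abstract_simplicial_complex_matching_complex)
  have r: "linear_order_on (\<Union>?K) r" using assms(3) by (simp add: vertices_matching_complex)
  have fin: "finite ?V" and card: "card ?V = n" and fresh: "0 \<notin> ?V" by auto
  have "\<exists>m. n = 3 * m \<or> n = Suc (3 * m) \<or> n = 3 * m + 2" by presburger
  then obtain m where "n = 3 * m \<or> n = Suc (3 * m) \<or> n = 3 * m + 2" ..
  then consider (block) "n = 3 * m \<or> n = Suc (3 * m)" | (pent) "n = 3 * m + 2" by blast
  then have "(\<forall>c\<in>mcycles ?V k. c + c + c \<in> mbounds ?V k) \<and> (\<exists>c\<in>mcycles ?V k. c \<notin> mbounds ?V k)"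
  proof cases
    case block
    then have "k = m" by (auto simp: k_def)
    have large: "m \<ge> 4 \<or> m \<ge> 2 \<and> card ?V = Suc (3 * m)"
      using block assms(1) unfolding card by presburger
    have "card ?V = 3 * m \<or> card ?V = Suc (3 * m)" using block by simp
    from three_cycle_bounds[OF fin this large] nonbounding_cycle[OF fin this fresh]
    show ?thesis unfolding \<open>k = m\<close> by metis
  next
    case pent
    then have "k = Suc m" by (simp add: k_def)
    \<comment> \<open>At least four blocks besides the pentagon; 14 vertices would leave only three.\<close>
    have "m \<ge> 5" using pent assms(1,2) by presburger
    then obtain i where i: "m = Suc i" by (cases m) auto
    have "card ?V = 3 * i + 5" using pent i by simp
    from nonbounding_pent_cycle[OF fin this] three_pent_cycle_bounds[OF fin _ \<open>m \<ge> 5\<close>] pent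
    show ?thesis unfolding \<open>k = Suc m\<close> i by (metis card)
  qed
  then show ?thesis
    using elementary_3_group_homology[OF K r, of "nu n"] nontrivial_homology[OF K r, of _ "nu n"]
    unfolding cycles boundaries by blast
qed

end
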